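(* Let $M$ be an existentially closed model of $T_3$ and let $C\leq M$ be a finite subgroup generated by at most $n$ elements. Then there is a subgroup $D$ with $C\leq D\leq M$ such that (1) $D$ is generated by at most $15n^2$ elements, and (2) the lower central series of $D$ coincides with its upper central series in reverse order, i.e. $\gamma_i(D)=Z_{4-i}(D)$ for every $1\leq i\leq 3$. In particular, $D\leq_{\mathrm{LCS}}M$.
   Context: $T_3$ is the first-order theory of groups (language $\{\cdot,{}^{-1},1\}$) satisfying $\forall x\,(x^3=1)$. A model $M$ of $T_3$ is existentially closed if for every finite tuple $\bar a$ in $M$, every extension $M\leq N$ with $N\models T_3$, and every quantifier-free formula $\varphi(\bar x,\bar y)$, $N\models\exists\bar x\,\varphi(\bar x,\bar a)$ implies $M\models\exists\bar x\,\varphi(\bar x,\bar a)$. Commutators: $[a,b]=aba^{-1}b^{-1}$ and $[a_1,\ldots,a_k]=[[a_1,\ldots,a_{k-1}],a_k]$. The lower central series of a group $G$ is $\gamma_1(G)=G$, $\gamma_{n+1}(G)=[\gamma_n(G),G]$. The upper central series is $Z_0(G)=1$ and $Z_n(G)=\{a\in G:[a,g_1,\ldots,g_n]=1\text{ for all }g_1,\ldots,g_n\in G\}$ for $n\geq1$. For groups $G\leq H$ of exponent $3$ (i.e. satisfying $x^3=1$), $G\leq_{\mathrm{LCS}}H$ means $\gamma_2(G)=\gamma_2(H)\cap G$ and $\gamma_3(G)=\gamma_3(H)\cap G$. *)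

theory Defs
  imports "HOL-Algebra.Algebra"
begin

definition model_T3 :: "('a, 'b) monoid_scheme \<Rightarrow> bool"
  where "model_T3 G \<longleftrightarrow> group G \<and> (\<forall>x\<in>carrier G. x [^]\<^bsub>G\<^esub> (3::nat) = \<one>\<^bsub>G\<^esub>)"

datatype (tm_vars: 'v) grp_term =
    Var 'v
  | One
  | Mult "'v grp_term" "'v grp_term"
  | Inv "'v grp_term"

datatype (qf_vars: 'v) qf_formula =
    Eq "'v grp_term" "'v grp_term"
  | Neg "'v qf_formula"
  | Conj "'v qf_formula" "'v qf_formula"
  | Disj "'v qf_formula" "'v qf_formula"

primrec tm_val :: "('a, 'b) monoid_scheme \<Rightarrow> ('v \<Rightarrow> 'a) \<Rightarrow> 'v grp_term \<Rightarrow> 'a" where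
  "tm_val G e (Var v) = e v"
| "tm_val G e One = \<one>\<^bsub>G\<^esub>"
| "tm_val G e (Mult s t) = tm_val G e s \<otimes>\<^bsub>G\<^esub> tm_val G e t"
| "tm_val G e (Inv t) = inv\<^bsub>G\<^esub> (tm_val G e t)"

primrec qf_sat :: "('a, 'b) monoid_scheme \<Rightarrow> ('v \<Rightarrow> 'a) \<Rightarrow> 'v qf_formula \<Rightarrow> bool" where
  "qf_sat G e (Eq s t) \<longleftrightarrow> tm_val G e s = tm_val G e t"
| "qf_sat G e (Neg p) \<longleftrightarrow> \<not> qf_sat G e p"
| "qf_sat G e (Conj p q) \<longleftrightarrow> qf_sat G e p \<and> qf_sat G e q"
| "qf_sat G e (Disj p q) \<longleftrightarrow> qf_sat G e p \<or> qf_sat G e q"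

text \<open>
  In a formula over \<^typ>\<open>nat + nat\<close>, the variable \<open>Inl i\<close> stands for the quantified variable
  \<open>x\<^sub>i\<close> and \<open>Inr j\<close> for the parameter variable \<open>y\<^sub>j\<close>. The statement
  \<open>ex_sat G k \<phi> as\<close> is \<open>G \<Turnstile> \<exists>x\<^sub>0 \<dots> x\<^sub>k\<^sub>-\<^sub>1. \<phi>(x, as)\<close>.
\<close>

definition tuple_env :: "'a list \<Rightarrow> 'a list \<Rightarrow> nat + nat \<Rightarrow> 'a"
  where "tuple_env xs as = case_sum (nth xs) (nth as)"

definition ex_sat :: "('a, 'b) monoid_scheme \<Rightarrow> nat \<Rightarrow> (nat + nat) qf_formula \<Rightarrow> 'a list \<Rightarrow> bool"
  where "ex_sat G k \<phi> as \<longleftrightarrow>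
    (\<exists>xs. length xs = k \<and> set xs \<subseteq> carrier G \<and> qf_sat G (tuple_env xs as) \<phi>)"

text \<open>
  Extensions of \<open>M\<close> are represented by embeddings \<open>h\<close> of \<open>M\<close> into a group \<open>N\<close>. HOL cannot
  quantify over the carrier type of \<open>N\<close> inside a definition, so a single carrier type with room
  for every extension of cardinality at most \<open>|M| + \<aleph>\<^sub>0\<close> is used. By a downward
  Loewenheim--Skolem argument this loses nothing: the theorem
  \<open>existentially_closed_T3_extension\<close> below derives the closure property for extensions over an
  arbitrary carrier type.
\<close>

definition existentially_closed_T3 :: "('a, 'b) monoid_scheme \<Rightarrow> bool"
  where "existentially_closed_T3 M \<longleftrightarrow> model_T3 M \<and>
    (\<forall>(N :: ('a + nat) monoid) h as k \<phi>.
       model_T3 N \<longrightarrow> h \<in> hom M N \<longrightarrow> inj_on h (carrier M) \<longrightarrow>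
       set as \<subseteq> carrier M \<longrightarrow> qf_vars \<phi> \<subseteq> Inl ` {..<k} \<union> Inr ` {..<length as} \<longrightarrow>
       ex_sat N k \<phi> (map h as) \<longrightarrow> ex_sat M k \<phi> as)"

definition commutator :: "('a, 'b) monoid_scheme \<Rightarrow> 'a \<Rightarrow> 'a \<Rightarrow> 'a"
  where "commutator G a b = a \<otimes>\<^bsub>G\<^esub> b \<otimes>\<^bsub>G\<^esub> inv\<^bsub>G\<^esub> a \<otimes>\<^bsub>G\<^esub> inv\<^bsub>G\<^esub> b"

definition commutator_subgroup :: "('a, 'b) monoid_scheme \<Rightarrow> 'a set \<Rightarrow> 'a set \<Rightarrow> 'a set"
  where "commutator_subgroup G A B = generate G {commutator G a b | a b. a \<in> A \<and> b \<in> B}"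

text \<open>The lower central series starts at index 1; the value at 0 is a dummy.\<close>

fun lower_central :: "('a, 'b) monoid_scheme \<Rightarrow> nat \<Rightarrow> 'a set" where
  "lower_central G 0 = carrier G"
| "lower_central G (Suc 0) = carrier G"
| "lower_central G (Suc (Suc n)) = commutator_subgroup G (lower_central G (Suc n)) (carrier G)"

text \<open>
  The iterated commutator \<open>[a, g\<^sub>1, \<dots>, g\<^sub>n]\<close> is left-normed, hence a left fold; for \<open>n = 0\<close> it
  is \<open>a\<close> itself, which gives \<open>Z\<^sub>0(G) = 1\<close>.
\<close>

definition upper_central :: "('a, 'b) monoid_scheme \<Rightarrow> nat \<Rightarrow> 'a set"
  where "upper_central G n = {a \<in> carrier G.
    \<forall>gs. length gs = n \<longrightarrow> set gs \<subseteq> carrier G \<longrightarrow> foldl (commutator G) a gs = \<one>\<^bsub>G\<^esub>}"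

definition LCS_subgroup :: "'a set \<Rightarrow> ('a, 'b) monoid_scheme \<Rightarrow> bool"
  where "LCS_subgroup G H \<longleftrightarrow> subgroup G H \<and>
    lower_central (H\<lparr>carrier := G\<rparr>) 2 = lower_central H 2 \<inter> G \<and>
    lower_central (H\<lparr>carrier := G\<rparr>) 3 = lower_central H 3 \<inter> G"

definition generated_by_at_most :: "('a, 'b) monoid_scheme \<Rightarrow> 'a set \<Rightarrow> nat \<Rightarrow> bool"
  where "generated_by_at_most G H n \<longleftrightarrow>
    (\<exists>S. S \<subseteq> carrier G \<and> finite S \<and> card S \<le> n \<and> generate G S = H)"

lemma tm_val_hom:
  assumes "group G" "group H" "h \<in> hom G H"
    and "\<And>v. v \<in> tm_vars t \<Longrightarrow> e v \<in> carrier G \<and> e' v = h (e v)"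
  shows "tm_val G e t \<in> carrier G \<and> tm_val H e' t = h (tm_val G e t)"
proof -
  interpret group_hom G H h
    using assms(1-3) by (simp add: group_hom_def group_hom_axioms_def)
  show ?thesis
    using assms(4) by (induction t) auto
qed

lemma qf_sat_embedding:
  assumes "group G" "group H" "h \<in> hom G H" "inj_on h (carrier G)"
    and "\<And>v. v \<in> qf_vars p \<Longrightarrow> e v \<in> carrier G \<and> e' v = h (e v)"
  shows "qf_sat H e' p \<longleftrightarrow> qf_sat G e p"
  using assms(5)
proof (induction p)
  case (Eq s t)
  have "tm_val G e s \<in> carrier G \<and> tm_val H e' s = h (tm_val G e s)"
    by (rule tm_val_hom[OF assms(1-3)]) (use Eq in auto)
  moreover have "tm_val G e t \<in> carrier G \<and> tm_val H e' t = h (tm_val G e t)"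
    by (rule tm_val_hom[OF assms(1-3)]) (use Eq in auto)
  ultimately show ?case
    using assms(4) by (auto dest: inj_onD)
qed auto

lemma generate_embeds:
  fixes g :: "'i \<Rightarrow> 'c" and N :: "('c, 'd) monoid_scheme"
  assumes "group N" "infinite (UNIV :: 'i set)" "range g \<subseteq> carrier N"
    and inv: "\<And>i. \<exists>j. g j = inv\<^bsub>N\<^esub> (g i)"
  shows "\<exists>f :: 'c \<Rightarrow> 'i. inj_on f (generate N (range g))"
proof -
  interpret group N by fact
  define ev where "ev l = foldr (\<lambda>i y. g i \<otimes>\<^bsub>N\<^esub> y) l \<one>\<^bsub>N\<^esub>" for l :: "'i list"
  have ev_carrier: "ev l \<in> carrier N" for l
    unfolding ev_def using assms(3) by (induction l) auto
  have ev_append: "ev (l @ l') = ev l \<otimes>\<^bsub>N\<^esub> ev l'" for l l'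
    using assms(3) ev_carrier by (induction l) (auto simp: ev_def m_assoc image_subset_iff)
  have ev_single: "ev [i] = g i" for i
    using assms(3) by (simp add: ev_def image_subset_iff)
  have "generate N (range g) \<subseteq> range ev"
  proof
    fix x assume "x \<in> generate N (range g)"
    then show "x \<in> range ev"
    proof (induction rule: generate.induct)
      case one
      have "ev [] = \<one>\<^bsub>N\<^esub>" by (simp add: ev_def)
      then show ?case by (metis rangeI)
    next
      case (incl h)
      then obtain i where "h = ev [i]" using ev_single by auto
      then show ?case by blast
    next
      case (inv h)
      then obtain i where "h = g i" by blast
      then obtain j where "inv\<^bsub>N\<^esub> h = ev [j]" using assms(4)[of i] ev_single by metis
      then show ?case by blast
    next
      case (eng h1 h2)
      then obtain l l' where "h1 = ev l" "h2 = ev l'" by blast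
      then have "h1 \<otimes>\<^bsub>N\<^esub> h2 = ev (l @ l')" by (simp add: ev_append)
      then show ?case by blast
    qed
  qed
  then have inj_ev: "inj_on (inv_into UNIV ev) (generate N (range g))"
    by (meson inj_on_inv_into inj_on_subset)
  have "|lists (UNIV :: 'i set)| =o |UNIV :: 'i set|"
    by (rule card_of_lists_infinite) fact
  then obtain c :: "'i list \<Rightarrow> 'i" where "inj c"
    unfolding card_of_ordIso[symmetric] bij_betw_def by auto
  then have "inj_on (c \<circ> inv_into UNIV ev) (generate N (range g))"
    using inj_ev by (meson comp_inj_on inj_on_subset subset_UNIV)
  then show ?thesis by blast
qed

theorem existentially_closed_T3_extension:
  fixes M :: "('a, 'b) monoid_scheme" and N :: "('c, 'd) monoid_scheme"
  assumes ec: "existentially_closed_T3 M"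
    and N: "model_T3 N" "h \<in> hom M N" "inj_on h (carrier M)"
    and as: "set as \<subseteq> carrier M"
    and vars: "qf_vars \<phi> \<subseteq> Inl ` {..<k} \<union> Inr ` {..<length as}"
    and sat: "ex_sat N k \<phi> (map h as)"
  shows "ex_sat M k \<phi> as"
proof -
  interpret M: group M using ec by (simp add: existentially_closed_T3_def model_T3_def)
  interpret N: group N using N by (simp add: model_T3_def)
  interpret h: group_hom M N h using N(2) by unfold_locales
  obtain xs where xs: "length xs = k" "set xs \<subseteq> carrier N"
      "qf_sat N (tuple_env xs (map h as)) \<phi>"
    using sat by (auto simp: ex_sat_def)
  define ys where "ys = xs @ map (\<lambda>x. inv\<^bsub>N\<^esub> x) xs"
  define g :: "'a + nat \<Rightarrow> 'c" where "g = case_sum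
    (\<lambda>a. if a \<in> carrier M then h a else \<one>\<^bsub>N\<^esub>) (\<lambda>i. if i < length ys then ys ! i else \<one>\<^bsub>N\<^esub>)"
  define K where "K = generate N (range g)"
  have ys_carrier: "set ys \<subseteq> carrier N"
    using xs(2) by (auto simp: ys_def)
  have g_carrier: "range g \<subseteq> carrier N"
    using ys_carrier by (auto simp: g_def split: sum.splits intro!: nth_mem[THEN subsetD[rotated]])
  have ys_g: "y \<in> range g" if "y \<in> set ys" for y
  proof -
    obtain i where "i < length ys" "ys ! i = y" using \<open>y \<in> set ys\<close> by (meson in_set_conv_nth)
    then have "g (Inr i) = y" by (simp add: g_def)
    then show ?thesis by blast
  qed
  have one_g: "\<one>\<^bsub>N\<^esub> \<in> range g"
  proof -
    have "g (Inr (length ys)) = \<one>\<^bsub>N\<^esub>" by (simp add: g_def)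
    then show ?thesis by (metis rangeI)
  qed
  have h_g: "h a \<in> range g" if "a \<in> carrier M" for a
  proof -
    have "g (Inl a) = h a" using that by (simp add: g_def)
    then show ?thesis by (metis rangeI)
  qed
  have inv_g: "\<exists>j. g j = inv\<^bsub>N\<^esub> (g i)" for i
  proof -
    have "inv\<^bsub>N\<^esub> (g i) \<in> range g"
    proof (cases i)
      case (Inl a)
      then show ?thesis
        using one_g h_g[of "inv\<^bsub>M\<^esub> a"] by (auto simp: g_def)
    next
      case (Inr j)
      show ?thesis
      proof (cases "j < length ys")
        case True
        then have "ys ! j \<in> set ys" by simp
        then have "inv\<^bsub>N\<^esub> (ys ! j) \<in> set ys"
          using xs(2) by (force simp: ys_def)
        then show ?thesis using ys_g True Inr by (simp add: g_def)
      next
        case False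
        then show ?thesis using one_g Inr by (simp add: g_def)
      qed
    qed
    then show ?thesis by (metis rangeE)
  qed
  have K: "subgroup K N"
    unfolding K_def by (rule N.generate_is_subgroup[OF g_carrier])
  have hK: "h ` carrier M \<subseteq> K" and xsK: "set xs \<subseteq> K"
    using h_g ys_g by (auto simp: K_def ys_def intro: generate.incl)
  define NK where "NK = N\<lparr>carrier := K\<rparr>"
  have grp_NK: "group NK"
    unfolding NK_def using K by (rule N.subgroup_imp_group)
  interpret NK: group NK by fact
  have NK_simps [simp]: "carrier NK = K" "x \<otimes>\<^bsub>NK\<^esub> y = x \<otimes>\<^bsub>N\<^esub> y" "\<one>\<^bsub>NK\<^esub> = \<one>\<^bsub>N\<^esub>" for x y
    by (simp_all add: NK_def)
  have "infinite (UNIV :: ('a + nat) set)"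
    by (simp add: finite_Plus_UNIV_iff)
  then obtain f :: "'c \<Rightarrow> 'a + nat" where f: "inj_on f K"
    using generate_embeds[OF N.is_group _ g_carrier inv_g] unfolding K_def by blast
  define f' where "f' = inv_into K f"
  have f'f [simp]: "f' (f x) = x" if "x \<in> K" for x
    using f that by (simp add: f'_def)
  define P :: "('a + nat) monoid" where
    "P = \<lparr>carrier = f ` K, monoid.mult = (\<lambda>x y. f (f' x \<otimes>\<^bsub>N\<^esub> f' y)), one = f \<one>\<^bsub>N\<^esub>\<rparr>"
  have f_hom: "f \<in> hom NK P"
    by (auto simp: hom_def P_def)
  have P_img: "P = P\<lparr>carrier := f ` carrier NK, one := f \<one>\<^bsub>NK\<^esub>\<rparr>"
    by (simp add: P_def)
  have grp_P: "group P"
    using NK.hom_imp_img_group[OF f_hom] P_img by simp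
  interpret P: group P by fact
  interpret f: group_hom NK P f using f_hom by unfold_locales
  have pow_NK: "x [^]\<^bsub>NK\<^esub> n = x [^]\<^bsub>N\<^esub> n" for x and n :: nat
    by (induction n) (simp_all add: nat_pow_def)
  have T3: "model_T3 P"
    unfolding model_T3_def
  proof (intro conjI ballI)
    fix z assume "z \<in> carrier P"
    then obtain x where x: "x \<in> K" "z = f x" by (auto simp: P_def)
    have "z [^]\<^bsub>P\<^esub> (3::nat) = f (x [^]\<^bsub>NK\<^esub> (3::nat))"
      using f.hom_nat_pow[of x 3] x by simp
    also have "x [^]\<^bsub>NK\<^esub> (3::nat) = \<one>\<^bsub>NK\<^esub>"
      using N(1) x(1) subgroup.subset[OF K] by (auto simp: pow_NK model_T3_def)
    finally show "z [^]\<^bsub>P\<^esub> (3::nat) = \<one>\<^bsub>P\<^esub>" using f.hom_one by simp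
  qed (fact grp_P)
  have vars_K: "tuple_env xs (map h as) v \<in> K \<and>
      tuple_env (map f xs) (map (f \<circ> h) as) v = f (tuple_env xs (map h as) v)"
    if v: "v \<in> qf_vars \<phi>" for v
  proof (cases v)
    case (Inl i)
    then have "i < length xs" using v vars xs(1) by auto
    then show ?thesis using Inl xsK nth_mem by (fastforce simp: tuple_env_def)
  next
    case (Inr j)
    then have "j < length as" using v vars by auto
    moreover from this have "as ! j \<in> carrier M" using as nth_mem by blast
    ultimately show ?thesis using Inr hK by (auto simp: tuple_env_def)
  qed
  have "id \<in> hom NK N"
    using subgroup.subset[OF K] by (auto simp: hom_def)
  then have "qf_sat N (tuple_env xs (map h as)) \<phi> \<longleftrightarrow> qf_sat NK (tuple_env xs (map h as)) \<phi>"
    by (intro qf_sat_embedding[where h = id]) (use vars_K in \<open>auto intro: N.is_group grp_NK\<close>)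
  moreover have "qf_sat P (tuple_env (map f xs) (map (f \<circ> h) as)) \<phi> \<longleftrightarrow>
      qf_sat NK (tuple_env xs (map h as)) \<phi>"
    by (rule qf_sat_embedding[OF grp_NK grp_P f_hom]) (use f vars_K in auto)
  ultimately have "ex_sat P k \<phi> (map (f \<circ> h) as)"
    unfolding ex_sat_def using xs xsK
    by (intro exI[of _ "map f xs"]) (auto simp: P_def)
  moreover have "f \<circ> h \<in> hom M P"
    using f_hom hK N(2) by (auto simp: hom_def)
  moreover have "inj_on (f \<circ> h) (carrier M)"
    using N(3) f hK by (meson comp_inj_on inj_on_subset)
  ultimately show ?thesis
    using ec T3 as vars unfolding existentially_closed_T3_def by blast
qed

end

theory Submission
  imports Defs
begin

text \<open>
  Groups of exponent 3 have class at most 3, and the triple commutator is alternating and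
  trilinear. Over any such group \<open>M\<close> a generic element \<open>a\<close> can be adjoined: the normal closure of
  \<open>a\<close> is built from the Baer (abelian) group of \<open>M/\<gamma>\<^sub>3(M)\<close>, so that \<open>[a, m] = 1\<close> forces
  \<open>m \<in> \<gamma>\<^sub>3(M)\<close> and \<open>[a, m] \<in> \<gamma>\<^sub>3\<close> forces \<open>m \<in> \<gamma>\<^sub>2(M)\<close>.

  Two generic elements \<open>x, y\<close> may be subjected to \<open>[x, y] = c\<close> for \<open>c \<in> \<gamma>\<^sub>2(M)\<close>, and three to
  \<open>[x, y, t] = z\<close> for \<open>z \<in> \<gamma>\<^sub>3(M)\<close>, without collapsing \<open>M\<close>. Since \<open>M\<close> is existentially closed,
  finite pieces of these extensions already occur in \<open>M\<close>, where generic elements serve as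
  witnesses that nothing new falls into \<open>\<gamma>\<^sub>2(M)\<close> or \<open>\<gamma>\<^sub>3(M)\<close>. At most \<open>n\<close> steps of the first kind
  and \<open>n + n\<^sup>2\<close> of the second give \<open>D \<inter> \<gamma>\<^sub>i(M) = \<gamma>\<^sub>i(D)\<close>; adjoining two further generic elements
  then makes the centres of \<open>D\<close> as small as possible. The total number of generators is
  \<open>3n\<^sup>2 + 6n + 2 \<le> 15n\<^sup>2\<close>.
\<close>

section \<open>Groups of exponent 3\<close>

text \<open>Existential closedness carries only the multiplication table of a finite piece into M,
  whereas membership in \<open>\<gamma>\<^sub>i(M)\<close> may be witnessed anywhere in M, so an
  element could slip into \<open>\<gamma>\<^sub>i(M)\<close> unnoticed. Genericity turns
  non-membership into finite facts: d outside \<open>\<gamma>\<^sub>3\<close> is a failure of [a, d]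
  = 1, and d outside \<open>\<gamma>\<^sub>2\<close> is a failure of [t, [a, d]] = 1 with a second
  generic t.

  Imposing w = 1 is safe only if the normal closure of w meets M trivially. This is checked by
  projecting the generic elements away one after another.

  The step counts are indices: \<open>\<gamma>\<^sub>2(C)\<close> has index at most 3^n in C,
  \<open>\<gamma>\<^sub>3(C)\<close> has index at most 3^(n^2) in
  \<open>\<gamma>\<^sub>2(C)\<close>, and each step at least triples the part of C already absorbed.

  One final generic element a would not do: [a, l] is central as soon as l is central modulo
  \<open>\<gamma>\<^sub>3\<close>. The base must first lose such l outside
  \<open>\<gamma>\<^sub>2\<close>, and this is the work of the first of the two.\<close>

locale exponent3_group = group G for G (structure) +
  assumes cube: "x \<in> carrier G \<Longrightarrow> x \<otimes> x \<otimes> x = \<one>"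
begin

abbreviation cm :: "'a \<Rightarrow> 'a \<Rightarrow> 'a"
  where "cm \<equiv> commutator G"

lemma cm_closed [simp, intro]: "x \<in> carrier G \<Longrightarrow> y \<in> carrier G \<Longrightarrow> cm x y \<in> carrier G"
  by (simp add: commutator_def)

lemma inv_cancel:
  assumes "x \<in> carrier G" "y \<in> carrier G"
  shows "x \<otimes> (inv x \<otimes> y) = y" "inv x \<otimes> (x \<otimes> y) = y"
  using assms by (simp_all add: m_assoc[symmetric])

lemmas word = m_assoc inv_mult_group inv_cancel commutator_def

lemma cm_swap: "x \<in> carrier G \<Longrightarrow> y \<in> carrier G \<Longrightarrow> x \<otimes> y = cm x y \<otimes> (y \<otimes> x)"
  by (simp add: word)

lemma inv_cm: "x \<in> carrier G \<Longrightarrow> y \<in> carrier G \<Longrightarrow> inv (cm x y) = cm y x"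
  by (simp add: word)

lemma cm_eq_one_iff:
  assumes "x \<in> carrier G" "y \<in> carrier G"
  shows "cm x y = \<one> \<longleftrightarrow> x \<otimes> y = y \<otimes> x"
proof
  assume "cm x y = \<one>" then show "x \<otimes> y = y \<otimes> x" using cm_swap[OF assms] assms by simp
next
  assume "x \<otimes> y = y \<otimes> x" then show "cm x y = \<one>"
    using assms by (simp add: commutator_def) (simp add: word)
qed

lemma inv_square: "x \<in> carrier G \<Longrightarrow> x \<otimes> x = inv x"
  using cube by (metis inv_equality m_closed)

lemma square_eq_one: "x \<in> carrier G \<Longrightarrow> x \<otimes> x = \<one> \<Longrightarrow> x = \<one>"
  using cube by force

text \<open>For A and B the conjugates of x by y and by y^-1, the cubes of x y and of x y^-1 say
  that x A B and x B A are trivial. So x A and A x are both the inverse of B.\<close>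

lemma commute_conj:
  assumes "x \<in> carrier G" "y \<in> carrier G"
  shows "x \<otimes> (y \<otimes> x \<otimes> inv y) = y \<otimes> x \<otimes> inv y \<otimes> x"
proof -
  define A where "A = y \<otimes> x \<otimes> inv y"
  define B where "B = inv y \<otimes> x \<otimes> y"
  have c [simp]: "A \<in> carrier G" "B \<in> carrier G" using assms by (auto simp: A_def B_def)
  have i: "inv y = y \<otimes> y" using assms inv_square by simp
  have "x \<otimes> A \<otimes> B = x \<otimes> y \<otimes> x \<otimes> (inv y \<otimes> inv y) \<otimes> x \<otimes> y"
    using assms by (simp add: A_def B_def m_assoc)
  also have "inv y \<otimes> inv y = y" using assms inv_square[of "inv y"] by simp
  also have "x \<otimes> y \<otimes> x \<otimes> y \<otimes> x \<otimes> y = \<one>"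
    using cube[of "x \<otimes> y"] assms by (simp add: m_assoc)
  finally have 1: "x \<otimes> A \<otimes> B = \<one>" .
  have "x \<otimes> B \<otimes> A = x \<otimes> inv y \<otimes> x \<otimes> (y \<otimes> y) \<otimes> x \<otimes> inv y"
    using assms by (simp add: A_def B_def m_assoc)
  also have "y \<otimes> y = inv y" using i by simp
  also have "x \<otimes> inv y \<otimes> x \<otimes> inv y \<otimes> x \<otimes> inv y = \<one>"
    using cube[of "x \<otimes> inv y"] assms by (simp add: m_assoc)
  finally have 2: "x \<otimes> B \<otimes> A = \<one>" .
  have "x \<otimes> A = inv B" using 1 assms by (metis inv_equality inv_inv c m_closed)
  moreover have "A \<otimes> x = inv B"
    using 2 assms c by (smt (verit) inv_equality inv_unique l_cancel m_assoc m_closed inv_comm r_inv)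
  ultimately show ?thesis by (simp add: A_def)
qed

section \<open>The abelian normal closure of one element, and class at most 3\<close>

definition conjs :: "'a \<Rightarrow> 'a set"
  where "conjs x = generate G {g \<otimes> x \<otimes> inv g | g. g \<in> carrier G}"

lemma conjs_subgroup: "x \<in> carrier G \<Longrightarrow> subgroup (conjs x) G"
  unfolding conjs_def by (rule generate_is_subgroup) auto

lemma conjs_carrier: "x \<in> carrier G \<Longrightarrow> a \<in> conjs x \<Longrightarrow> a \<in> carrier G"
  using conjs_subgroup subgroup.mem_carrier by fastforce

lemma conjs_self: "x \<in> carrier G \<Longrightarrow> x \<in> conjs x"
  unfolding conjs_def by (rule generate.incl) (force intro: exI[of _ \<one>])

lemma generate_commute:
  assumes "S \<subseteq> carrier G" "y \<in> carrier G" "\<And>s. s \<in> S \<Longrightarrow> s \<otimes> y = y \<otimes> s" "a \<in> generate G S"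
  shows "a \<otimes> y = y \<otimes> a"
  using assms(4)
proof (induction rule: generate.induct)
  case (inv h)
  then have "h \<in> carrier G" "h \<otimes> y = y \<otimes> h" using assms by auto
  then show ?case using assms(2)
    by (metis inv_solve_left' inv_solve_right m_assoc inv_closed m_closed)
next
  case (eng h1 h2)
  then have "h1 \<in> carrier G" "h2 \<in> carrier G" using assms(1) generate_in_carrier by blast+
  then show ?case using eng assms(2) by (metis m_assoc)
qed (use assms in auto)

text \<open>Up to a common conjugation, two conjugates of x are x itself and a conjugate of x, so
  \<open>commute_conj\<close> applies to the generators.\<close>

lemma conjs_commute:
  assumes x: "x \<in> carrier G" and "a \<in> conjs x" "b \<in> conjs x"
  shows "a \<otimes> b = b \<otimes> a"
proof -
  let ?S = "{g \<otimes> x \<otimes> inv g | g. g \<in> carrier G}"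
  have S: "?S \<subseteq> carrier G" using x by auto
  have gens: "s \<otimes> t = t \<otimes> s" if "s \<in> ?S" "t \<in> ?S" for s t
  proof -
    obtain g h where g: "g \<in> carrier G" "s = g \<otimes> x \<otimes> inv g" and h: "h \<in> carrier G" "t = h \<otimes> x \<otimes> inv h"
      using \<open>s \<in> ?S\<close> \<open>t \<in> ?S\<close> by blast
    define k where "k = inv g \<otimes> h"
    have k: "k \<in> carrier G" using g h by (simp add: k_def)
    have "s \<otimes> t = g \<otimes> (x \<otimes> (k \<otimes> x \<otimes> inv k)) \<otimes> inv g"
      using g h x by (simp add: k_def word)
    also have "\<dots> = g \<otimes> (k \<otimes> x \<otimes> inv k \<otimes> x) \<otimes> inv g"
      using commute_conj[OF x k] by simp
    also have "\<dots> = t \<otimes> s"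
      using g h x by (simp add: k_def word)
    finally show ?thesis .
  qed
  have b: "b \<in> carrier G" using assms conjs_carrier by blast
  have tb: "t \<otimes> b = b \<otimes> t" if t: "t \<in> ?S" for t
  proof -
    have "t \<in> carrier G" using S t by blast
    then show ?thesis
      by (rule generate_commute[OF S _ _ assms(3)[unfolded conjs_def], symmetric]) (rule gens[OF _ t])
  qed
  show ?thesis
    by (rule generate_commute[OF S b _ assms(2)[unfolded conjs_def]]) (rule tb)
qed

lemma conjs_conj:
  assumes x: "x \<in> carrier G" and g: "g \<in> carrier G" and "a \<in> conjs x"
  shows "g \<otimes> a \<otimes> inv g \<in> conjs x"
proof -
  let ?S = "{g \<otimes> x \<otimes> inv g | g. g \<in> carrier G}"
  have A: "subgroup (conjs x) G" using conjs_subgroup[OF x] .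
  have S: "?S \<subseteq> carrier G" using x by auto
  have gen: "g \<otimes> s \<otimes> inv g \<in> conjs x" if s: "s \<in> ?S" for s
  proof -
    obtain h where h: "h \<in> carrier G" "s = h \<otimes> x \<otimes> inv h" using s by blast
    then have "g \<otimes> s \<otimes> inv g = (g \<otimes> h) \<otimes> x \<otimes> inv (g \<otimes> h)" using x g by (simp add: word)
    then show ?thesis unfolding conjs_def using g h by (intro generate.incl) blast
  qed
  show ?thesis using assms(3)[unfolded conjs_def]
  proof (induction rule: generate.induct)
    case one then show ?case using g subgroup.one_closed[OF A] by simp
  next
    case (incl h) then show ?case using gen by blast
  next
    case (inv h)
    then have h: "h \<in> carrier G" using S by blast
    have "inv (g \<otimes> h \<otimes> inv g) \<in> conjs x" using gen[OF inv] subgroup.m_inv_closed[OF A] by simp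
    then show ?case using g h by (simp add: word)
  next
    case (eng h1 h2)
    have c: "h1 \<in> carrier G" "h2 \<in> carrier G"
      using eng S generate_in_carrier by blast+
    have "(g \<otimes> h1 \<otimes> inv g) \<otimes> (g \<otimes> h2 \<otimes> inv g) \<in> conjs x"
      using eng subgroup.m_closed[OF A] by simp
    then show ?case using g c by (simp add: word)
  qed
qed

lemma cm_conjs:
  assumes "x \<in> carrier G" "g \<in> carrier G" "a \<in> conjs x"
  shows "cm g a \<in> conjs x"
proof -
  interpret A: subgroup "conjs x" G using conjs_subgroup assms by blast
  show ?thesis unfolding commutator_def using conjs_conj assms by auto
qed

text \<open>[g, a] is g times the conjugate a g^-1 a^-1 of g^-1, and g commutes with both
  factors.\<close>

lemma cm_cm_same:
  assumes "g \<in> carrier G" "a \<in> carrier G"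
  shows "cm g (cm g a) = \<one>"
proof -
  define W where "W = a \<otimes> inv g \<otimes> inv a"
  have W: "W \<in> carrier G" using assms by (simp add: W_def)
  have "g \<otimes> W = W \<otimes> g"
  proof -
    have "inv g \<otimes> W = W \<otimes> inv g"
      using commute_conj[of "inv g" a] assms by (simp add: W_def)
    then have "g \<otimes> (inv g \<otimes> W) \<otimes> g = g \<otimes> (W \<otimes> inv g) \<otimes> g" by simp
    then show ?thesis using assms W by (simp add: m_assoc inv_cancel)
  qed
  then have "g \<otimes> (g \<otimes> W) = g \<otimes> W \<otimes> g"
    using assms W by (metis m_assoc)
  moreover have "cm g a = g \<otimes> W" using assms by (simp add: W_def word)
  ultimately have "g \<otimes> cm g a = cm g a \<otimes> g" by simp
  then show ?thesis using cm_eq_one_iff assms by simp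
qed

text \<open>From here on the abelian group \<open>conjs x\<close> is read additively as a module:
  \<open>cm g\<close> is the endomorphism g - 1, and \<open>cm_prod_conjs\<close> is the identity gh
  - 1 = (g - 1)(h - 1) + (h - 1) + (g - 1).\<close>

lemma cm_mult_conjs:
  assumes x: "x \<in> carrier G" and g: "g \<in> carrier G" and ab: "a \<in> conjs x" "b \<in> conjs x"
  shows "cm g (a \<otimes> b) = cm g a \<otimes> cm g b"
proof -
  have c: "a \<in> carrier G" "b \<in> carrier G" using x ab conjs_carrier by auto
  have "cm g (a \<otimes> b) = g \<otimes> a \<otimes> inv g \<otimes> (cm g b \<otimes> inv a)" using g c by (simp add: word)
  also have "cm g b \<otimes> inv a = inv a \<otimes> cm g b"
    using conjs_commute[OF x cm_conjs[OF x g ab(2)]] ab(1) conjs_subgroup[OF x]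
    by (meson subgroup.m_inv_closed)
  also have "g \<otimes> a \<otimes> inv g \<otimes> (inv a \<otimes> cm g b) = cm g a \<otimes> cm g b" using g c by (simp add: word)
  finally show ?thesis .
qed

lemma cm_prod_conjs:
  assumes x: "x \<in> carrier G" and g: "g \<in> carrier G" "h \<in> carrier G" and a: "a \<in> conjs x"
  shows "cm (g \<otimes> h) a = cm g (cm h a) \<otimes> cm h a \<otimes> cm g a"
  using assms conjs_carrier[OF x a] by (simp add: word)

lemma cm_one: "g \<in> carrier G \<Longrightarrow> cm g \<one> = \<one>" "g \<in> carrier G \<Longrightarrow> cm \<one> g = \<one>"
  by (simp_all add: commutator_def)

lemma cm_inv_conjs:
  assumes x: "x \<in> carrier G" and g: "g \<in> carrier G" and a: "a \<in> conjs x"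
  shows "cm g (inv a) = inv (cm g a)"
proof -
  have i: "inv a \<in> conjs x" using a conjs_subgroup[OF x] by (meson subgroup.m_inv_closed)
  have "cm g (inv a) \<otimes> cm g a = \<one>"
    using cm_mult_conjs[OF x g i a] conjs_carrier[OF x a] g by (simp add: cm_one)
  then show ?thesis using x a g by (metis cm_closed conjs_carrier inv_closed inv_equality)
qed

context
  fixes x assumes x: "x \<in> carrier G"
begin

text \<open>Put u = g - 1 and v = h - 1 on \<open>conjs x\<close>. By \<open>cm_cm_same\<close>, u^2
  = v^2 = (gh - 1)^2 = 0, and the last square expands to uvuv + uvu + vuv + vu + uv = 0, which is
  \<open>key\<close>. It yields uvu = 0 and then uv = -vu.\<close>

lemma cm_three_same:
  assumes g: "g \<in> carrier G" and h: "h \<in> carrier G" and a: "a \<in> conjs x"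
  shows "cm g (cm h (cm g a)) = \<one>"
    and "cm g (cm h a) = inv (cm h (cm g a))"
proof -
  interpret A: subgroup "conjs x" G using conjs_subgroup[OF x] .
  have K [simp]: "cm k b \<in> conjs x" if "k \<in> carrier G" "b \<in> conjs x" for k b
    using cm_conjs[OF x] that by blast
  have C [simp]: "b \<in> carrier G" if "b \<in> conjs x" for b using conjs_carrier[OF x that] .
  note M = cm_mult_conjs[OF x]
  note [simp] = cm_cm_same cm_one
  have key: "cm g (cm h (cm g (cm h b))) \<otimes> cm g (cm h (cm g b)) \<otimes> cm h (cm g (cm h b)) \<otimes>
      cm h (cm g b) \<otimes> cm g (cm h b) = \<one>"
    if g: "g \<in> carrier G" and h: "h \<in> carrier G" and b: "b \<in> conjs x" for g h b
  proof -
    have "cm (g \<otimes> h) (cm (g \<otimes> h) b) = \<one>" using g h b by simp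
    moreover have "cm (g \<otimes> h) (cm (g \<otimes> h) b) =
      cm g (cm h (cm g (cm h b) \<otimes> cm h b \<otimes> cm g b)) \<otimes>
      cm h (cm g (cm h b) \<otimes> cm h b \<otimes> cm g b) \<otimes> cm g (cm g (cm h b) \<otimes> cm h b \<otimes> cm g b)"
      using g h b by (simp add: cm_prod_conjs[OF x])
    ultimately show ?thesis using g h b by (simp add: M m_assoc)
  qed
  have uvu: "cm g (cm h (cm g b)) = \<one>" if g: "g \<in> carrier G" and h: "h \<in> carrier G" and b: "b \<in> conjs x" for g h b
  proof -
    \<comment> \<open>This a satisfies b = (1 + v) a. Applying u to \<open>key\<close> at a leaves
      uvuv a + uvu a = 0, and the left side is uvu b.\<close>
    define a where "a = inv h \<otimes> b \<otimes> h"
    have a: "a \<in> conjs x" using conjs_conj[OF x, of "inv h" b] h b by (simp add: a_def)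
    have ba: "b = cm h a \<otimes> a" using h b by (simp add: a_def word)
    have "cm g \<one> = \<one>" using g by simp
    then have "cm g (cm g (cm h (cm g (cm h a))) \<otimes> cm g (cm h (cm g a)) \<otimes> cm h (cm g (cm h a)) \<otimes>
      cm h (cm g a) \<otimes> cm g (cm h a)) = \<one>" using key[OF g h a] by simp
    then have "cm g (cm h (cm g (cm h a))) \<otimes> cm g (cm h (cm g a)) = \<one>"
      using g h a by (simp add: M)
    then show ?thesis using g h a by (simp add: ba M)
  qed
  show "cm g (cm h (cm g a)) = \<one>" using uvu g h a by blast
  have "cm h (cm g a) \<otimes> cm g (cm h a) = \<one>"
    using key[OF g h a] uvu[OF g h a] uvu[OF h g a] uvu[OF g h K[OF h a]] g h a by simp
  then have "cm g (cm h a) \<otimes> cm h (cm g a) = \<one>"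
    using conjs_commute[OF x] g h a by simp
  then show "cm g (cm h a) = inv (cm h (cm g a))"
    using g h a by (metis inv_equality C K)
qed

text \<open>With u = g - 1 and v = h - 1 the claim is [g, h] - 1 = vu. For c = hg a, comparing gh
  with [g, h] hg on a gives ([g, h] - 1) c = uv a - vu a = -2 vu a, which is vu a in exponent 3.
  Finally vu a = vu c, because uvu, vuv and u^2 vanish.\<close>

lemma cm_cm_conjs:
  assumes g: "g \<in> carrier G" and h: "h \<in> carrier G" and c: "c \<in> conjs x"
  shows "cm (cm g h) c = cm h (cm g c)"
proof -
  interpret A: subgroup "conjs x" G using conjs_subgroup[OF x] .
  have K [simp]: "cm k b \<in> conjs x" if "k \<in> carrier G" "b \<in> conjs x" for k b
    using cm_conjs[OF x] that by blast
  have C [simp]: "b \<in> carrier G" if "b \<in> conjs x" for b using conjs_carrier[OF x that] .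
  note M = cm_mult_conjs[OF x]
  note T = cm_three_same
  note [simp] = cm_cm_same cm_one
  define a where "a = inv (h \<otimes> g) \<otimes> c \<otimes> (h \<otimes> g)"
  have a: "a \<in> conjs x" using conjs_conj[OF x, of "inv (h \<otimes> g)" c] g h c by (simp add: a_def)
  define b where "b = cm (h \<otimes> g) a"
  have b: "b \<in> conjs x" using a g h by (simp add: b_def)
  have ca: "c = b \<otimes> a" using g h c by (simp add: b_def a_def word)
  have b': "b = cm h (cm g a) \<otimes> cm g a \<otimes> cm h a"
    using g h a by (simp add: b_def cm_prod_conjs[OF x])
  have "cm (g \<otimes> h) a = cm (cm g h \<otimes> (h \<otimes> g)) a" using cm_swap[OF g h] by simp
  also have "\<dots> = cm (cm g h) b \<otimes> b \<otimes> cm (cm g h) a"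
    using g h a by (simp add: cm_prod_conjs[OF x, of "cm g h" "h \<otimes> g"] b_def)
  also have "\<dots> = cm (cm g h) c \<otimes> b"
    using g h a b conjs_commute[OF x b, of "cm (cm g h) a"] by (simp add: ca M m_assoc)
  finally have 1: "cm (cm g h) c \<otimes> b = cm (g \<otimes> h) a" by simp
  have vu: "cm g (cm h a) = inv (cm h (cm g a))" using T(2) g h a by blast
  have sq: "inv (cm h (cm g a)) = cm h (cm g a) \<otimes> cm h (cm g a)" using g h a inv_square by simp
  have "cm (g \<otimes> h) a = cm g (cm h a) \<otimes> (cm h a \<otimes> cm g a)"
    using g h a by (simp add: cm_prod_conjs[OF x] m_assoc)
  also have "\<dots> = cm h (cm g a) \<otimes> cm h (cm g a) \<otimes> (cm g a \<otimes> cm h a)"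
    using vu sq conjs_commute[OF x, of "cm h a" "cm g a"] g h a by simp
  also have "\<dots> = cm h (cm g a) \<otimes> b" using g h a by (simp add: b' m_assoc)
  finally have "cm (cm g h) c = cm h (cm g a)" using 1 g h a b c by simp
  moreover have "cm h (cm g c) = cm h (cm g a)"
    using g h a T(1)[OF h g] T(1)[OF g h] by (simp add: ca M b')
  ultimately show ?thesis by simp
qed

end

text \<open>Let r = [k, [h, [g, x]]] = [k, [[g, h], x]]. Moving k past [g, h] costs one sign; after
  expanding [g, h], moving k back past g and h costs two more. So r = r^-1, and an element of
  exponent 3 with r^2 = 1 is trivial.\<close>

lemma cm_class3:
  assumes "x \<in> carrier G" "g \<in> carrier G" "h \<in> carrier G" "k \<in> carrier G"
  shows "cm k (cm h (cm g x)) = \<one>"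
proof -
  note x = conjs_self[OF assms(1)]
  have K: "cm k b \<in> conjs x" if "k \<in> carrier G" "b \<in> conjs x" for k b
    using cm_conjs[OF assms(1)] that by blast
  note T = cm_three_same(2)[OF assms(1)] and W = cm_cm_conjs[OF assms(1)] and I = cm_inv_conjs[OF assms(1)]
  let ?r = "cm k (cm h (cm g x))"
  have r: "?r \<in> carrier G" using assms by simp
  have a: "cm k (cm (cm g h) x) = ?r" using W[OF assms(2,3) x] by simp
  have "cm k (cm (cm g h) x) = inv (cm (cm g h) (cm k x))"
    using T[of k "cm g h" x] assms x by simp
  also have "cm (cm g h) (cm k x) = cm h (cm g (cm k x))" using W K assms x by simp
  also have "\<dots> = cm h (inv (cm k (cm g x)))" using T[of g k x] assms x by simp
  also have "\<dots> = inv (cm h (cm k (cm g x)))" using I K assms x by simp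
  also have "\<dots> = inv (inv (cm k (cm h (cm g x))))" using T[of h k "cm g x"] K assms x by simp
  finally have "?r = inv ?r" using a assms by simp
  then have "?r \<otimes> ?r = \<one>" using r by (metis r_inv)
  then show ?thesis using square_eq_one r by blast
qed

lemma cm_anti:
  assumes "x \<in> carrier G" "g \<in> carrier G" "h \<in> carrier G"
  shows "cm g (cm h x) = inv (cm h (cm g x))"
  using cm_three_same(2)[OF assms(1,2,3) conjs_self[OF assms(1)]] .

end

text \<open>These four notions are relative to a subset of one ambient group, so that subgroups are
  compared without changing the group; \<open>gamma_consistent\<close> links them to a subgroup
  regarded as a group.\<close>

definition gamma2 :: "('a, 'b) monoid_scheme \<Rightarrow> 'a set \<Rightarrow> 'a set"
  where "gamma2 G S = commutator_subgroup G S S"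

definition gamma3 :: "('a, 'b) monoid_scheme \<Rightarrow> 'a set \<Rightarrow> 'a set"
  where "gamma3 G S = commutator_subgroup G (gamma2 G S) S"

definition centre :: "('a, 'b) monoid_scheme \<Rightarrow> 'a set \<Rightarrow> 'a set"
  where "centre G S = {z \<in> S. \<forall>g\<in>S. commutator G z g = \<one>\<^bsub>G\<^esub>}"

definition centre2 :: "('a, 'b) monoid_scheme \<Rightarrow> 'a set \<Rightarrow> 'a set"
  where "centre2 G S = {z \<in> S. \<forall>g\<in>S. commutator G z g \<in> centre G S}"

section \<open>Commutator calculus modulo the first and second centre\<close>

context exponent3_group
begin

abbreviation Z1 where "Z1 \<equiv> centre G (carrier G)"
abbreviation Z2 where "Z2 \<equiv> centre2 G (carrier G)"

lemma Z1_carrier: "z \<in> Z1 \<Longrightarrow> z \<in> carrier G"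
  unfolding centre_def by blast

lemma Z2_carrier: "z \<in> Z2 \<Longrightarrow> z \<in> carrier G"
  unfolding centre2_def by blast

lemma cm_Z1:
  assumes "z \<in> Z1" "g \<in> carrier G"
  shows "cm z g = \<one>" "cm g z = \<one>"
proof -
  show 1: "cm z g = \<one>" using assms unfolding centre_def by blast
  show "cm g z = \<one>"
    using 1 assms Z1_carrier cm_eq_one_iff by metis
qed

lemma Z1_commute: "z \<in> Z1 \<Longrightarrow> g \<in> carrier G \<Longrightarrow> z \<otimes> g = g \<otimes> z"
  using cm_Z1(1) cm_eq_one_iff Z1_carrier by metis

lemma Z1I: "z \<in> carrier G \<Longrightarrow> (\<And>g. g \<in> carrier G \<Longrightarrow> z \<otimes> g = g \<otimes> z) \<Longrightarrow> z \<in> Z1"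
  unfolding centre_def by (auto simp: cm_eq_one_iff)

lemma Z1_subgroup: "subgroup Z1 G"
proof (rule subgroupI)
  show "Z1 \<subseteq> carrier G" using Z1_carrier by blast
  have "\<one> \<in> Z1" by (rule Z1I) auto
  then show "Z1 \<noteq> {}" by blast
next
  fix a b assume a: "a \<in> Z1" and b: "b \<in> Z1"
  note ca = Z1_carrier[OF a] and cb = Z1_carrier[OF b]
  show "a \<otimes> b \<in> Z1"
  proof (rule Z1I)
    fix g assume g: "g \<in> carrier G"
    have "a \<otimes> b \<otimes> g = a \<otimes> (g \<otimes> b)" using ca cb g by (simp add: m_assoc Z1_commute[OF b g])
    also have "\<dots> = a \<otimes> g \<otimes> b" using ca cb g by (simp add: m_assoc)
    also have "\<dots> = g \<otimes> (a \<otimes> b)" using ca cb g by (simp add: m_assoc Z1_commute[OF a g])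
    finally show "a \<otimes> b \<otimes> g = g \<otimes> (a \<otimes> b)" .
  qed (use ca cb in simp)
next
  fix a assume a: "a \<in> Z1"
  note ca = Z1_carrier[OF a]
  show "inv a \<in> Z1"
  proof (rule Z1I)
    fix g assume g: "g \<in> carrier G"
    have "a \<otimes> inv g = inv g \<otimes> a" using Z1_commute[OF a] g by simp
    then have "inv (a \<otimes> inv g) = inv (inv g \<otimes> a)" by simp
    then show "inv a \<otimes> g = g \<otimes> inv a" using ca g by (simp add: inv_mult_group)
  qed (use ca in simp)
qed

lemma Z1_mult [intro]: "a \<in> Z1 \<Longrightarrow> b \<in> Z1 \<Longrightarrow> a \<otimes> b \<in> Z1"
  and Z1_inv [intro]: "a \<in> Z1 \<Longrightarrow> inv a \<in> Z1"
  and Z1_one [intro]: "\<one> \<in> Z1"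
  using Z1_subgroup by (auto simp: subgroup.m_closed subgroup.m_inv_closed subgroup.one_closed)

lemma Z2_D:
  assumes "z \<in> Z2" "g \<in> carrier G"
  shows "cm z g \<in> Z1" "cm g z \<in> Z1"
proof -
  show 1: "cm z g \<in> Z1" using assms unfolding centre2_def by blast
  show "cm g z \<in> Z1" using Z1_inv[OF 1] inv_cm[OF Z2_carrier[OF assms(1)] assms(2)] by simp
qed

lemma Z2I: "z \<in> carrier G \<Longrightarrow> (\<And>g. g \<in> carrier G \<Longrightarrow> cm z g \<in> Z1) \<Longrightarrow> z \<in> Z2"
  unfolding centre2_def by blast

lemma cm_mult_left:
  assumes "x \<in> carrier G" "x' \<in> carrier G" "y \<in> carrier G"
  shows "cm (x \<otimes> x') y = cm x (cm x' y) \<otimes> cm x' y \<otimes> cm x y"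
  using assms by (simp add: word)

lemma cm_mult_right:
  assumes "x \<in> carrier G" "y \<in> carrier G" "y' \<in> carrier G"
  shows "cm x (y \<otimes> y') = cm x y \<otimes> cm y (cm x y') \<otimes> cm x y'"
  using assms by (simp add: word)

text \<open>\<open>cm_class3\<close> in terms of centres. It makes the bilinear rules for
  \<open>Z2\<close> available for every commutator.\<close>

lemma cm_in_Z2 [simp, intro]:
  assumes "x \<in> carrier G" "y \<in> carrier G"
  shows "cm x y \<in> Z2"
proof (rule Z2I)
  fix g assume g: "g \<in> carrier G"
  have "cm g (cm x y) \<in> Z1"
  proof (rule Z1I)
    fix k assume k: "k \<in> carrier G"
    then have "k \<otimes> cm g (cm x y) = cm g (cm x y) \<otimes> k"
      using cm_class3[OF assms(2,1) g k] cm_eq_one_iff[OF k] assms g by simp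
    then show "cm g (cm x y) \<otimes> k = k \<otimes> cm g (cm x y)" by simp
  qed (use assms g in simp)
  from Z1_inv[OF this] show "cm (cm x y) g \<in> Z1" using assms g by (simp add: inv_cm)
qed (use assms in simp)

lemma Z2_mult_right:
  assumes b: "b \<in> Z2" and g: "g \<in> carrier G" and h: "h \<in> carrier G"
  shows "cm b (g \<otimes> h) = cm b g \<otimes> cm b h" "cm (g \<otimes> h) b = cm g b \<otimes> cm h b"
proof -
  note c = Z2_carrier[OF b] g h
  have z: "cm h b \<in> Z1" "cm b h \<in> Z1" using assms Z2_D by auto
  show "cm b (g \<otimes> h) = cm b g \<otimes> cm b h"
    using c by (simp add: cm_mult_right cm_Z1[OF z(2)])
  show "cm (g \<otimes> h) b = cm g b \<otimes> cm h b"
    using c by (simp add: cm_mult_left cm_Z1[OF z(1)] Z1_commute[OF z(1)])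
qed

text \<open>For b in \<open>Z2\<close> the map sending g to [b, g] is a homomorphism with central
  values, so it does not distinguish xy from yx and must kill [x, y].\<close>

lemma Z2_commute_cm:
  assumes b: "b \<in> Z2" and x: "x \<in> carrier G" and y: "y \<in> carrier G"
  shows "cm b (cm x y) = \<one>"
proof -
  note c = Z2_carrier[OF b] x y
  have z: "cm b x \<in> Z1" using assms Z2_D by auto
  have "cm b (x \<otimes> y) = cm b (cm x y) \<otimes> cm b (y \<otimes> x)"
    unfolding cm_swap[OF x y] using Z2_mult_right(1)[OF b, of "cm x y" "y \<otimes> x"] c by simp
  moreover have "cm b (x \<otimes> y) = cm b (y \<otimes> x)"
    using Z2_mult_right(1)[OF b x y] Z2_mult_right(1)[OF b y x] Z1_commute[OF z, of "cm b y"] c by simp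
  ultimately show ?thesis using c
    by (metis cm_closed m_closed r_cancel_one)
qed

text \<open>The error terms of \<open>cm_mult_left\<close> and \<open>cm_mult_right\<close> are
  trivial: each is a commutator with a central element or one of b with a commutator, as in
  \<open>Z2_commute_cm\<close>.\<close>

lemma Z2_mult_left:
  assumes b: "b \<in> Z2" and c: "c \<in> carrier G" and g: "g \<in> carrier G"
  shows "cm (b \<otimes> c) g = cm b g \<otimes> cm c g" "cm (c \<otimes> b) g = cm b g \<otimes> cm c g"
    "cm g (b \<otimes> c) = cm g b \<otimes> cm g c" "cm g (c \<otimes> b) = cm g b \<otimes> cm g c"
proof -
  note C = Z2_carrier[OF b] c g
  have z: "cm b g \<in> Z1" "cm g b \<in> Z1" using assms Z2_D by auto
  note z' = cm_Z1[OF z(1)] cm_Z1[OF z(2)]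
  have k: "cm b (cm c g) = \<one>" "cm b (cm g c) = \<one>" using Z2_commute_cm[OF b] c g by auto
  show "cm (b \<otimes> c) g = cm b g \<otimes> cm c g"
    using C k by (simp add: cm_mult_left Z1_commute[OF z(1)])
  show "cm (c \<otimes> b) g = cm b g \<otimes> cm c g"
    using C by (simp add: cm_mult_left z')
  show "cm g (b \<otimes> c) = cm g b \<otimes> cm g c"
    using C k by (simp add: cm_mult_right)
  show "cm g (c \<otimes> b) = cm g b \<otimes> cm g c"
    using C by (simp add: cm_mult_right z' Z1_commute[OF z(2)])
qed

lemma Z2_inv:
  assumes b: "b \<in> Z2" and g: "g \<in> carrier G"
  shows "cm (inv b) g = inv (cm b g)" "cm g (inv b) = inv (cm g b)"
    "cm b (inv g) = inv (cm b g)" "cm (inv g) b = inv (cm g b)"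
proof -
  note c = Z2_carrier[OF b] g
  have "cm b g \<otimes> cm (inv b) g = \<one>" using Z2_mult_left(1)[OF b, of "inv b" g] c by (simp add: cm_one)
  then show "cm (inv b) g = inv (cm b g)" using c by (metis cm_closed inv_closed inv_equality inv_inv)
  have "cm g b \<otimes> cm g (inv b) = \<one>" using Z2_mult_left(3)[OF b, of "inv b" g] c by (simp add: cm_one)
  then show "cm g (inv b) = inv (cm g b)" using c by (metis cm_closed inv_closed inv_equality inv_inv)
  have "cm b g \<otimes> cm b (inv g) = \<one>" using Z2_mult_right(1)[OF b, of g "inv g"] c by (simp add: cm_one)
  then show "cm b (inv g) = inv (cm b g)" using c by (metis cm_closed inv_closed inv_equality inv_inv)
  have "cm g b \<otimes> cm (inv g) b = \<one>" using Z2_mult_right(2)[OF b, of g "inv g"] c by (simp add: cm_one)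
  then show "cm (inv g) b = inv (cm g b)" using c by (metis cm_closed inv_closed inv_equality inv_inv)
qed

lemma Z1_sub_Z2: "z \<in> Z1 \<Longrightarrow> z \<in> Z2"
  by (rule Z2I) (auto simp: cm_Z1 Z1_carrier Z1_one)

lemma Z2_subgroup: "subgroup Z2 G"
proof (rule subgroupI)
  show "Z2 \<subseteq> carrier G" using Z2_carrier by blast
  show "Z2 \<noteq> {}" using Z1_sub_Z2[OF Z1_one] by auto
next
  fix a b assume a: "a \<in> Z2" and b: "b \<in> Z2"
  show "a \<otimes> b \<in> Z2"
  proof (rule Z2I)
    fix g assume "g \<in> carrier G"
    then show "cm (a \<otimes> b) g \<in> Z1"
      using Z2_mult_left(1)[OF a Z2_carrier[OF b]] Z2_D(1)[OF a] Z2_D(1)[OF b] by auto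
  qed (use a b Z2_carrier in simp)
next
  fix a assume a: "a \<in> Z2"
  show "inv a \<in> Z2"
  proof (rule Z2I)
    fix g assume "g \<in> carrier G"
    then show "cm (inv a) g \<in> Z1" using Z2_inv(1)[OF a] Z2_D(1)[OF a] by auto
  qed (use a Z2_carrier in simp)
qed

lemma Z2_mult [intro]: "a \<in> Z2 \<Longrightarrow> b \<in> Z2 \<Longrightarrow> a \<otimes> b \<in> Z2"
  and Z2_inv_closed [intro]: "a \<in> Z2 \<Longrightarrow> inv a \<in> Z2"
  and Z2_one [intro]: "\<one> \<in> Z2"
  using Z2_subgroup by (auto simp: subgroup.m_closed subgroup.m_inv_closed subgroup.one_closed)

lemma commutator_subgroup_carrier:
  assumes "A \<subseteq> carrier G" "B \<subseteq> carrier G"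
  shows "subgroup (commutator_subgroup G A B) G"
  unfolding commutator_subgroup_def by (rule generate_is_subgroup) (use assms in auto)

lemma gamma2_subgroup: "S \<subseteq> carrier G \<Longrightarrow> subgroup (gamma2 G S) G"
  unfolding gamma2_def by (rule commutator_subgroup_carrier)

lemma gamma3_subgroup: "S \<subseteq> carrier G \<Longrightarrow> subgroup (gamma3 G S) G"
  unfolding gamma3_def
  by (rule commutator_subgroup_carrier) (use gamma2_subgroup subgroup.subset in blast)+

lemma gamma2_Z2: "S \<subseteq> carrier G \<Longrightarrow> gamma2 G S \<subseteq> Z2"
  unfolding gamma2_def commutator_subgroup_def
  by (rule generate_subgroup_incl[OF _ Z2_subgroup]) auto

lemma gamma3_Z1: "S \<subseteq> carrier G \<Longrightarrow> gamma3 G S \<subseteq> Z1"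
  unfolding gamma3_def commutator_subgroup_def
  by (rule generate_subgroup_incl[OF _ Z1_subgroup]) (use gamma2_Z2 Z2_D(1) in blast)

lemma cm_gamma2: "a \<in> S \<Longrightarrow> b \<in> S \<Longrightarrow> cm a b \<in> gamma2 G S"
  unfolding gamma2_def commutator_subgroup_def by (rule generate.incl) blast

lemma cm_gamma3: "a \<in> gamma2 G S \<Longrightarrow> b \<in> S \<Longrightarrow> cm a b \<in> gamma3 G S"
  unfolding gamma3_def commutator_subgroup_def by (rule generate.incl) blast

lemma gamma2_sub: assumes "subgroup S G" shows "gamma2 G S \<subseteq> S"
  unfolding gamma2_def commutator_subgroup_def
proof (rule generate_subgroup_incl[OF _ assms])
  show "{cm a b |a b. a \<in> S \<and> b \<in> S} \<subseteq> S"
    using assms by (auto simp: commutator_def subgroup.m_closed subgroup.m_inv_closed)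
qed

lemma gamma3_sub_gamma2: assumes "subgroup S G" shows "gamma3 G S \<subseteq> gamma2 G S"
  unfolding gamma3_def commutator_subgroup_def
proof (rule generate_subgroup_incl)
  show "subgroup (gamma2 G S) G" using gamma2_subgroup assms subgroup.subset by blast
  show "{cm a b |a b. a \<in> gamma2 G S \<and> b \<in> S} \<subseteq> gamma2 G S"
    using cm_gamma2 gamma2_sub[OF assms] by blast
qed

lemma gamma2_mono: "S \<subseteq> T \<Longrightarrow> gamma2 G S \<subseteq> gamma2 G T"
  unfolding gamma2_def commutator_subgroup_def by (rule mono_generate) blast

lemma gamma3_mono: "S \<subseteq> T \<Longrightarrow> gamma3 G S \<subseteq> gamma3 G T"
  unfolding gamma3_def commutator_subgroup_def using gamma2_mono by (intro mono_generate) blast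

lemma Z2_commute_gamma2:
  assumes "b \<in> Z2" "S \<subseteq> carrier G" "e \<in> gamma2 G S"
  shows "e \<otimes> b = b \<otimes> e" "cm b e = \<one>" "cm e b = \<one>"
proof -
  show *: "e \<otimes> b = b \<otimes> e"
  proof (rule generate_commute[OF _ _ _ assms(3)[unfolded gamma2_def commutator_subgroup_def]])
    fix s assume "s \<in> {cm x y |x y. x \<in> S \<and> y \<in> S}"
    then obtain x y where xy: "x \<in> carrier G" "y \<in> carrier G" "s = cm x y" using assms(2) by blast
    then show "s \<otimes> b = b \<otimes> s"
      using Z2_commute_cm[OF assms(1) xy(1,2)] Z2_carrier[OF assms(1)] by (simp add: cm_eq_one_iff)
  qed (use assms Z2_carrier in auto)
  have "e \<in> carrier G" using assms(2,3) gamma2_Z2 Z2_carrier by blast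
  then show "cm b e = \<one>" "cm e b = \<one>" using * Z2_carrier[OF assms(1)] by (simp_all add: cm_eq_one_iff)
qed

section \<open>The triple commutator as an alternating form\<close>

lemma trilinear_swap12:
  assumes "x \<in> carrier G" "y \<in> carrier G" "z \<in> carrier G"
  shows "cm (cm y x) z = inv (cm (cm x y) z)"
  using Z2_inv(1)[of "cm x y" z] assms by (simp add: inv_cm)

text \<open>This is the anticommutation \<open>cm_anti\<close> in the normal closure of x, rewritten
  for left-normed commutators.\<close>

lemma trilinear_swap23:
  assumes "x \<in> carrier G" "y \<in> carrier G" "z \<in> carrier G"
  shows "cm (cm x z) y = inv (cm (cm x y) z)"
proof -
  have "cm z (cm y x) = inv (cm y (cm z x))" using cm_anti assms by blast
  then have "inv (cm (cm y x) z) = inv (inv (cm (cm z x) y))" using assms by (simp add: inv_cm)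
  then have "cm (cm x y) z = inv (cm (cm x z) y)"
    using trilinear_swap12[of x y z] trilinear_swap12[of x z y] assms by simp
  then show ?thesis using assms by simp
qed

lemma trilinear_cyc:
  assumes "x \<in> carrier G" "y \<in> carrier G" "z \<in> carrier G"
  shows "cm (cm x y) z = cm (cm y z) x"
  using trilinear_swap12[of x y z] trilinear_swap23[of y x z] assms by simp

lemma trilinear_same:
  assumes "x \<in> carrier G" "y \<in> carrier G"
  shows "cm (cm x y) y = \<one>" "cm (cm y x) y = \<one>"
proof -
  have "cm y (cm y x) = \<one>" using cm_cm_same assms by simp
  then have "y \<otimes> cm y x = cm y x \<otimes> y" using cm_eq_one_iff[of y "cm y x"] assms by simp
  then show 1: "cm (cm y x) y = \<one>" using cm_eq_one_iff[of "cm y x" y] assms by simp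
  show "cm (cm x y) y = \<one>" using trilinear_swap12[of y x y] 1 assms by simp
qed

end

section \<open>Adjoining a generic element\<close>

lemma (in group_hom) hom_commutator:
  "a \<in> carrier G \<Longrightarrow> b \<in> carrier G \<Longrightarrow> h (commutator G a b) = commutator H (h a) (h b)"
  by (simp add: commutator_def)

lemma (in group) commutator_closed:
  "a \<in> carrier G \<Longrightarrow> b \<in> carrier G \<Longrightarrow> commutator G a b \<in> carrier G"
  by (simp add: commutator_def)

lemma (in group_hom) commutator_subgroup_image:
  assumes "A \<subseteq> carrier G" "B \<subseteq> carrier G"
  shows "commutator_subgroup H (h ` A) (h ` B) = h ` commutator_subgroup G A B"
proof -
  let ?S = "{commutator G a b |a b. a \<in> A \<and> b \<in> B}"
  have "?S \<subseteq> carrier G" using assms G.commutator_closed by blast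
  then have "h ` generate G ?S = generate H (h ` ?S)" by (simp add: generate_img)
  also have "h ` ?S = {commutator H a b |a b. a \<in> h ` A \<and> b \<in> h ` B}"
  proof (intro equalityI subsetI)
    fix y assume "y \<in> h ` ?S"
    then obtain a b where "a \<in> A" "b \<in> B" "y = h (commutator G a b)" by blast
    moreover from this have "y = commutator H (h a) (h b)" using assms hom_commutator by blast
    ultimately show "y \<in> {commutator H a b |a b. a \<in> h ` A \<and> b \<in> h ` B}" by blast
  next
    fix y assume "y \<in> {commutator H a b |a b. a \<in> h ` A \<and> b \<in> h ` B}"
    then obtain a b where "a \<in> A" "b \<in> B" "y = commutator H (h a) (h b)" by blast
    moreover from this have "y = h (commutator G a b)" using assms hom_commutator by (metis subsetD)
    ultimately show "y \<in> h ` ?S" by blast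
  qed
  finally show ?thesis by (simp add: commutator_subgroup_def)
qed

lemma (in group_hom) gamma2_image:
  "S \<subseteq> carrier G \<Longrightarrow> gamma2 H (h ` S) = h ` gamma2 G S"
  unfolding gamma2_def by (rule commutator_subgroup_image)

lemma (in group) commutator_subgroup_in_carrier:
  "A \<subseteq> carrier G \<Longrightarrow> B \<subseteq> carrier G \<Longrightarrow> commutator_subgroup G A B \<subseteq> carrier G"
  unfolding commutator_subgroup_def by (rule generate_incl) (use commutator_closed in blast)

lemma (in group_hom) gamma3_image:
  "S \<subseteq> carrier G \<Longrightarrow> gamma3 H (h ` S) = h ` gamma3 G S"
  unfolding gamma3_def using G.commutator_subgroup_in_carrier[of S S] commutator_subgroup_image
  by (simp add: gamma2_image gamma2_def)

section \<open>The Baer correspondence in class 2\<close>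

locale class2_group = exponent3_group +
  assumes class2: "x \<in> carrier G \<Longrightarrow> y \<in> carrier G \<Longrightarrow> cm x y \<in> Z1"
begin

lemma Z2_all: "x \<in> carrier G \<Longrightarrow> x \<in> Z2"
  by (rule Z2I) (auto intro: class2)

text \<open>The general Baer product is x y [x, y]^(-1/2), and -1/2 = 1 modulo 3.\<close>

definition baer :: "('a, 'b) monoid_scheme"
  where "baer = G\<lparr>monoid.mult := \<lambda>x y. x \<otimes> y \<otimes> cm x y\<rparr>"

lemma baer_simps [simp]: "carrier baer = carrier G" "\<one>\<^bsub>baer\<^esub> = \<one>"
  "x \<otimes>\<^bsub>baer\<^esub> y = x \<otimes> y \<otimes> cm x y"
  by (simp_all add: baer_def)

lemma baer_comm_group: "comm_group baer"
proof (rule comm_groupI)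
  fix x y z assume "x \<in> carrier baer" "y \<in> carrier baer" "z \<in> carrier baer"
  then have c: "x \<in> carrier G" "y \<in> carrier G" "z \<in> carrier G" by simp_all
  have z: "cm x y \<in> Z1" "cm y z \<in> Z1" using c class2 by auto
  have 1: "cm (x \<otimes> y \<otimes> cm x y) z = cm y z \<otimes> cm x z"
    using c Z1_commute[OF z(2), of "cm x z"] Z2_mult_left(1)[OF Z2_all, of x y z] Z2_mult_left(2)[OF Z1_sub_Z2[OF z(1)], of "x \<otimes> y" z]
    by (simp add: cm_Z1[OF z(1)])
  have 2: "cm x (y \<otimes> z \<otimes> cm y z) = cm x y \<otimes> cm x z"
    using c Z2_mult_right(1)[OF Z2_all, of x y z] Z2_mult_left(4)[OF Z1_sub_Z2[OF z(2)], of "y \<otimes> z" x]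
    by (simp add: cm_Z1[OF z(2)])
  have "x \<otimes> y \<otimes> cm x y \<otimes> z \<otimes> (cm x z \<otimes> cm y z) = x \<otimes> y \<otimes> (cm x y \<otimes> (z \<otimes> (cm x z \<otimes> cm y z)))"
    using c by (simp add: m_assoc)
  also have "cm x y \<otimes> (z \<otimes> (cm x z \<otimes> cm y z)) = z \<otimes> (cm x z \<otimes> cm y z) \<otimes> cm x y"
    using c Z1_commute[OF z(1)] by simp
  also have "cm x z \<otimes> cm y z = cm y z \<otimes> cm x z" using c Z1_commute[OF z(2)] by simp
  also have "z \<otimes> (cm y z \<otimes> cm x z) \<otimes> cm x y = z \<otimes> (cm y z \<otimes> (cm x z \<otimes> cm x y))"
    using c by (simp add: m_assoc)
  also have "cm x z \<otimes> cm x y = cm x y \<otimes> cm x z" using c Z1_commute[OF z(1)] by simp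
  also have "x \<otimes> y \<otimes> (z \<otimes> (cm y z \<otimes> (cm x y \<otimes> cm x z))) = x \<otimes> (y \<otimes> z \<otimes> cm y z) \<otimes> (cm x y \<otimes> cm x z)"
    using c by (simp add: m_assoc)
  finally have "x \<otimes> y \<otimes> cm x y \<otimes> z \<otimes> (cm y z \<otimes> cm x z) =
    x \<otimes> (y \<otimes> z \<otimes> cm y z) \<otimes> (cm x y \<otimes> cm x z)" .
  then show "x \<otimes>\<^bsub>baer\<^esub> y \<otimes>\<^bsub>baer\<^esub> z = x \<otimes>\<^bsub>baer\<^esub> (y \<otimes>\<^bsub>baer\<^esub> z)"
    by (simp only: baer_simps 1 2)
next
  fix x y assume "x \<in> carrier baer" "y \<in> carrier baer"
  then have c: "x \<in> carrier G" "y \<in> carrier G" by simp_all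
  have z: "cm x y \<in> Z1" "cm y x \<in> Z1" using c class2 by auto
  have "y \<otimes> x \<otimes> cm y x = cm y x \<otimes> (y \<otimes> x)" using c Z1_commute[OF z(2)] by simp
  also have "\<dots> = cm x y \<otimes> cm x y \<otimes> (y \<otimes> x)" using c inv_cm[of x y] inv_square[of "cm x y"] by simp
  also have "\<dots> = cm x y \<otimes> (x \<otimes> y)"
    using c by (simp add: m_assoc cm_swap[of x y, symmetric])
  also have "\<dots> = x \<otimes> y \<otimes> cm x y" using c Z1_commute[OF z(1)] by simp
  finally show "x \<otimes>\<^bsub>baer\<^esub> y = y \<otimes>\<^bsub>baer\<^esub> x" by simp
next
  fix x assume "x \<in> carrier baer"
  then show "\<exists>y\<in>carrier baer. y \<otimes>\<^bsub>baer\<^esub> x = \<one>\<^bsub>baer\<^esub>"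
    by (intro bexI[of _ "inv x"]) (simp_all add: word)
qed (auto simp: commutator_def)

end

text \<open>
  For a derivation \<open>\<delta>\<close> of \<open>G\<close> with values in the \<open>G\<close>-module \<open>L\<close>, the group below is
  \<open>(L \<rtimes> G) \<rtimes> \<int>/3\<close>, where the generator of \<open>\<int>/3\<close> acts as
  \<open>m \<mapsto> \<delta>(m)\<^sup>-\<^sup>1 m\<close>.
\<close>

locale derivation = exponent3_group G + L: comm_group L
  for G :: "('a, 'b) monoid_scheme" (structure) and L :: "('l, 'c) monoid_scheme" +
  fixes act :: "'a \<Rightarrow> 'l \<Rightarrow> 'l" and \<delta> :: "'a \<Rightarrow> 'l"
  assumes act_closed [simp, intro]: "m \<in> carrier G \<Longrightarrow> l \<in> carrier L \<Longrightarrow> act m l \<in> carrier L"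
    and act_mult: "m \<in> carrier G \<Longrightarrow> l \<in> carrier L \<Longrightarrow> l' \<in> carrier L \<Longrightarrow>
      act m (l \<otimes>\<^bsub>L\<^esub> l') = act m l \<otimes>\<^bsub>L\<^esub> act m l'"
    and act_act: "m \<in> carrier G \<Longrightarrow> m' \<in> carrier G \<Longrightarrow> l \<in> carrier L \<Longrightarrow>
      act m (act m' l) = act (m \<otimes> m') l"
    and act_one: "l \<in> carrier L \<Longrightarrow> act \<one> l = l"
    and \<delta>_closed [simp, intro]: "m \<in> carrier G \<Longrightarrow> \<delta> m \<in> carrier L"
    and \<delta>_mult: "m \<in> carrier G \<Longrightarrow> m' \<in> carrier G \<Longrightarrow> \<delta> (m \<otimes> m') = \<delta> m \<otimes>\<^bsub>L\<^esub> act m (\<delta> m')"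
    and act_cube: "m \<in> carrier G \<Longrightarrow> l \<in> carrier L \<Longrightarrow>
      l \<otimes>\<^bsub>L\<^esub> act m l \<otimes>\<^bsub>L\<^esub> act (m \<otimes> m) l = \<one>\<^bsub>L\<^esub>"
    and \<delta>_square: "m \<in> carrier G \<Longrightarrow> \<delta> m \<otimes>\<^bsub>L\<^esub> \<delta> (m \<otimes> m) = \<one>\<^bsub>L\<^esub>"
begin

text \<open>The triple (s, l, m) stands for a^s l m, where a generates \<int>/3. Moving m to the
  right past a^s' creates the factor \<delta>(m)^s'.\<close>

definition ext :: "(nat \<times> 'l \<times> 'a) monoid"
  where "ext = \<lparr>carrier = {..<3} \<times> carrier L \<times> carrier G,
    monoid.mult = (\<lambda>(s, l, m) (s', l', m').
      ((s + s') mod 3, l \<otimes>\<^bsub>L\<^esub> act m l' \<otimes>\<^bsub>L\<^esub> \<delta> m [^]\<^bsub>L\<^esub> s', m \<otimes> m')),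
    one = (0, \<one>\<^bsub>L\<^esub>, \<one>)\<rparr>"

lemma ext_simps [simp]:
  "(s, l, m) \<in> carrier ext \<longleftrightarrow> s < 3 \<and> l \<in> carrier L \<and> m \<in> carrier G"
  "(s, l, m) \<otimes>\<^bsub>ext\<^esub> (s', l', m') =
    ((s + s') mod 3, l \<otimes>\<^bsub>L\<^esub> act m l' \<otimes>\<^bsub>L\<^esub> \<delta> m [^]\<^bsub>L\<^esub> s', m \<otimes> m')"
  "\<one>\<^bsub>ext\<^esub> = (0, \<one>\<^bsub>L\<^esub>, \<one>)"
  by (auto simp: ext_def)

lemma \<delta>_one: "\<delta> \<one> = \<one>\<^bsub>L\<^esub>"
  using \<delta>_mult[of \<one> \<one>] act_one[of "\<delta> \<one>"] by simp

lemma act_L_one: "m \<in> carrier G \<Longrightarrow> act m \<one>\<^bsub>L\<^esub> = \<one>\<^bsub>L\<^esub>"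
  using act_mult[of m "\<one>\<^bsub>L\<^esub>" "\<one>\<^bsub>L\<^esub>"] by simp

text \<open>With this, powers of \<delta>(m) depend only on the exponent modulo 3, as the first
  coordinate of \<open>ext\<close> demands.\<close>

lemma L_cube: "l \<in> carrier L \<Longrightarrow> l [^]\<^bsub>L\<^esub> (3::nat) = \<one>\<^bsub>L\<^esub>"
  using act_cube[of \<one> l] act_one by (simp add: numeral_3_eq_3)

lemma L_pow_mod: assumes "l \<in> carrier L" shows "l [^]\<^bsub>L\<^esub> (s mod 3) = l [^]\<^bsub>L\<^esub> (s::nat)"
proof -
  have "l [^]\<^bsub>L\<^esub> (s mod 3 + 3 * (s div 3)) = l [^]\<^bsub>L\<^esub> (s mod 3) \<otimes>\<^bsub>L\<^esub> (l [^]\<^bsub>L\<^esub> (3::nat)) [^]\<^bsub>L\<^esub> (s div 3)"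
    using assms by (simp only: L.nat_pow_mult[symmetric] L.nat_pow_pow)
  then show ?thesis using assms by (simp add: L_cube)
qed

lemma act_pow: "m \<in> carrier G \<Longrightarrow> l \<in> carrier L \<Longrightarrow> act m (l [^]\<^bsub>L\<^esub> (s::nat)) = act m l [^]\<^bsub>L\<^esub> s"
  by (induction s) (simp_all add: act_L_one act_mult)

lemma ext_group: "group ext"
proof (rule groupI)
  fix x y z assume "x \<in> carrier ext" "y \<in> carrier ext" "z \<in> carrier ext"
  obtain s l m s' l' m' s'' l'' m'' where
    e: "x = (s, l, m)" "y = (s', l', m')" "z = (s'', l'', m'')" by (cases x, cases y, cases z)
  with \<open>x \<in> carrier ext\<close> \<open>y \<in> carrier ext\<close> \<open>z \<in> carrier ext\<close>
  have c: "l \<in> carrier L" "l' \<in> carrier L" "l'' \<in> carrier L" "m \<in> carrier G" "m' \<in> carrier G" "m'' \<in> carrier G"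
    by auto
  have "act m (l' \<otimes>\<^bsub>L\<^esub> act m' l'' \<otimes>\<^bsub>L\<^esub> \<delta> m' [^]\<^bsub>L\<^esub> s'') =
      act m l' \<otimes>\<^bsub>L\<^esub> act (m \<otimes> m') l'' \<otimes>\<^bsub>L\<^esub> act m (\<delta> m') [^]\<^bsub>L\<^esub> s''"
    using c by (simp add: act_mult act_act act_pow)
  moreover have "\<delta> m [^]\<^bsub>L\<^esub> ((s' + s'') mod 3) = \<delta> m [^]\<^bsub>L\<^esub> s' \<otimes>\<^bsub>L\<^esub> \<delta> m [^]\<^bsub>L\<^esub> s''"
    using c by (simp only: L_pow_mod \<delta>_closed L.nat_pow_mult)
  moreover have "\<delta> (m \<otimes> m') [^]\<^bsub>L\<^esub> s'' = \<delta> m [^]\<^bsub>L\<^esub> s'' \<otimes>\<^bsub>L\<^esub> act m (\<delta> m') [^]\<^bsub>L\<^esub> s''"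
    using c by (simp add: \<delta>_mult L.nat_pow_distrib)
  ultimately show "x \<otimes>\<^bsub>ext\<^esub> y \<otimes>\<^bsub>ext\<^esub> z = x \<otimes>\<^bsub>ext\<^esub> (y \<otimes>\<^bsub>ext\<^esub> z)"
    using c by (simp add: e m_assoc L.m_ac mod_add_left_eq mod_add_right_eq add.assoc)
next
  fix x assume "x \<in> carrier ext"
  then obtain s l m where e: "x = (s, l, m)" and c: "s < 3" "l \<in> carrier L" "m \<in> carrier G"
    by (cases x) auto
  define l' where "l' = inv\<^bsub>L\<^esub> (act (inv m) l \<otimes>\<^bsub>L\<^esub> \<delta> (inv m) [^]\<^bsub>L\<^esub> s)"
  have l': "l' \<in> carrier L" using c by (simp add: l'_def)
  have "l' \<otimes>\<^bsub>L\<^esub> (act (inv m) l \<otimes>\<^bsub>L\<^esub> \<delta> (inv m) [^]\<^bsub>L\<^esub> s) = \<one>\<^bsub>L\<^esub>"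
    using c by (simp add: l'_def)
  then have "((3 - s) mod 3, l', inv m) \<otimes>\<^bsub>ext\<^esub> x = \<one>\<^bsub>ext\<^esub>"
    using c l' by (simp add: e L.m_assoc mod_add_left_eq)
  then show "\<exists>y\<in>carrier ext. y \<otimes>\<^bsub>ext\<^esub> x = \<one>\<^bsub>ext\<^esub>"
    using c l' by (intro bexI[of _ "((3 - s) mod 3, l', inv m)"]) auto
qed (auto simp: act_L_one act_one \<delta>_one)

text \<open>The middle coordinate of (s, l, m)^3 is the norm of l under m times the s-th power of
  \<delta>(m) \<delta>(m^2). The assumptions \<open>act_cube\<close> and
  \<open>\<delta>_square\<close> are the vanishing of these two factors.\<close>

lemma ext_exponent3: "exponent3_group ext"
proof -
  interpret E: group ext by (rule ext_group)
  show ?thesis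
  proof
    fix x assume "x \<in> carrier ext"
    then obtain s l m where e: "x = (s, l, m)" and c: "s < 3" "l \<in> carrier L" "m \<in> carrier G"
      by (cases x) auto
    have 1: "\<delta> m [^]\<^bsub>L\<^esub> s \<otimes>\<^bsub>L\<^esub> \<delta> (m \<otimes> m) [^]\<^bsub>L\<^esub> s = \<one>\<^bsub>L\<^esub>"
      using c \<delta>_square[of m] by (simp add: L.nat_pow_distrib[symmetric])
    have "l \<otimes>\<^bsub>L\<^esub> act m l \<otimes>\<^bsub>L\<^esub> \<delta> m [^]\<^bsub>L\<^esub> s \<otimes>\<^bsub>L\<^esub> act (m \<otimes> m) l \<otimes>\<^bsub>L\<^esub> \<delta> (m \<otimes> m) [^]\<^bsub>L\<^esub> s =
      (l \<otimes>\<^bsub>L\<^esub> act m l \<otimes>\<^bsub>L\<^esub> act (m \<otimes> m) l) \<otimes>\<^bsub>L\<^esub> (\<delta> m [^]\<^bsub>L\<^esub> s \<otimes>\<^bsub>L\<^esub> \<delta> (m \<otimes> m) [^]\<^bsub>L\<^esub> s)"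
      using c by (simp add: L.m_ac)
    also have "\<dots> = \<one>\<^bsub>L\<^esub>" using c 1 act_cube by simp
    finally have "l \<otimes>\<^bsub>L\<^esub> act m l \<otimes>\<^bsub>L\<^esub> \<delta> m [^]\<^bsub>L\<^esub> s \<otimes>\<^bsub>L\<^esub> act (m \<otimes> m) l \<otimes>\<^bsub>L\<^esub> \<delta> (m \<otimes> m) [^]\<^bsub>L\<^esub> s = \<one>\<^bsub>L\<^esub>" .
    then show "x \<otimes>\<^bsub>ext\<^esub> x \<otimes>\<^bsub>ext\<^esub> x = \<one>\<^bsub>ext\<^esub>"
      using c cube[of m] by (simp add: e) presburger
  qed
qed

end

context class2_group
begin

lemma cm_bilinear:
  assumes "x \<in> carrier G" "y \<in> carrier G" "z \<in> carrier G"
  shows "cm (x \<otimes> y) z = cm x z \<otimes> cm y z" "cm z (x \<otimes> y) = cm z x \<otimes> cm z y"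
    "cm (cm x y) z = \<one>" "cm z (cm x y) = \<one>"
  using assms Z2_mult_left(1)[OF Z2_all, of x y z] Z2_mult_right(1)[OF Z2_all, of z x y]
    cm_Z1[OF class2, of x y z] by auto

lemma Z1_exchange:
  assumes "x \<in> carrier G" "y \<in> carrier G" "u \<in> Z1" "v \<in> Z1"
  shows "x \<otimes> u \<otimes> (y \<otimes> v) = x \<otimes> y \<otimes> (u \<otimes> v)"
proof -
  note c = assms(1,2) Z1_carrier[OF assms(3)] Z1_carrier[OF assms(4)]
  have "x \<otimes> u \<otimes> (y \<otimes> v) = x \<otimes> (u \<otimes> y) \<otimes> v" using c by (simp add: m_assoc)
  also have "u \<otimes> y = y \<otimes> u" using Z1_commute assms by blast
  finally show ?thesis using c by (simp add: m_assoc)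
qed

lemma cm_same: "x \<in> carrier G \<Longrightarrow> cm x x = \<one>"
  by (simp add: cm_eq_one_iff)

text \<open>The element l [l, \<pi> m] is the conjugate of l by (\<pi> m)^-1. This is a left action
  because inner automorphisms commute in class 2. The inverse is chosen so that the commutator
  coming from the action cancels the one in the Baer product, which makes \<pi> itself a
  derivation.\<close>

lemma baer_derivation:
  assumes M: "exponent3_group M" and \<pi>: "\<pi> \<in> hom M G"
  shows "derivation M baer (\<lambda>m l. l \<otimes> cm l (\<pi> m)) \<pi>"
proof -
  interpret M: exponent3_group M by (rule M)
  interpret h: group_hom M G \<pi> by unfold_locales (rule \<pi>)
  interpret L: comm_group baer by (rule baer_comm_group)
  show ?thesis
  proof unfold_locales
    fix m l l' assume "m \<in> carrier M" "l \<in> carrier baer" "l' \<in> carrier baer"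
    then have c: "\<pi> m \<in> carrier G" "l \<in> carrier G" "l' \<in> carrier G" by auto
    let ?p = "\<pi> m"
    have z: "cm l l' \<in> Z1" "cm l ?p \<in> Z1" "cm l' ?p \<in> Z1" using c class2 by auto
    have "l \<otimes> cm l ?p \<otimes> (l' \<otimes> cm l' ?p) \<otimes> cm l l' = l \<otimes> l' \<otimes> (cm l ?p \<otimes> cm l' ?p) \<otimes> cm l l'"
      using Z1_exchange c z by simp
    also have "\<dots> = l \<otimes> l' \<otimes> cm l l' \<otimes> (cm l ?p \<otimes> cm l' ?p)"
      using c z Z1_commute[OF z(1), of "cm l ?p \<otimes> cm l' ?p"] by (simp add: m_assoc)
    finally show "l \<otimes>\<^bsub>baer\<^esub> l' \<otimes> cm (l \<otimes>\<^bsub>baer\<^esub> l') ?p = l \<otimes> cm l ?p \<otimes>\<^bsub>baer\<^esub> (l' \<otimes> cm l' ?p)"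
      using c by (simp add: cm_bilinear)
  next
    fix m m' l assume "m \<in> carrier M" "m' \<in> carrier M" "l \<in> carrier baer"
    then have c: "\<pi> m \<in> carrier G" "\<pi> m' \<in> carrier G" "l \<in> carrier G" "\<pi> (m \<otimes>\<^bsub>M\<^esub> m') = \<pi> m \<otimes> \<pi> m'"
      by auto
    have "cm l (\<pi> m') \<otimes> cm l (\<pi> m) = cm l (\<pi> m) \<otimes> cm l (\<pi> m')"
      using c Z1_commute[OF class2[of l "\<pi> m'"]] by simp
    then show "l \<otimes> cm l (\<pi> m') \<otimes> cm (l \<otimes> cm l (\<pi> m')) (\<pi> m) = l \<otimes> cm l (\<pi> (m \<otimes>\<^bsub>M\<^esub> m'))"
      using c by (simp add: cm_bilinear m_assoc)
  next
    fix m m' assume "m \<in> carrier M" "m' \<in> carrier M"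
    then have c: "\<pi> m \<in> carrier G" "\<pi> m' \<in> carrier G" "\<pi> (m \<otimes>\<^bsub>M\<^esub> m') = \<pi> m \<otimes> \<pi> m'"
      by auto
    then show "\<pi> (m \<otimes>\<^bsub>M\<^esub> m') = \<pi> m \<otimes>\<^bsub>baer\<^esub> (\<pi> m' \<otimes> cm (\<pi> m') (\<pi> m))"
      using inv_cm[of "\<pi> m'" "\<pi> m", symmetric] by (simp add: cm_bilinear m_assoc)
  next
    fix m l assume "m \<in> carrier M" "l \<in> carrier baer"
    then have c: "\<pi> m \<in> carrier G" "l \<in> carrier G" "\<pi> (m \<otimes>\<^bsub>M\<^esub> m) = \<pi> m \<otimes> \<pi> m" by auto
    let ?p = "\<pi> m"
    have z: "cm l ?p \<in> Z1" using c class2 by auto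
    have "l \<otimes> l \<otimes> cm l ?p \<otimes> (l \<otimes> (cm l ?p \<otimes> cm l ?p)) = l \<otimes> l \<otimes> l \<otimes> (cm l ?p \<otimes> (cm l ?p \<otimes> cm l ?p))"
      using Z1_exchange[of "l \<otimes> l" l "cm l ?p" "cm l ?p \<otimes> cm l ?p"] c z by auto
    also have "\<dots> = \<one>" using cube[of l] cube[of "cm l ?p"] c by (simp add: m_assoc)
    finally show "l \<otimes>\<^bsub>baer\<^esub> (l \<otimes> cm l ?p) \<otimes>\<^bsub>baer\<^esub> (l \<otimes> cm l (\<pi> (m \<otimes>\<^bsub>M\<^esub> m))) = \<one>\<^bsub>baer\<^esub>"
      using c by (simp add: cm_bilinear cm_same m_assoc)
  next
    fix m assume "m \<in> carrier M"
    then show "\<pi> m \<otimes>\<^bsub>baer\<^esub> \<pi> (m \<otimes>\<^bsub>M\<^esub> m) = \<one>\<^bsub>baer\<^esub>"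
      using cube[of "\<pi> m"] by (simp add: cm_bilinear cm_same m_assoc)
  qed (auto simp: cm_one)
qed

end

lemma exponent3_image:
  assumes "exponent3_group G" "group H" "h \<in> hom G H" "h ` carrier G = carrier H"
  shows "exponent3_group H"
proof -
  interpret exponent3_group G by fact
  interpret H: group H by fact
  interpret group_hom G H h by unfold_locales fact
  show ?thesis
  proof
    fix y assume "y \<in> carrier H"
    then obtain x where "x \<in> carrier G" "y = h x" using assms(4) by blast
    then show "y \<otimes>\<^bsub>H\<^esub> y \<otimes>\<^bsub>H\<^esub> y = \<one>\<^bsub>H\<^esub>"
      using cube[of x] by (metis hom_mult hom_one m_closed)
  qed
qed

lemma (in normal) coset_eq_iff:
  assumes "x \<in> carrier G" "y \<in> carrier G"
  shows "H #> x = H #> y \<longleftrightarrow> x \<otimes> inv y \<in> H"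
  using assms by (metis coset_join1 coset_join2 coset_mult_inv1 coset_mult_inv2 inv_closed
      is_subgroup m_closed subset)

lemma (in exponent3_group) quotient_exponent3:
  assumes "R \<lhd> G"
  shows "exponent3_group (G Mod R)" "(\<lambda>x. R #> x) \<in> hom G (G Mod R)"
    "(\<lambda>x. R #> x) ` carrier G = carrier (G Mod R)"
    "\<And>x. x \<in> carrier G \<Longrightarrow> R #> x = \<one>\<^bsub>G Mod R\<^esub> \<longleftrightarrow> x \<in> R"
proof -
  interpret normal R G by fact
  show *: "(\<lambda>x. R #> x) \<in> hom G (G Mod R)" by (rule r_coset_hom_Mod)
  show **: "(\<lambda>x. R #> x) ` carrier G = carrier (G Mod R)" by (simp add: carrier_FactGroup)
  show "exponent3_group (G Mod R)"
    by (rule exponent3_image[OF _ factorgroup_is_group * **]) unfold_locales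
  show "R #> x = \<one>\<^bsub>G Mod R\<^esub> \<longleftrightarrow> x \<in> R" if "x \<in> carrier G" for x
    using coset_eq_iff[of x \<one>] that by (simp add: coset_mult_one subset)
qed

lemma (in exponent3_group) central_normal:
  assumes "subgroup R G" "R \<subseteq> Z1"
  shows "R \<lhd> G"
proof (rule normal_invI[OF assms(1)])
  fix x h assume x: "x \<in> carrier G" and h: "h \<in> R"
  have z: "h \<in> Z1" using h assms(2) by blast
  have "x \<otimes> h \<otimes> inv x = h"
    using x Z1_carrier[OF z] by (simp add: Z1_commute[OF z x, symmetric] m_assoc)
  then show "x \<otimes> h \<otimes> inv x \<in> R" using \<open>h \<in> R\<close> by simp
qed

lemma (in exponent3_group) subgroupI_mult:
  assumes "H \<subseteq> carrier G" "H \<noteq> {}" "\<And>x y. x \<in> H \<Longrightarrow> y \<in> H \<Longrightarrow> x \<otimes> y \<in> H"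
  shows "subgroup H G"
proof (rule subgroupI[OF assms(1,2)])
  fix x assume x: "x \<in> H"
  then have "x \<otimes> x = inv x" using assms(1) inv_square by blast
  then show "inv x \<in> H" using assms(3)[OF x x] by simp
qed (rule assms(3))

lemma (in exponent3_group) commutator_subgroup_incl:
  assumes "subgroup H G" "\<And>x y. x \<in> A \<Longrightarrow> y \<in> B \<Longrightarrow> cm x y \<in> H"
  shows "commutator_subgroup G A B \<subseteq> H"
  unfolding commutator_subgroup_def by (rule generate_subgroup_incl[OF _ assms(1)]) (use assms(2) in blast)

text \<open>Exponent of the new element, coset of \<open>\<gamma>\<^sub>3(M)\<close>, element of
  \<open>M\<close>. The type depends only on that of \<open>M\<close>, so that extensions can be
  iterated.\<close>

type_synonym 'a generic = "nat \<times> 'a set \<times> 'a"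

text \<open>In the extension by \<delta> = \<pi>, the projection onto P =
  M/\<open>\<gamma>\<^sub>3(M)\<close>, the commutator [a, m] is the inverse of \<pi>(m) placed in
  the Baer group, so it vanishes only on \<open>\<gamma>\<^sub>3(M)\<close>. The Baer part of
  \<open>\<gamma>\<^sub>3(N)\<close> stays inside \<open>\<gamma>\<^sub>2(P)\<close>, so [a, m] in
  \<open>\<gamma>\<^sub>3(N)\<close> forces m into \<open>\<gamma>\<^sub>2(M)\<close>.\<close>

lemma generic_extension:
  fixes M :: "('a, 'b) monoid_scheme"
  assumes "exponent3_group M"
  obtains N :: "'a generic monoid" and h a \<rho>
  where "exponent3_group N" "h \<in> hom M N" "a \<in> carrier N" "\<rho> \<in> hom N M"
    "\<And>m. m \<in> carrier M \<Longrightarrow> \<rho> (h m) = m" "\<rho> a = \<one>\<^bsub>M\<^esub>"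
    "carrier N = generate N (h ` carrier M \<union> {a})"
    "a \<notin> gamma2 N (carrier N)"
    "\<And>m. m \<in> carrier M \<Longrightarrow> commutator N a (h m) = \<one>\<^bsub>N\<^esub> \<Longrightarrow> m \<in> gamma3 M (carrier M)"
    "\<And>m. m \<in> carrier M \<Longrightarrow> commutator N a (h m) \<in> gamma3 N (carrier N) \<Longrightarrow> m \<in> gamma2 M (carrier M)"
proof -
  interpret M: exponent3_group M by fact
  define R where "R = gamma3 M (carrier M)"
  have R: "subgroup R M" "R \<subseteq> M.Z1"
    using M.gamma3_subgroup M.gamma3_Z1 by (auto simp: R_def)
  have Rn: "R \<lhd> M" using M.central_normal R by blast
  define P where "P = M Mod R"
  define \<pi> where "\<pi> m = R #>\<^bsub>M\<^esub> m" for m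
  note Q = M.quotient_exponent3[OF Rn, folded P_def \<pi>_def]
  interpret P: exponent3_group P by (rule Q)
  interpret \<pi>: group_hom M P \<pi> using Q(2) by unfold_locales
  have surj: "\<exists>m\<in>carrier M. y = \<pi> m" if "y \<in> carrier P" for y using that Q(3) by blast
  interpret P: class2_group P
  proof
    fix x y assume "x \<in> carrier P" "y \<in> carrier P"
    then obtain m k where m: "m \<in> carrier M" "x = \<pi> m" and k: "k \<in> carrier M" "y = \<pi> k"
      using surj by meson
    have "P.cm (P.cm x y) z = \<one>\<^bsub>P\<^esub>" if "z \<in> carrier P" for z
    proof -
      obtain j where j: "j \<in> carrier M" "z = \<pi> j" using surj \<open>z \<in> carrier P\<close> by meson
      have "M.cm (M.cm m k) j \<in> R"
        unfolding R_def using m k j by (intro M.cm_gamma3 M.cm_gamma2)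
      then have "\<pi> (M.cm (M.cm m k) j) = \<one>\<^bsub>P\<^esub>" using Q(4) m k j by simp
      then show ?thesis using m k j by (simp add: \<pi>.hom_commutator)
    qed
    then show "P.cm x y \<in> P.Z1" using \<open>x \<in> carrier P\<close> \<open>y \<in> carrier P\<close> unfolding centre_def by auto
  qed
  define act where "act m l = l \<otimes>\<^bsub>P\<^esub> P.cm l (\<pi> m)" for m l
  interpret D: derivation M P.baer act \<pi>
    unfolding act_def using P.baer_derivation[OF assms Q(2)] .
  define N where "N = D.ext"
  note N_simps [simp] = D.ext_simps[folded N_def]
  interpret N: exponent3_group N unfolding N_def by (rule D.ext_exponent3)
  define h where "h m = (0::nat, \<one>\<^bsub>P\<^esub>, m)" for m :: 'a
  define a where "a = (1::nat, \<one>\<^bsub>P\<^esub>, \<one>\<^bsub>M\<^esub>)"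
  define \<rho> where "\<rho> = (\<lambda>(s::nat, l::'a set, m::'a). m)"
  have act1: "act m \<one>\<^bsub>P\<^esub> = \<one>\<^bsub>P\<^esub>" if "m \<in> carrier M" for m using D.act_L_one[OF that] by simp
  have act_id: "act \<one>\<^bsub>M\<^esub> l = l" if "l \<in> carrier P" for l using D.act_one that by simp
  have h: "h \<in> hom M N" by (auto simp: hom_def h_def act1 P.cm_one)
  have a: "a \<in> carrier N" by (simp add: a_def)
  have \<rho>: "\<rho> \<in> hom N M" by (auto simp: hom_def \<rho>_def)
  have comm: "commutator N a (h m) = (0, inv\<^bsub>P.baer\<^esub> (\<pi> m), \<one>\<^bsub>M\<^esub>)" (is "_ = ?c") if m: "m \<in> carrier M" for m
  proof -
    have hm: "h m \<in> carrier N" using m by (simp add: h_def)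
    have c: "?c \<in> carrier N" using D.L.inv_closed[of "\<pi> m"] m by simp
    have "?c \<otimes>\<^bsub>N\<^esub> (h m \<otimes>\<^bsub>N\<^esub> a) = a \<otimes>\<^bsub>N\<^esub> h m"
      using m D.L.l_inv[of "\<pi> m"] D.L.inv_closed[of "\<pi> m"] act_id
      by (simp add: h_def a_def act1 P.cm_one del: D.L.l_inv)
    then show ?thesis using N.cm_swap[OF a hm] c a hm
      by (metis N.cm_closed N.m_closed N.r_cancel)
  qed
  have M2: "subgroup (gamma2 M (carrier M)) M" by (rule M.gamma2_subgroup) (rule subset_refl)
  \<comment> \<open>The right side is closed under products and contains all commutators: their
    \<int>/3-part is 0, and by \<rho> their \<open>M\<close>-part is a commutator of
    \<open>M\<close>.\<close>
  have W2: "gamma2 N (carrier N) \<subseteq> {0} \<times> UNIV \<times> gamma2 M (carrier M)" (is "_ \<subseteq> ?W")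
  proof -
    have "subgroup (?W \<inter> carrier N) N"
    proof (rule N.subgroupI_mult)
      have "\<one>\<^bsub>N\<^esub> \<in> ?W"
        unfolding N_simps using subgroup.one_closed[OF M2] by blast
      then show "?W \<inter> carrier N \<noteq> {}" using N.one_closed by (metis IntI empty_iff)
      show "x \<otimes>\<^bsub>N\<^esub> y \<in> ?W \<inter> carrier N" if "x \<in> ?W \<inter> carrier N" "y \<in> ?W \<inter> carrier N" for x y
        using that N.m_closed[of x y] subgroup.m_closed[OF M2]
        by (cases x, cases y) auto
    qed auto
    moreover have "N.cm x y \<in> ?W \<inter> carrier N" if "x \<in> carrier N" "y \<in> carrier N" for x y
    proof -
      obtain s l m s' l' m' where e: "x = (s, l, m)" "y = (s', l', m')" by (cases x, cases y)
      obtain t k j where f: "N.cm x y = (t, k, j)" by (cases "N.cm x y")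
      have c: "N.cm x y \<in> carrier N" using that by simp
      have "x \<otimes>\<^bsub>N\<^esub> y = (t, k, j) \<otimes>\<^bsub>N\<^esub> (y \<otimes>\<^bsub>N\<^esub> x)"
        using N.cm_swap[OF that] by (simp only: f)
      then have "(s + s') mod 3 = (t + (s' + s)) mod 3"
        by (simp add: e mod_add_right_eq del: P.baer_simps)
      moreover have "t < 3" using c by (simp only: f N_simps)
      ultimately have "t = 0" by presburger
      moreover interpret \<rho>: group_hom N M \<rho> using \<rho> by unfold_locales
      have "j = M.cm m m'"
        using \<rho>.hom_commutator[OF that] by (simp add: f, simp add: e \<rho>_def)
      moreover have "M.cm m m' \<in> gamma2 M (carrier M)"
        using that by (intro M.cm_gamma2) (simp_all add: e)
      ultimately show ?thesis using c by (simp add: f)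
    qed
    ultimately show ?thesis unfolding gamma2_def using N.commutator_subgroup_incl by blast
  qed
  define \<Gamma> where "\<Gamma> = gamma2 P (carrier P)"
  have \<Gamma>: "subgroup \<Gamma> P" "\<Gamma> \<subseteq> P.Z1"
    unfolding \<Gamma>_def
    using P.gamma2_subgroup[OF subset_refl] P.commutator_subgroup_incl[OF P.Z1_subgroup P.class2]
    by (simp_all add: gamma2_def)
  have \<Gamma>_cm: "P.cm x y \<in> \<Gamma>" if "x \<in> carrier P" "y \<in> carrier P" for x y
    unfolding \<Gamma>_def using P.cm_gamma2 that by blast
  have \<Gamma>_\<pi>: "\<Gamma> = \<pi> ` gamma2 M (carrier M)"
    unfolding \<Gamma>_def using \<pi>.gamma2_image[of "carrier M"] Q(3) by simp
  \<comment> \<open>Modulo \<Gamma> the Baer product agrees with the product of P, the group is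
    abelian and \<open>M\<close> acts trivially, so the Baer part of a commutator can be found by
    cancellation.\<close>
  define \<kappa> where "\<kappa> x = \<Gamma> #>\<^bsub>P\<^esub> x" for x
  define V where "V = P Mod \<Gamma>"
  note K = P.quotient_exponent3[OF P.central_normal[OF \<Gamma>], folded \<kappa>_def V_def]
  interpret V: group V using K(1) by (simp add: exponent3_group_def)
  interpret \<kappa>: group_hom P V \<kappa> using K(2) by unfold_locales
  have \<kappa>_one: "\<kappa> x = \<one>\<^bsub>V\<^esub>" if "x \<in> \<Gamma>" for x
    using K(4)[of x] subgroup.mem_carrier[OF \<Gamma>(1) that] that by blast
  have \<kappa>_comm: "\<kappa> x \<otimes>\<^bsub>V\<^esub> \<kappa> y = \<kappa> y \<otimes>\<^bsub>V\<^esub> \<kappa> x" if "x \<in> carrier P" "y \<in> carrier P" for x y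
  proof -
    have "\<kappa> (x \<otimes>\<^bsub>P\<^esub> y) = \<kappa> (P.cm x y \<otimes>\<^bsub>P\<^esub> (y \<otimes>\<^bsub>P\<^esub> x))"
      by (rule arg_cong[OF P.cm_swap[OF that]])
    then show ?thesis using that \<kappa>_one[OF \<Gamma>_cm[OF that]] by simp
  qed
  have \<kappa>_baer: "\<kappa> (x \<otimes>\<^bsub>P.baer\<^esub> y) = \<kappa> x \<otimes>\<^bsub>V\<^esub> \<kappa> y" if "x \<in> carrier P" "y \<in> carrier P" for x y
    using that \<kappa>_one[OF \<Gamma>_cm[OF that]] by simp
  have \<kappa>_act: "\<kappa> (act m l) = \<kappa> l" if "m \<in> carrier M" "l \<in> carrier P" for m l
    using that \<kappa>_one[OF \<Gamma>_cm[of l "\<pi> m"]] by (simp add: act_def)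
  have \<kappa>_pow: "\<kappa> (x [^]\<^bsub>P.baer\<^esub> (s::nat)) = \<one>\<^bsub>V\<^esub>" if "x \<in> \<Gamma>" for x s
  proof (induction s)
    case (Suc s)
    have "x \<in> carrier P" using subgroup.mem_carrier[OF \<Gamma>(1) that] .
    moreover from this have "x [^]\<^bsub>P.baer\<^esub> s \<in> carrier P" using D.L.nat_pow_closed[of x s] by simp
    ultimately show ?case using Suc \<kappa>_baer[of "x [^]\<^bsub>P.baer\<^esub> s" x] \<kappa>_one[OF that]
      by (simp del: P.baer_simps(3))
  qed simp
  \<comment> \<open>By \<open>W2\<close> an element of \<open>\<gamma>\<^sub>2(N)\<close> has
    \<open>M\<close>-part in \<open>\<gamma>\<^sub>2(M)\<close>, so the derivation contributes only
    powers of elements of \<Gamma>, and \<kappa> kills these.\<close>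
  have W3: "gamma3 N (carrier N) \<subseteq> {0} \<times> \<Gamma> \<times> UNIV" (is "_ \<subseteq> ?W")
  proof -
    have "subgroup (?W \<inter> carrier N) N"
    proof (rule N.subgroupI_mult)
      have "\<one>\<^bsub>N\<^esub> \<in> ?W"
        using subgroup.one_closed[OF \<Gamma>(1)] by simp
      then show "?W \<inter> carrier N \<noteq> {}" using N.one_closed by (metis IntI empty_iff)
      show "x \<otimes>\<^bsub>N\<^esub> y \<in> ?W \<inter> carrier N" if x: "x \<in> ?W \<inter> carrier N" and y: "y \<in> ?W \<inter> carrier N" for x y
      proof -
        obtain l m l' m' where e: "x = (0, l, m)" "y = (0, l', m')" "l \<in> \<Gamma>" "l' \<in> \<Gamma>"
          using x y by (cases x, cases y) auto
        have c: "l \<in> carrier P" "l' \<in> carrier P" "m \<in> carrier M" using x y by (auto simp: e)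
        have "act m l' \<in> \<Gamma>" unfolding act_def using c e \<Gamma>_cm subgroup.m_closed[OF \<Gamma>(1)] by simp
        moreover from this have "act m l' \<in> carrier P" using subgroup.mem_carrier[OF \<Gamma>(1)] by blast
        ultimately have "l \<otimes>\<^bsub>P.baer\<^esub> act m l' \<in> \<Gamma>" "l \<otimes>\<^bsub>P.baer\<^esub> act m l' \<in> carrier P.baer"
          using c e \<Gamma>_cm subgroup.m_closed[OF \<Gamma>(1)] by simp_all
        then have "l \<otimes>\<^bsub>P.baer\<^esub> act m l' \<otimes>\<^bsub>P.baer\<^esub> \<pi> m [^]\<^bsub>P.baer\<^esub> (0::nat) \<in> \<Gamma>"
          using D.L.r_one by (simp del: P.baer_simps)
        then show ?thesis using N.m_closed[of x y] x y by (simp add: e del: P.baer_simps)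
      qed
    qed auto
    moreover have "N.cm x y \<in> ?W \<inter> carrier N" if x: "x \<in> gamma2 N (carrier N)" and y: "y \<in> carrier N" for x y
    proof -
      have xc: "x \<in> carrier N"
        using x subgroup.mem_carrier[OF N.gamma2_subgroup[OF subset_refl]] by blast
      obtain l m s l' m' where e: "x = (0, l, m)" "y = (s, l', m')" and m: "m \<in> gamma2 M (carrier M)"
        using x W2 by (cases x, cases y) auto
      obtain k j where f: "N.cm x y = (0, k, j)" and j: "j \<in> gamma2 M (carrier M)"
        using W2 N.cm_gamma2[OF xc y] by (cases "N.cm x y") auto
      have c: "(0, k, j) \<in> carrier N" using N.cm_closed[OF xc y] by (simp only: f)
      have c': "l \<in> carrier P" "l' \<in> carrier P" "k \<in> carrier P" "m \<in> carrier M" "m' \<in> carrier M" "j \<in> carrier M"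
        using xc y c by (auto simp: e f)
      have ac: "act i u \<in> carrier P" if "i \<in> carrier M" "u \<in> carrier P" for i u
        using D.act_closed that by simp
      have pw: "u [^]\<^bsub>P.baer\<^esub> (r::nat) \<in> carrier P" if "u \<in> carrier P" for u r
        using D.L.nat_pow_closed that by simp
      have bc: "u \<otimes>\<^bsub>P.baer\<^esub> v \<in> carrier P" if "u \<in> carrier P" "v \<in> carrier P" for u v
        using D.L.m_closed that by simp
      have \<pi>m: "\<pi> m \<in> \<Gamma>" "\<pi> j \<in> \<Gamma>" using m j \<Gamma>_\<pi> by auto
      have "x \<otimes>\<^bsub>N\<^esub> y = (0, k, j) \<otimes>\<^bsub>N\<^esub> (y \<otimes>\<^bsub>N\<^esub> x)"
        using N.cm_swap[OF xc y] by (simp only: f)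
      then have "l \<otimes>\<^bsub>P.baer\<^esub> act m l' \<otimes>\<^bsub>P.baer\<^esub> \<pi> m [^]\<^bsub>P.baer\<^esub> s =
        k \<otimes>\<^bsub>P.baer\<^esub> act j (l' \<otimes>\<^bsub>P.baer\<^esub> act m' l \<otimes>\<^bsub>P.baer\<^esub> \<pi> m' [^]\<^bsub>P.baer\<^esub> (0::nat))
          \<otimes>\<^bsub>P.baer\<^esub> \<pi> j [^]\<^bsub>P.baer\<^esub> ((s + 0) mod 3)"
        by (simp add: e del: P.baer_simps)
      from arg_cong[OF this, of \<kappa>]
      have "\<kappa> l \<otimes>\<^bsub>V\<^esub> \<kappa> l' = \<kappa> k \<otimes>\<^bsub>V\<^esub> (\<kappa> l' \<otimes>\<^bsub>V\<^esub> \<kappa> l)"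
        using c' \<pi>m
        by (simp add: \<kappa>_baer \<kappa>_act \<kappa>_pow ac pw bc \<kappa>_one del: P.baer_simps(3))
      then have "\<kappa> k = \<one>\<^bsub>V\<^esub>"
        using \<kappa>_comm[of l l'] c' by (metis V.m_closed V.r_cancel_one' \<kappa>.hom_closed)
      then show ?thesis using K(4) c c' by (simp add: f)
    qed
    ultimately show ?thesis unfolding gamma3_def using N.commutator_subgroup_incl by blast
  qed
  have binv: "inv\<^bsub>P.baer\<^esub> x = inv\<^bsub>P\<^esub> x" if "x \<in> carrier P" for x
  proof (rule D.L.inv_equality)
    show "inv\<^bsub>P\<^esub> x \<otimes>\<^bsub>P.baer\<^esub> x = \<one>\<^bsub>P.baer\<^esub>" using that by (simp add: P.word)
  qed (use that in auto)
  show thesis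
  proof (rule that[of N h a \<rho>])
    show "exponent3_group N" ..
    show "\<rho> (h m) = m" for m by (simp add: \<rho>_def h_def)
    show "\<rho> a = \<one>\<^bsub>M\<^esub>" by (simp add: \<rho>_def a_def)
    show "a \<notin> gamma2 N (carrier N)" using W2 by (auto simp: a_def)
    show "m \<in> gamma3 M (carrier M)" if "m \<in> carrier M" "commutator N a (h m) = \<one>\<^bsub>N\<^esub>" for m
    proof -
      have "inv\<^bsub>P\<^esub> (\<pi> m) = \<one>\<^bsub>P\<^esub>" using that comm binv by simp
      then have "\<pi> m = \<one>\<^bsub>P\<^esub>" using that P.inv_eq_1_iff by simp
      then show ?thesis using Q(4) that by (simp add: R_def)
    qed
    show "m \<in> gamma2 M (carrier M)"
      if "m \<in> carrier M" "commutator N a (h m) \<in> gamma3 N (carrier N)" for m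
    proof -
      have "inv\<^bsub>P\<^esub> (\<pi> m) \<in> \<Gamma>" using that comm binv W3 by auto
      then have "\<pi> m \<in> \<Gamma>" using subgroup.m_inv_closed[OF \<Gamma>(1)] that by fastforce
      then obtain k where k: "k \<in> gamma2 M (carrier M)" "\<pi> m = \<pi> k" using \<Gamma>_\<pi> by blast
      note g2 = M2
      have kc: "k \<in> carrier M" using k subgroup.mem_carrier[OF g2] by blast
      have "\<pi> (m \<otimes>\<^bsub>M\<^esub> inv\<^bsub>M\<^esub> k) = \<one>\<^bsub>P\<^esub>" using k kc that by simp
      then have "m \<otimes>\<^bsub>M\<^esub> inv\<^bsub>M\<^esub> k \<in> gamma2 M (carrier M)"
        using Q(4)[of "m \<otimes>\<^bsub>M\<^esub> inv\<^bsub>M\<^esub> k"] kc that M.gamma3_sub_gamma2[OF M.subgroup_self]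
        unfolding R_def by (metis M.inv_closed M.m_closed subsetD)
      then have "m \<otimes>\<^bsub>M\<^esub> inv\<^bsub>M\<^esub> k \<otimes>\<^bsub>M\<^esub> k \<in> gamma2 M (carrier M)"
        using k subgroup.m_closed[OF g2] by blast
      then show ?thesis using kc that by (simp add: M.m_assoc)
    qed
    show "carrier N = generate N (h ` carrier M \<union> {a})" (is "_ = ?E")
    proof
      have ca: "h ` carrier M \<union> {a} \<subseteq> carrier N" using a h by (auto simp: hom_def)
      show "?E \<subseteq> carrier N" using N.generate_incl[OF ca] .
      have E: "subgroup ?E N" using N.generate_is_subgroup[OF ca] .
      have aE: "a \<in> ?E" and hE: "m \<in> carrier M \<Longrightarrow> h m \<in> ?E" for m by (auto intro: generate.incl)
      have s: "(s, \<one>\<^bsub>P\<^esub>, \<one>\<^bsub>M\<^esub>) \<in> ?E" if "s < 3" for s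
      proof -
        consider "s = 0" | "s = 1" | "s = 2" using \<open>s < 3\<close> by linarith
        then show ?thesis
        proof cases
          case 1 then show ?thesis using subgroup.one_closed[OF E] by simp
        next
          case 2 then show ?thesis using aE by (simp add: a_def)
        next
          case 3
          have "a \<otimes>\<^bsub>N\<^esub> a = (2, \<one>\<^bsub>P\<^esub>, \<one>\<^bsub>M\<^esub>)" using D.\<delta>_one by (simp add: a_def act_id P.cm_one)
          then show ?thesis using 3 subgroup.m_closed[OF E aE aE] by simp
        qed
      qed
      \<comment> \<open>As \<pi> is onto, every element of the Baer group is a commutator of a with
        some h m.\<close>
      have l: "(0, l, \<one>\<^bsub>M\<^esub>) \<in> ?E" if "l \<in> carrier P" for l
      proof -
        obtain m where m: "m \<in> carrier M" "inv\<^bsub>P\<^esub> l = \<pi> m"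
          using surj[OF P.inv_closed[OF \<open>l \<in> carrier P\<close>]] by blast
        then have "commutator N a (h m) = (0, l, \<one>\<^bsub>M\<^esub>)" using comm binv that by (metis P.inv_closed P.inv_inv)
        moreover have "commutator N a (h m) \<in> ?E" unfolding commutator_def
          using aE hE[OF m(1)] subgroup.m_closed[OF E] subgroup.m_inv_closed[OF E] by simp
        ultimately show ?thesis by simp
      qed
      show "carrier N \<subseteq> ?E"
      proof
        fix x assume "x \<in> carrier N"
        then obtain s u m where x: "x = (s, u, m)" and c: "s < 3" "u \<in> carrier P" "m \<in> carrier M"
          by (cases x) auto
        have "(s, \<one>\<^bsub>P\<^esub>, \<one>\<^bsub>M\<^esub>) \<otimes>\<^bsub>N\<^esub> (0, u, \<one>\<^bsub>M\<^esub>) \<otimes>\<^bsub>N\<^esub> h m = x"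
          using c by (simp add: x h_def act_id P.cm_one)
        then show "x \<in> ?E" using s[OF c(1)] l[OF c(2)] hE[OF c(3)] subgroup.m_closed[OF E] by metis
      qed
    qed
  qed fact+
qed

section \<open>Generic extensions and the lower central series\<close>

context exponent3_group
begin

text \<open>Expanding [a, l l'] produces the central error [[l, l'], a]; the additional factor
  [l, l'] contributes the inverse of this error.\<close>

lemma cm_generic_mult:
  assumes a: "a \<in> carrier G" and l: "l \<in> carrier G" "l' \<in> carrier G"
  shows "cm a l \<otimes> cm a l' = cm a (l \<otimes> l' \<otimes> cm l l')"
proof -
  let ?t = "cm (cm l l') a"
  have z: "?t \<in> Z1" using Z2_D(1) a l by blast
  have "cm a (cm l l') = inv ?t" using a l by (simp add: inv_cm)
  then have 1: "cm a (l \<otimes> l' \<otimes> cm l l') = inv ?t \<otimes> cm a (l \<otimes> l')"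
    using Z2_mult_left(4)[OF cm_in_Z2[OF l], of "l \<otimes> l'" a] a l by simp
  have "cm (cm a l') l = cm (cm l' l) a" using trilinear_cyc a l by blast
  also have "\<dots> = inv ?t" using trilinear_swap12 a l by blast
  finally have "cm l (cm a l') = ?t" using inv_cm[of "cm a l'" l] a l by simp
  then have "cm a (l \<otimes> l') = cm a l \<otimes> ?t \<otimes> cm a l'" using cm_mult_right a l by simp
  also have "\<dots> = ?t \<otimes> (cm a l \<otimes> cm a l')"
    using Z1_commute[OF z, of "cm a l"] a l by (metis m_assoc cm_closed)
  finally show ?thesis using 1 a l by (simp add: inv_cancel)
qed

text \<open>The correction [c, [a, l]] is brought by \<open>trilinear_cyc\<close> to the form
  [a, l'] with l' = [l, c], so moving elements of \<open>C\<close> past commutators [a, l] creates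
  nothing but further commutators of this kind.\<close>

lemma cm_generic_conj:
  assumes a: "a \<in> carrier G" and l: "l \<in> carrier G" and c: "c \<in> carrier G"
  shows "c \<otimes> cm a l = cm a (cm l c) \<otimes> cm a l \<otimes> c"
proof -
  have "cm c (cm a l) = inv (cm (cm a l) c)" using a l c by (simp add: inv_cm)
  also have "cm (cm a l) c = cm (cm l c) a" using trilinear_cyc a l c by blast
  also have "inv (cm (cm l c) a) = cm a (cm l c)" using a l c by (simp add: inv_cm)
  finally show ?thesis using cm_swap[of c "cm a l"] a l c by (simp add: m_assoc)
qed

lemma cm_self_commute:
  assumes "a \<in> carrier G" "l \<in> carrier G"
  shows "cm a l \<otimes> a = a \<otimes> cm a l"
  using cm_cm_same[OF assms] cm_eq_one_iff[of a "cm a l"] assms by simp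

text \<open>
  Every element of \<open>\<langle>C, a\<rangle>\<close> has the form \<open>a\<^sup>i [a, l] c\<close>, because the commutators
  \<open>[a, l]\<close> form an abelian subgroup centralised by \<open>a\<close>: its product is the Baer sum of the \<open>l\<close>.
\<close>

lemma normal_form:
  assumes C: "subgroup C G" and a: "a \<in> carrier G" and d: "d \<in> generate G (C \<union> {a})"
  shows "\<exists>p\<in>{\<one>, a, a \<otimes> a}. \<exists>l\<in>C. \<exists>c\<in>C. d = p \<otimes> cm a l \<otimes> c"
proof -
  define P where "P = {\<one>, a, a \<otimes> a}"
  define W where "W = cm a ` C"
  define S where "S = {p \<otimes> w \<otimes> c | p w c. p \<in> P \<and> w \<in> W \<and> c \<in> C}"
  note Cc = subgroup.mem_carrier[OF C] and Cm = subgroup.m_closed[OF C] and Ci = subgroup.m_inv_closed[OF C]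
  have cmC: "cm x y \<in> C" if "x \<in> C" "y \<in> C" for x y
    using that Cm Ci by (simp add: commutator_def)
  have Pc: "p \<in> carrier G" if "p \<in> P" for p using that a by (auto simp: P_def)
  have Wc: "w \<in> carrier G" if "w \<in> W" for w using that a Cc by (auto simp: W_def)
  have WW: "w \<otimes> w' \<in> W" if w: "w \<in> W" "w' \<in> W" for w w'
  proof -
    obtain l l' where "l \<in> C" "l' \<in> C" "w = cm a l" "w' = cm a l'" using w by (auto simp: W_def)
    then show ?thesis using cm_generic_mult[OF a Cc Cc] Cm cmC by (auto simp: W_def)
  qed
  have aP: "a \<otimes> p \<in> P" if "p \<in> P" for p
    using that a cube[OF a] by (auto simp: P_def m_assoc)
  have Wa: "w \<otimes> a = a \<otimes> w" if "w \<in> W" for w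
    using that cm_self_commute a Cc by (auto simp: W_def)
  have WP: "w \<otimes> p = p \<otimes> w" if w: "w \<in> W" and p: "p \<in> P" for w p
  proof -
    have "w \<otimes> (a \<otimes> a) = a \<otimes> a \<otimes> w"
      using Wa[OF w] Wc[OF w] a by (metis m_assoc)
    then show ?thesis using p Wa[OF w] Wc[OF w] by (auto simp: P_def)
  qed
  have CW: "\<exists>w'\<in>W. c \<otimes> w = w' \<otimes> c" if c: "c \<in> C" and w: "w \<in> W" for c w
  proof -
    obtain l where l: "l \<in> C" "w = cm a l" using w by (auto simp: W_def)
    have "c \<otimes> w = cm a (cm l c) \<otimes> w \<otimes> c" using cm_generic_conj[OF a Cc Cc, of l c] l c by simp
    moreover have "cm a (cm l c) \<otimes> w \<in> W" using WW w cmC[OF l(1) c] by (auto simp: W_def)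
    ultimately show ?thesis by blast
  qed
  have Ca: "\<exists>w\<in>W. c \<otimes> a = a \<otimes> w \<otimes> c" if c: "c \<in> C" for c
  proof -
    \<comment> \<open>This is [c, a], written as [a, c]^2 = [a, c]^-1 to show that it lies in
      \<open>W\<close>.\<close>
    let ?w = "cm a c \<otimes> cm a c"
    have w: "?w \<in> W" using WW c by (auto simp: W_def)
    have "?w = cm c a" using a Cc[OF c] inv_square[of "cm a c"] by (simp add: inv_cm)
    then have "c \<otimes> a = ?w \<otimes> a \<otimes> c" using cm_swap[OF Cc[OF c] a] a Cc[OF c] by (simp add: m_assoc)
    then show ?thesis using w Wa[OF w] by auto
  qed
  have oneW: "\<one> \<in> W" using cm_one(1)[OF a] subgroup.one_closed[OF C] by (force simp: W_def)
  have CP: "\<exists>w\<in>W. c \<otimes> p = p \<otimes> w \<otimes> c" if c: "c \<in> C" and p: "p \<in> P" for c p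
  proof -
    obtain w where w: "w \<in> W" "c \<otimes> a = a \<otimes> w \<otimes> c" using Ca[OF c] by blast
    note cs = Wc[OF w(1)] Cc[OF c] a
    have "c \<otimes> (a \<otimes> a) = c \<otimes> a \<otimes> a" using cs by (simp add: m_assoc)
    also have "\<dots> = a \<otimes> w \<otimes> (c \<otimes> a)" unfolding w(2) using cs w(2) by (simp add: m_assoc)
    also have "\<dots> = a \<otimes> w \<otimes> (a \<otimes> w \<otimes> c)" by (simp only: w(2))
    also have "\<dots> = a \<otimes> (w \<otimes> a) \<otimes> w \<otimes> c" using cs by (simp add: m_assoc)
    also have "\<dots> = a \<otimes> (a \<otimes> w) \<otimes> w \<otimes> c" by (simp only: Wa[OF w(1)])
    also have "\<dots> = a \<otimes> a \<otimes> (w \<otimes> w) \<otimes> c" using cs by (simp add: m_assoc)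
    finally have "c \<otimes> (a \<otimes> a) = a \<otimes> a \<otimes> (w \<otimes> w) \<otimes> c" .
    then have "\<exists>w\<in>W. c \<otimes> (a \<otimes> a) = a \<otimes> a \<otimes> w \<otimes> c" using WW[OF w(1) w(1)] by blast
    moreover have "\<exists>w\<in>W. c \<otimes> \<one> = \<one> \<otimes> w \<otimes> c" using oneW Cc[OF c] by (intro bexI[of _ \<one>]) auto
    ultimately show ?thesis using p Ca[OF c] unfolding P_def by blast
  qed
  have Sc: "S \<subseteq> carrier G" using Pc Wc Cc by (auto simp: S_def)
  have oneP: "\<one> \<in> P" by (simp add: P_def)
  have oneC: "\<one> \<in> C" using subgroup.one_closed[OF C] .
  have PP: "p \<otimes> q \<in> P" if "p \<in> P" "q \<in> P" for p q
  proof -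
    have "a \<otimes> a \<otimes> q \<in> P" using aP[OF aP[OF \<open>q \<in> P\<close>]] a Pc[OF \<open>q \<in> P\<close>] by (simp add: m_assoc)
    then show ?thesis using that(1) aP[OF \<open>q \<in> P\<close>] \<open>q \<in> P\<close> Pc[OF \<open>q \<in> P\<close>]
      by (metis P_def empty_iff insert_iff l_one)
  qed
  have SS: "d \<otimes> e \<in> S" if "d \<in> S" "e \<in> S" for d e
  proof -
    obtain p w c p' w' c' where d: "p \<in> P" "w \<in> W" "c \<in> C" "d = p \<otimes> w \<otimes> c"
      and e: "p' \<in> P" "w' \<in> W" "c' \<in> C" "e = p' \<otimes> w' \<otimes> c'"
      using \<open>d \<in> S\<close> \<open>e \<in> S\<close> unfolding S_def by blast
    obtain u where u: "u \<in> W" "c \<otimes> p' = p' \<otimes> u \<otimes> c" using CP d e by blast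
    obtain v where v: "v \<in> W" "c \<otimes> w' = v \<otimes> c" using CW d e by blast
    note cs = Pc[OF d(1)] Wc[OF d(2)] Cc[OF d(3)] Pc[OF e(1)] Wc[OF e(2)] Cc[OF e(3)] Wc[OF u(1)] Wc[OF v(1)]
    have "d \<otimes> e = p \<otimes> w \<otimes> (c \<otimes> p') \<otimes> w' \<otimes> c'" using cs by (simp add: d e m_assoc)
    also have "\<dots> = p \<otimes> w \<otimes> p' \<otimes> u \<otimes> (c \<otimes> w') \<otimes> c'" using cs by (simp add: u(2) m_assoc)
    also have "\<dots> = p \<otimes> (w \<otimes> p') \<otimes> u \<otimes> v \<otimes> c \<otimes> c'" using cs by (simp add: v(2) m_assoc)
    also have "\<dots> = (p \<otimes> p') \<otimes> (w \<otimes> u \<otimes> v) \<otimes> (c \<otimes> c')"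
      using cs by (simp add: WP[OF d(2) e(1)] m_assoc)
    finally show ?thesis unfolding S_def
      using PP[OF d(1) e(1)] WW[OF WW[OF d(2) u(1)] v(1)] Cm[OF d(3) e(3)] by blast
  qed
  have "\<one> \<otimes> \<one> \<otimes> \<one> \<in> S" unfolding S_def using oneP oneW oneC by blast
  then have "subgroup S G" using subgroupI_mult[OF Sc _ SS] by blast
  moreover have "C \<union> {a} \<subseteq> S"
  proof -
    have "\<one> \<otimes> \<one> \<otimes> c \<in> S" if "c \<in> C" for c unfolding S_def using oneP oneW that by blast
    moreover have "a \<otimes> \<one> \<otimes> \<one> \<in> S" unfolding S_def using oneC oneW by (auto simp: P_def)
    ultimately show ?thesis using Cc a by auto
  qed
  ultimately have "d \<in> S" using d generate_subgroup_incl by blast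
  then show ?thesis unfolding S_def P_def W_def by blast
qed

text \<open>Every subgroup that is moved into \<open>M\<close> has to be finite, since its
  multiplication table must fit into one formula. The normal form supplies the bound.\<close>

lemma finite_adjoin:
  assumes "subgroup C G" "finite C" "a \<in> carrier G"
  shows "finite (generate G (C \<union> {a}))"
proof -
  have "generate G (C \<union> {a}) \<subseteq> (\<lambda>(p, l, c). p \<otimes> cm a l \<otimes> c) ` ({\<one>, a, a \<otimes> a} \<times> C \<times> C)"
  proof
    fix d assume "d \<in> generate G (C \<union> {a})"
    then obtain p l c where "p \<in> {\<one>, a, a \<otimes> a}" "l \<in> C" "c \<in> C" "d = p \<otimes> cm a l \<otimes> c"
      using normal_form[OF assms(1,3)] by blast
    then show "d \<in> (\<lambda>(p, l, c). p \<otimes> cm a l \<otimes> c) ` ({\<one>, a, a \<otimes> a} \<times> C \<times> C)"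
      by (intro image_eqI[of _ _ "(p, l, c)"]) auto
  qed
  then show ?thesis using assms(2) by (meson finite.emptyI finite_SigmaI finite_imageI finite_insert finite_subset)
qed

end

text \<open>
  \<open>tame G K H C D\<close> says that an overgroup \<open>D\<close> of \<open>C\<close> in an overgroup \<open>K\<close> of \<open>H\<close> meets the
  lower central series of \<open>K\<close> only in what is forced by the intersection of \<open>C\<close> with that of \<open>H\<close>.
\<close>

definition spread2 :: "('a, 'b) monoid_scheme \<Rightarrow> 'a set \<Rightarrow> 'a set \<Rightarrow> 'a set \<Rightarrow> 'a set"
  where "spread2 G H C D = generate G ((C \<inter> gamma2 G H) \<union> gamma2 G D)"

text \<open>Commutators are formed with \<open>spread2\<close> and not with
  \<open>\<gamma>\<^sub>2(D)\<close>: an l in \<open>C\<close> that is a product of commutators only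
  in the larger \<open>H\<close> still forces [l, g] into \<open>\<gamma>\<^sub>3\<close> of the
  overgroup, for every g in \<open>D\<close>.\<close>

definition spread3 :: "('a, 'b) monoid_scheme \<Rightarrow> 'a set \<Rightarrow> 'a set \<Rightarrow> 'a set \<Rightarrow> 'a set"
  where "spread3 G H C D = generate G ((C \<inter> gamma3 G H) \<union> {commutator G l g | l g. l \<in> spread2 G H C D \<and> g \<in> D})"

definition tame :: "('a, 'b) monoid_scheme \<Rightarrow> 'a set \<Rightarrow> 'a set \<Rightarrow> 'a set \<Rightarrow> 'a set \<Rightarrow> bool"
  where "tame G K H C D \<longleftrightarrow>
    D \<inter> gamma2 G K \<subseteq> spread2 G H C D \<and> D \<inter> gamma3 G K \<subseteq> spread3 G H C D"

text \<open>The outcome of \<open>generic_extension\<close> expressed inside one ambient group, so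
  that towers of generic elements need no change of type. The retraction \<rho> projects
  \<open>\<gamma>\<^sub>i(K)\<close> into \<open>\<gamma>\<^sub>i(H)\<close>.\<close>

definition generic_in :: "('a, 'b) monoid_scheme \<Rightarrow> 'a set \<Rightarrow> 'a set \<Rightarrow> 'a \<Rightarrow> bool"
  where "generic_in G K H a \<longleftrightarrow> subgroup K G \<and> subgroup H G \<and> a \<in> carrier G \<and>
    K = generate G (H \<union> {a}) \<and> a \<notin> gamma2 G K \<and>
    (\<forall>m\<in>H. commutator G a m = \<one>\<^bsub>G\<^esub> \<longrightarrow> m \<in> gamma3 G H) \<and>
    (\<forall>m\<in>H. commutator G a m \<in> gamma3 G K \<longrightarrow> m \<in> gamma2 G H) \<and>
    (\<exists>\<rho>. \<rho> \<in> hom (G\<lparr>carrier := K\<rparr>) (G\<lparr>carrier := H\<rparr>) \<and> (\<forall>m\<in>H. \<rho> m = m) \<and> \<rho> a = \<one>\<^bsub>G\<^esub>)"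

lemma (in group) commutator_subgroup_consistent:
  assumes K: "subgroup K G" and "A \<subseteq> K" "B \<subseteq> K"
  shows "commutator_subgroup (G\<lparr>carrier := K\<rparr>) A B = commutator_subgroup G A B"
proof -
  have c: "commutator (G\<lparr>carrier := K\<rparr>) a b = commutator G a b" if "a \<in> K" "b \<in> K" for a b
    using m_inv_consistent[OF K] that by (simp add: commutator_def)
  have e: "{commutator (G\<lparr>carrier := K\<rparr>) a b |a b. a \<in> A \<and> b \<in> B} = {commutator G a b |a b. a \<in> A \<and> b \<in> B}"
    using c assms(2,3) by (metis (no_types, lifting) subsetD)
  have "{commutator G a b |a b. a \<in> A \<and> b \<in> B} \<subseteq> K"
    using assms subgroup.m_closed[OF K] subgroup.m_inv_closed[OF K] by (auto simp: commutator_def subset_iff)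
  then show ?thesis unfolding commutator_subgroup_def e using generate_consistent K by blast
qed

lemma (in exponent3_group) gamma_consistent:
  assumes K: "subgroup K G" and S: "subgroup S G" "S \<subseteq> K"
  shows "gamma2 (G\<lparr>carrier := K\<rparr>) S = gamma2 G S" "gamma3 (G\<lparr>carrier := K\<rparr>) S = gamma3 G S"
  unfolding gamma3_def
  using commutator_subgroup_consistent[OF K, of _ S] S gamma2_sub[OF S(1)]
  by (auto simp: gamma2_def)

context exponent3_group
begin

lemma generic_inD:
  assumes "generic_in G K H a"
  shows "subgroup K G" "subgroup H G" "a \<in> carrier G" "K = generate G (H \<union> {a})" "a \<notin> gamma2 G K"
    "m \<in> H \<Longrightarrow> cm a m = \<one> \<Longrightarrow> m \<in> gamma3 G H"
    "m \<in> H \<Longrightarrow> cm a m \<in> gamma3 G K \<Longrightarrow> m \<in> gamma2 G H"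
    "H \<subseteq> K" "a \<in> K"
  using assms generate.incl[of _ "H \<union> {a}" G] unfolding generic_in_def by blast+

lemma generic_retraction:
  assumes "generic_in G K H a"
  obtains \<rho> where "\<And>x. x \<in> K \<Longrightarrow> \<rho> x \<in> H" "\<And>x y. x \<in> K \<Longrightarrow> y \<in> K \<Longrightarrow> \<rho> (x \<otimes> y) = \<rho> x \<otimes> \<rho> y"
    "\<And>x y. x \<in> K \<Longrightarrow> y \<in> K \<Longrightarrow> \<rho> (cm x y) = cm (\<rho> x) (\<rho> y)"
    "\<And>x. x \<in> K \<Longrightarrow> \<rho> (inv x) = inv (\<rho> x)" "\<rho> \<one> = \<one>"
    "\<And>m. m \<in> H \<Longrightarrow> \<rho> m = m" "\<rho> a = \<one>"
    "\<And>x. x \<in> gamma2 G K \<Longrightarrow> \<rho> x \<in> gamma2 G H" "\<And>x. x \<in> gamma3 G K \<Longrightarrow> \<rho> x \<in> gamma3 G H"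
proof -
  note g = generic_inD[OF assms]
  obtain \<rho> where \<rho>: "\<rho> \<in> hom (G\<lparr>carrier := K\<rparr>) (G\<lparr>carrier := H\<rparr>)" "\<And>m. m \<in> H \<Longrightarrow> \<rho> m = m" "\<rho> a = \<one>"
    using assms unfolding generic_in_def by blast
  interpret K: group "G\<lparr>carrier := K\<rparr>" using subgroup_imp_group[OF g(1)] .
  interpret H: group "G\<lparr>carrier := H\<rparr>" using subgroup_imp_group[OF g(2)] .
  interpret h: group_hom "G\<lparr>carrier := K\<rparr>" "G\<lparr>carrier := H\<rparr>" \<rho>
    using \<rho>(1) by unfold_locales
  have \<rho>H: "\<rho> ` K = H"
  proof
    show "\<rho> ` K \<subseteq> H" using h.hom_closed by auto
    show "H \<subseteq> \<rho> ` K" using \<rho>(2) g(8) by force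
  qed
  have inv: "\<rho> (inv x) = inv (\<rho> x)" if "x \<in> K" for x
    using h.hom_inv[of x] that h.hom_closed[of x] m_inv_consistent[OF g(1)] m_inv_consistent[OF g(2)] by simp
  have mult: "\<rho> (x \<otimes> y) = \<rho> x \<otimes> \<rho> y" if "x \<in> K" "y \<in> K" for x y using h.hom_mult[of x y] that by simp
  have g2: "\<rho> ` gamma2 G K = gamma2 G H" "\<rho> ` gamma3 G K = gamma3 G H"
    using h.gamma2_image[of K] h.gamma3_image[of K] gamma_consistent[OF g(1) g(1)] gamma_consistent[OF g(2) g(2)]
    by (simp_all add: \<rho>H)
  show thesis
  proof (rule that[of \<rho>])
    show "\<rho> (cm x y) = cm (\<rho> x) (\<rho> y)" if "x \<in> K" "y \<in> K" for x y
      using that inv mult subgroup.m_closed[OF g(1)] subgroup.m_inv_closed[OF g(1)]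
      by (simp add: commutator_def)
  qed (use \<rho> h.hom_closed mult inv g2 h.hom_one in auto)
qed

text \<open>The retraction sends d = p [a, l] c to c, so c inherits membership in
  \<open>\<gamma>\<^sub>i\<close>. Dividing by [a, l] c leaves p in
  \<open>\<gamma>\<^sub>2(K)\<close>, hence p = 1 since a is outside. In the case of
  \<open>\<gamma>\<^sub>3\<close>, dividing by c leaves [a, l] in
  \<open>\<gamma>\<^sub>3(K)\<close>, and genericity applies to l.\<close>

lemma generic_normal_form:
  assumes g: "generic_in G K H a" and C: "subgroup C G" "C \<subseteq> H" and d: "d \<in> generate G (C \<union> {a})"
  shows "\<exists>p\<in>{\<one>, a, a \<otimes> a}. \<exists>l\<in>C. \<exists>c\<in>C. d = p \<otimes> cm a l \<otimes> c \<and>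
    (d \<in> gamma2 G K \<longrightarrow> p = \<one> \<and> c \<in> gamma2 G H) \<and>
    (d \<in> gamma3 G K \<longrightarrow> c \<in> gamma3 G H \<and> l \<in> gamma2 G H)"
proof -
  note D = generic_inD[OF g]
  obtain p l c where pc: "p \<in> {\<one>, a, a \<otimes> a}" "l \<in> C" "c \<in> C" and deq: "d = p \<otimes> cm a l \<otimes> c"
    using normal_form[OF C(1) D(3) d] by blast
  obtain \<rho> where \<rho>: "\<And>x. x \<in> K \<Longrightarrow> \<rho> x \<in> H" "\<And>x y. x \<in> K \<Longrightarrow> y \<in> K \<Longrightarrow> \<rho> (x \<otimes> y) = \<rho> x \<otimes> \<rho> y"
    "\<And>x y. x \<in> K \<Longrightarrow> y \<in> K \<Longrightarrow> \<rho> (cm x y) = cm (\<rho> x) (\<rho> y)"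
    "\<rho> \<one> = \<one>" "\<And>m. m \<in> H \<Longrightarrow> \<rho> m = m" "\<rho> a = \<one>"
    "\<And>x. x \<in> gamma2 G K \<Longrightarrow> \<rho> x \<in> gamma2 G H" "\<And>x. x \<in> gamma3 G K \<Longrightarrow> \<rho> x \<in> gamma3 G H"
    by (rule generic_retraction[OF g]) blast
  note Kc = subgroup.mem_carrier[OF D(1)] and Km = subgroup.m_closed[OF D(1)]
  have g2: "subgroup (gamma2 G K) G" using gamma2_subgroup subgroup.subset[OF D(1)] by blast
  have g3: "subgroup (gamma3 G K) G" using gamma3_subgroup subgroup.subset[OF D(1)] by blast
  have lc: "l \<in> H" "c \<in> H" "l \<in> K" "c \<in> K" using pc C(2) D(8) by auto
  have w: "cm a l \<in> gamma2 G K" using cm_gamma2 D(9) lc by blast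
  have wK: "cm a l \<in> K" using w gamma2_sub[OF D(1)] by blast
  have p: "p \<in> K" using pc(1) D(9) Km subgroup.one_closed[OF D(1)] by auto
  have \<rho>p: "\<rho> p = \<one>" using pc(1) \<rho> D(9) by auto
  have \<rho>w: "\<rho> (cm a l) = \<one>" using \<rho>(3)[OF D(9) lc(3)] \<rho>(5,6) lc cm_one(2)[OF Kc[OF lc(3)]] by simp
  have \<rho>d: "\<rho> d = c" using \<rho> \<rho>p \<rho>w p wK lc Km Kc by (simp add: deq)
  have pp: "p = \<one>" if "p \<in> gamma2 G K"
  proof -
    have "a \<otimes> a \<in> gamma2 G K \<Longrightarrow> a \<in> gamma2 G K"
      using inv_square[OF D(3)] D(3) subgroup.m_inv_closed[OF g2] by fastforce
    then show ?thesis using that pc(1) D(5) by auto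
  qed
  have 2: "p = \<one> \<and> c \<in> gamma2 G H" if d: "d \<in> gamma2 G K"
  proof
    show c: "c \<in> gamma2 G H" using \<rho>(7)[OF d] \<rho>d by simp
    then have c': "c \<in> gamma2 G K" using gamma2_mono[OF D(8)] by blast
    have "p = d \<otimes> inv c \<otimes> inv (cm a l)"
      using p wK lc Kc by (simp add: deq m_assoc)
    then have "p \<in> gamma2 G K" using d c' w subgroup.m_closed[OF g2] subgroup.m_inv_closed[OF g2] by simp
    then show "p = \<one>" by (rule pp)
  qed
  have 3: "c \<in> gamma3 G H \<and> l \<in> gamma2 G H" if d: "d \<in> gamma3 G K"
  proof
    show c: "c \<in> gamma3 G H" using \<rho>(8)[OF d] \<rho>d by simp
    then have c': "c \<in> gamma3 G K" using gamma3_mono[OF D(8)] by blast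
    have "p = \<one>" using 2 d gamma3_sub_gamma2[OF D(1)] by blast
    then have "cm a l = d \<otimes> inv c" using p wK lc Kc by (simp add: deq m_assoc)
    then have "cm a l \<in> gamma3 G K" using d c' subgroup.m_closed[OF g3] subgroup.m_inv_closed[OF g3] by simp
    then show "l \<in> gamma2 G H" using D(7) lc by blast
  qed
  show ?thesis using pc deq 2 3 by blast
qed

lemma spread2_carrier: "C \<subseteq> carrier G \<Longrightarrow> D \<subseteq> carrier G \<Longrightarrow> subgroup (spread2 G H C D) G"
  unfolding spread2_def
  by (rule generate_is_subgroup) (use gamma2_subgroup subgroup.subset in blast)

lemma spread3_carrier: "C \<subseteq> carrier G \<Longrightarrow> D \<subseteq> carrier G \<Longrightarrow> subgroup (spread3 G H C D) G"
  unfolding spread3_def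
  using subgroup.mem_carrier[OF spread2_carrier] by (intro generate_is_subgroup) blast

text \<open>In the normal form c comes from C \<inter> \<open>\<gamma>\<^sub>i(H)\<close> and [a, l]
  is a commutator of the new group. In the \<open>\<gamma>\<^sub>3\<close> case l lies in C \<inter>
  \<open>\<gamma>\<^sub>2(H)\<close>, so [l, a] is one of the generators of
  \<open>spread3\<close>.\<close>

lemma generic_tame:
  assumes g: "generic_in G K H a" and C: "subgroup C G" "C \<subseteq> H"
  shows "tame G K H C (generate G (C \<union> {a}))"
proof -
  note D = generic_inD[OF g]
  let ?D = "generate G (C \<union> {a})"
  have Cc: "C \<subseteq> carrier G" using subgroup.subset[OF C(1)] .
  have dc: "C \<union> {a} \<subseteq> carrier G" using Cc D(3) by blast
  have Dc: "?D \<subseteq> carrier G" using generate_incl[OF dc] .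
  have CD: "C \<subseteq> ?D" "a \<in> ?D" by (auto intro: generate.incl)
  have s2: "subgroup (spread2 G H C ?D) G" and s3: "subgroup (spread3 G H C ?D) G"
    using spread2_carrier spread3_carrier Cc Dc by blast+
  have in2: "C \<inter> gamma2 G H \<subseteq> spread2 G H C ?D" "gamma2 G ?D \<subseteq> spread2 G H C ?D"
    unfolding spread2_def by (auto intro: generate.incl)
  have in3: "C \<inter> gamma3 G H \<subseteq> spread3 G H C ?D"
    "\<And>l g. l \<in> spread2 G H C ?D \<Longrightarrow> g \<in> ?D \<Longrightarrow> cm l g \<in> spread3 G H C ?D"
    unfolding spread3_def by (blast intro: generate.incl)+
  show ?thesis unfolding tame_def
  proof (intro conjI subsetI)
    fix d assume d: "d \<in> ?D \<inter> gamma2 G K"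
    obtain p l c where e: "l \<in> C" "c \<in> C" "d = p \<otimes> cm a l \<otimes> c" "p = \<one>" "c \<in> gamma2 G H"
      using generic_normal_form[OF g C, of d] d by auto
    have "cm a l \<in> spread2 G H C ?D" using in2(2) cm_gamma2 CD e(1) by blast
    moreover have "c \<in> spread2 G H C ?D" using in2(1) e by blast
    moreover have "d = cm a l \<otimes> c" using e Cc D(3) by auto
    ultimately show "d \<in> spread2 G H C ?D" using subgroup.m_closed[OF s2] by simp
  next
    fix d assume d: "d \<in> ?D \<inter> gamma3 G K"
    then have d2: "d \<in> gamma2 G K" using gamma3_sub_gamma2[OF D(1)] by blast
    obtain p l c where e: "l \<in> C" "c \<in> C" "d = p \<otimes> cm a l \<otimes> c" "p = \<one>" "c \<in> gamma3 G H" "l \<in> gamma2 G H"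
      using generic_normal_form[OF g C, of d] d d2 by auto
    have lc: "l \<in> carrier G" "c \<in> carrier G" using e Cc by auto
    have "cm l a \<in> spread3 G H C ?D" using in3(2) in2(1) e CD by blast
    then have "inv (cm l a) \<in> spread3 G H C ?D" using subgroup.m_inv_closed[OF s3] by blast
    moreover have "c \<in> spread3 G H C ?D" using in3(1) e by blast
    moreover have "d = inv (cm l a) \<otimes> c" using e lc D(3) by (simp add: inv_cm)
    ultimately show "d \<in> spread3 G H C ?D" using subgroup.m_closed[OF s3] by simp
  qed
qed

text \<open>The lower step bounds the intersections of \<open>D\<close> with
  \<open>\<gamma>\<^sub>i(K)\<close>, which are exactly the data allowed by the upper step; so the
  two spreads compose.\<close>

lemma tame_trans:
  assumes t1: "tame G K H C D" and t2: "tame G L K D E" and sub: "C \<subseteq> D" "D \<subseteq> E" and E: "E \<subseteq> carrier G"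
  shows "tame G L H C E"
proof -
  have Cc: "C \<subseteq> carrier G" using sub E by (meson order_trans)
  have s2: "subgroup (spread2 G H C E) G" by (rule spread2_carrier[OF Cc E])
  have s3: "subgroup (spread3 G H C E) G" by (rule spread3_carrier[OF Cc E])
  have "spread2 G H C D \<subseteq> spread2 G H C E"
    unfolding spread2_def using gamma2_mono[OF sub(2)] by (intro mono_generate) blast
  moreover have "gamma2 G E \<subseteq> spread2 G H C E" unfolding spread2_def by (auto intro: generate.incl)
  ultimately have A: "spread2 G K D E \<subseteq> spread2 G H C E"
    using t1 unfolding spread2_def[of G K] tame_def by (intro generate_subgroup_incl[OF _ s2]) blast
  have "spread3 G H C D \<subseteq> spread3 G H C E"
    unfolding spread3_def using \<open>spread2 G H C D \<subseteq> spread2 G H C E\<close> sub(2) by (intro mono_generate) blast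
  moreover have "cm l g \<in> spread3 G H C E" if "l \<in> spread2 G K D E" "g \<in> E" for l g
    unfolding spread3_def using that A by (intro generate.incl) blast
  ultimately have B: "spread3 G K D E \<subseteq> spread3 G H C E"
    using t1 unfolding spread3_def[of G K] tame_def by (intro generate_subgroup_incl[OF _ s3]) blast
  show ?thesis using A B t2 unfolding tame_def by blast
qed

end

section \<open>Transfer to existentially closed groups\<close>

lemma model_T3_iff: "model_T3 G \<longleftrightarrow> exponent3_group G"
proof
  assume m: "model_T3 G"
  then interpret group G by (simp add: model_T3_def)
  show "exponent3_group G"
  proof
    fix x assume "x \<in> carrier G"
    moreover from this have "x [^]\<^bsub>G\<^esub> (3::nat) = \<one>\<^bsub>G\<^esub>" using m by (simp add: model_T3_def)
    ultimately show "x \<otimes>\<^bsub>G\<^esub> x \<otimes>\<^bsub>G\<^esub> x = \<one>\<^bsub>G\<^esub>" by (simp add: numeral_3_eq_3)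
  qed
next
  assume "exponent3_group G"
  then interpret exponent3_group G .
  show "model_T3 G" unfolding model_T3_def using cube by (auto simp: numeral_3_eq_3 intro: is_group)
qed

definition conj_all :: "'v qf_formula list \<Rightarrow> 'v qf_formula"
  where "conj_all ps = foldr Conj ps (Eq One One)"

lemma qf_sat_conj_all: "qf_sat G e (conj_all ps) \<longleftrightarrow> (\<forall>p\<in>set ps. qf_sat G e p)"
  by (induction ps) (auto simp: conj_all_def)

lemma qf_vars_conj_all: "qf_vars (conj_all ps) = (\<Union>p\<in>set ps. qf_vars p)"
  by (induction ps) (auto simp: conj_all_def)

text \<open>The formula is the diagram of \<open>E\<close> over \<open>C\<close>: the products, the
  inequalities between distinct elements, and equations that identify each h c with its parameter. A
  solution in \<open>M\<close> is the required embedding.\<close>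

lemma existentially_closed_embedding:
  fixes M :: "('a, 'b) monoid_scheme" and N :: "('c, 'd) monoid_scheme"
  assumes ec: "existentially_closed_T3 M" and N: "exponent3_group N"
    and h: "h \<in> hom M N" "inj_on h (carrier M)"
    and C: "C \<subseteq> carrier M" "finite C" and E: "subgroup E N" "finite E" "h ` C \<subseteq> E"
  obtains f where "f \<in> hom (N\<lparr>carrier := E\<rparr>) M" "inj_on f E" "\<And>c. c \<in> C \<Longrightarrow> f (h c) = c"
proof -
  obtain es where es: "set es = E" "distinct es" using finite_distinct_list[OF E(2)] by blast
  obtain cs where cs: "set cs = C" using finite_list[OF C(2)] by blast
  define k where "k = length es"
  let ?I = "[0..<k]"
  let ?v = "\<lambda>i. Var (Inl i) :: (nat + nat) grp_term"
  let ?w = "\<lambda>j. Var (Inr j) :: (nat + nat) grp_term"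
  define ps1 where "ps1 = [Eq (Mult (?v i) (?v j)) (?v l). i \<leftarrow> ?I, j \<leftarrow> ?I, l \<leftarrow> ?I, es ! i \<otimes>\<^bsub>N\<^esub> es ! j = es ! l]"
  define ps2 where "ps2 = [Neg (Eq (?v i) (?v j)). i \<leftarrow> ?I, j \<leftarrow> ?I, i \<noteq> j]"
  define ps3 where "ps3 = [Eq (?v i) (?w j). i \<leftarrow> ?I, j \<leftarrow> [0..<length cs], es ! i = h (cs ! j)]"
  define \<phi> where "\<phi> = conj_all (ps1 @ ps2 @ ps3)"
  have vars: "qf_vars \<phi> \<subseteq> Inl ` {..<k} \<union> Inr ` {..<length cs}"
    by (auto simp: \<phi>_def qf_vars_conj_all ps1_def ps2_def ps3_def split: if_splits)
  have "ex_sat N k \<phi> (map h cs)"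
    unfolding ex_sat_def
  proof (intro exI conjI)
    show "length es = k" by (simp add: k_def)
    show "set es \<subseteq> carrier N" using es subgroup.subset[OF E(1)] by simp
    show "qf_sat N (tuple_env es (map h cs)) \<phi>"
      using es(2) by (auto simp: \<phi>_def qf_sat_conj_all ps1_def ps2_def ps3_def tuple_env_def k_def
          nth_eq_iff_index_eq split: if_splits)
  qed
  then have "ex_sat M k \<phi> cs"
    using existentially_closed_T3_extension[OF ec _ h _ vars] N C cs by (simp add: model_T3_iff)
  then obtain xs where xs: "length xs = k" "set xs \<subseteq> carrier M" "qf_sat M (tuple_env xs cs) \<phi>"
    by (auto simp: ex_sat_def)
  have s1: "xs ! i \<otimes>\<^bsub>M\<^esub> xs ! j = xs ! l" if "i < k" "j < k" "l < k" "es ! i \<otimes>\<^bsub>N\<^esub> es ! j = es ! l" for i j l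
  proof -
    have "Eq (Mult (?v i) (?v j)) (?v l) \<in> set ps1" using that by (auto simp: ps1_def)
    then have "qf_sat M (tuple_env xs cs) (Eq (Mult (?v i) (?v j)) (?v l))"
      using xs(3) unfolding \<phi>_def qf_sat_conj_all set_append by blast
    then show ?thesis by (simp add: tuple_env_def)
  qed
  have s2: "xs ! i \<noteq> xs ! j" if "i < k" "j < k" "i \<noteq> j" for i j
  proof -
    have "Neg (Eq (?v i) (?v j)) \<in> set ps2" using that by (auto simp: ps2_def)
    then have "qf_sat M (tuple_env xs cs) (Neg (Eq (?v i) (?v j)))"
      using xs(3) unfolding \<phi>_def qf_sat_conj_all set_append by blast
    then show ?thesis by (simp add: tuple_env_def)
  qed
  have s3: "xs ! i = cs ! j" if "i < k" "j < length cs" "es ! i = h (cs ! j)" for i j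
  proof -
    have "Eq (?v i) (?w j) \<in> set ps3" using that by (auto simp: ps3_def)
    then have "qf_sat M (tuple_env xs cs) (Eq (?v i) (?w j))"
      using xs(3) unfolding \<phi>_def qf_sat_conj_all set_append by blast
    then show ?thesis by (simp add: tuple_env_def)
  qed
  define ix where "ix e = (SOME i. i < k \<and> es ! i = e)" for e
  have ix: "ix e < k" "es ! ix e = e" if "e \<in> E" for e
  proof -
    have "\<exists>i. i < k \<and> es ! i = e" using that es(1) by (auto simp: k_def in_set_conv_nth)
    then have "ix e < k \<and> es ! ix e = e" unfolding ix_def by (rule someI_ex)
    then show "ix e < k" "es ! ix e = e" by auto
  qed
  show thesis
  proof (rule that[of "\<lambda>e. xs ! ix e"])
    show "(\<lambda>e. xs ! ix e) \<in> hom (N\<lparr>carrier := E\<rparr>) M"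
    proof (rule homI)
      fix x assume "x \<in> carrier (N\<lparr>carrier := E\<rparr>)"
      then show "xs ! ix x \<in> carrier M" using xs(1,2) ix nth_mem by fastforce
    next
      fix x y assume "x \<in> carrier (N\<lparr>carrier := E\<rparr>)" "y \<in> carrier (N\<lparr>carrier := E\<rparr>)"
      then have "x \<in> E" "y \<in> E" "x \<otimes>\<^bsub>N\<^esub> y \<in> E" using subgroup.m_closed[OF E(1)] by auto
      then show "xs ! ix (x \<otimes>\<^bsub>N\<lparr>carrier := E\<rparr>\<^esub> y) = xs ! ix x \<otimes>\<^bsub>M\<^esub> xs ! ix y"
        using s1[of "ix x" "ix y" "ix (x \<otimes>\<^bsub>N\<^esub> y)"] ix by simp
    qed
    show "inj_on (\<lambda>e. xs ! ix e) E"
    proof (rule inj_onI)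
      fix x y assume "x \<in> E" "y \<in> E" "xs ! ix x = xs ! ix y"
      then show "x = y" using s2[of "ix x" "ix y"] ix by metis
    qed
    show "xs ! ix (h c) = c" if c: "c \<in> C" for c
    proof -
      obtain j where "j < length cs" "cs ! j = c" using c cs by (auto simp: in_set_conv_nth)
      moreover have "h c \<in> E" using c E(3) by blast
      ultimately show ?thesis using s3[of "ix (h c)" j] ix by metis
    qed
  qed
qed

section \<open>Transport along embeddings, and towers of generic elements\<close>

locale exponent3_embedding = A: exponent3_group A + B: exponent3_group B
  for A :: "('a, 'c) monoid_scheme" and B :: "('b, 'd) monoid_scheme" +
  fixes f
  assumes f_hom: "f \<in> hom A B" and f_inj: "inj_on f (carrier A)"
begin

sublocale f: group_hom A B f
  using f_hom by unfold_locales

lemma f_cm: "x \<in> carrier A \<Longrightarrow> y \<in> carrier A \<Longrightarrow> f (commutator A x y) = commutator B (f x) (f y)"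
  by (rule f.hom_commutator)

lemma f_mem: "S \<subseteq> carrier A \<Longrightarrow> x \<in> carrier A \<Longrightarrow> f x \<in> f ` S \<longleftrightarrow> x \<in> S"
  using f_inj by (auto dest: inj_onD)

lemma image_Int: "S \<subseteq> carrier A \<Longrightarrow> T \<subseteq> carrier A \<Longrightarrow> f ` (S \<inter> T) = f ` S \<inter> f ` T"
  using f_inj by (rule inj_on_image_Int)

lemma gamma2_carrier: "S \<subseteq> carrier A \<Longrightarrow> gamma2 A S \<subseteq> carrier A"
  using A.gamma2_subgroup subgroup.subset by blast

lemma gamma3_carrier: "S \<subseteq> carrier A \<Longrightarrow> gamma3 A S \<subseteq> carrier A"
  using A.gamma3_subgroup subgroup.subset by blast

lemma f_gamma2_mem: "S \<subseteq> carrier A \<Longrightarrow> x \<in> carrier A \<Longrightarrow> f x \<in> gamma2 B (f ` S) \<longleftrightarrow> x \<in> gamma2 A S"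
  using f.gamma2_image f_mem gamma2_carrier by metis

lemma f_gamma3_mem: "S \<subseteq> carrier A \<Longrightarrow> x \<in> carrier A \<Longrightarrow> f x \<in> gamma3 B (f ` S) \<longleftrightarrow> x \<in> gamma3 A S"
  using f.gamma3_image f_mem gamma3_carrier by metis

lemma generic_image:
  assumes g: "generic_in A K H a"
  shows "generic_in B (f ` K) (f ` H) (f a)"
proof -
  note D = A.generic_inD[OF g]
  have Kc: "K \<subseteq> carrier A" and Hc: "H \<subseteq> carrier A" using D subgroup.subset by blast+
  obtain \<rho> where \<rho>: "\<rho> \<in> hom (A\<lparr>carrier := K\<rparr>) (A\<lparr>carrier := H\<rparr>)" "\<And>m. m \<in> H \<Longrightarrow> \<rho> m = m" "\<rho> a = \<one>\<^bsub>A\<^esub>"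
    using g unfolding generic_in_def by blast
  define \<sigma> where "\<sigma> y = f (\<rho> (the_inv_into (carrier A) f y))" for y
  have \<sigma>: "\<sigma> (f x) = f (\<rho> x)" if "x \<in> carrier A" for x
    using that by (simp add: \<sigma>_def the_inv_into_f_f[OF f_inj])
  have \<rho>H: "\<rho> x \<in> H" if "x \<in> K" for x using \<rho>(1) that by (auto simp: hom_def)
  show ?thesis unfolding generic_in_def
  proof (intro conjI ballI impI exI[of _ \<sigma>])
    show "subgroup (f ` K) B" "subgroup (f ` H) B" using f.subgroup_img_is_subgroup D by blast+
    show "f a \<in> carrier B" using D by simp
    show "f ` K = generate B (f ` H \<union> {f a})"
      using f.generate_img[of "H \<union> {a}"] Hc D by simp
    show "f a \<notin> gamma2 B (f ` K)" using f_gamma2_mem[OF Kc] D by blast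
    show "m \<in> gamma3 B (f ` H)" if "m \<in> f ` H" "commutator B (f a) m = \<one>\<^bsub>B\<^esub>" for m
    proof -
      obtain x where x: "x \<in> H" "m = f x" using \<open>m \<in> f ` H\<close> by blast
      then have "f (commutator A a x) = f \<one>\<^bsub>A\<^esub>" using that f_cm D Hc by auto
      then have "commutator A a x = \<one>\<^bsub>A\<^esub>" using f_inj D x Hc by (meson A.cm_closed A.one_closed inj_onD subsetD)
      then show ?thesis using D(6) x f_gamma3_mem[OF Hc] Hc by blast
    qed
    show "m \<in> gamma2 B (f ` H)" if "m \<in> f ` H" "commutator B (f a) m \<in> gamma3 B (f ` K)" for m
    proof -
      obtain x where x: "x \<in> H" "m = f x" using \<open>m \<in> f ` H\<close> by blast
      then have "f (commutator A a x) \<in> gamma3 B (f ` K)" using that f_cm D Hc by (metis subsetD)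
      then have "commutator A a x \<in> gamma3 A K" using f_gamma3_mem[OF Kc] D x Hc by blast
      then show ?thesis using D(7) x f_gamma2_mem[OF Hc] Hc by blast
    qed
    show "\<sigma> \<in> hom (B\<lparr>carrier := f ` K\<rparr>) (B\<lparr>carrier := f ` H\<rparr>)"
    proof (rule homI)
      fix x assume "x \<in> carrier (B\<lparr>carrier := f ` K\<rparr>)"
      then show "\<sigma> x \<in> carrier (B\<lparr>carrier := f ` H\<rparr>)" using \<sigma> \<rho>H Kc by auto
    next
      fix x y assume "x \<in> carrier (B\<lparr>carrier := f ` K\<rparr>)" "y \<in> carrier (B\<lparr>carrier := f ` K\<rparr>)"
      then obtain u v where uv: "u \<in> K" "v \<in> K" "x = f u" "y = f v" by auto
      have c: "u \<in> carrier A" "v \<in> carrier A" "\<rho> u \<in> carrier A" "\<rho> v \<in> carrier A" using uv Kc Hc \<rho>H by auto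
      have "\<rho> (u \<otimes>\<^bsub>A\<^esub> v) = \<rho> u \<otimes>\<^bsub>A\<^esub> \<rho> v" using hom_mult[OF \<rho>(1), of u v] uv by simp
      moreover have "x \<otimes>\<^bsub>B\<^esub> y = f (u \<otimes>\<^bsub>A\<^esub> v)" using uv c by simp
      then have "\<sigma> (x \<otimes>\<^bsub>B\<^esub> y) = f (\<rho> (u \<otimes>\<^bsub>A\<^esub> v))" using \<sigma>[of "u \<otimes>\<^bsub>A\<^esub> v"] c by simp
      ultimately have "\<sigma> (x \<otimes>\<^bsub>B\<^esub> y) = \<sigma> x \<otimes>\<^bsub>B\<^esub> \<sigma> y" using uv c by (simp add: \<sigma>)
      then show "\<sigma> (x \<otimes>\<^bsub>B\<lparr>carrier := f ` K\<rparr>\<^esub> y) = \<sigma> x \<otimes>\<^bsub>B\<lparr>carrier := f ` H\<rparr>\<^esub> \<sigma> y" by simp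
    qed
    show "\<sigma> m = m" if "m \<in> f ` H" for m using that \<sigma> \<rho>(2) Hc by auto
    show "\<sigma> (f a) = \<one>\<^bsub>B\<^esub>" using \<sigma> \<rho>(3) D by simp
  qed
qed

end

lemma generic_exists:
  assumes "exponent3_group (M :: ('a, 'b) monoid_scheme)"
  obtains N :: "'a generic monoid" and h a
  where "exponent3_embedding M N h" "generic_in N (carrier N) (h ` carrier M) a"
proof -
  obtain N :: "'a generic monoid" and h a \<rho>
    where N: "exponent3_group N" and h: "h \<in> hom M N" and a: "a \<in> carrier N" and \<rho>: "\<rho> \<in> hom N M"
      "\<And>m. m \<in> carrier M \<Longrightarrow> \<rho> (h m) = m" "\<rho> a = \<one>\<^bsub>M\<^esub>"
      and gen: "carrier N = generate N (h ` carrier M \<union> {a})" and F3: "a \<notin> gamma2 N (carrier N)"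
      and F1: "\<And>m. m \<in> carrier M \<Longrightarrow> commutator N a (h m) = \<one>\<^bsub>N\<^esub> \<Longrightarrow> m \<in> gamma3 M (carrier M)"
      and F2: "\<And>m. m \<in> carrier M \<Longrightarrow> commutator N a (h m) \<in> gamma3 N (carrier N) \<Longrightarrow> m \<in> gamma2 M (carrier M)"
    by (rule generic_extension[OF assms]) (rule that; assumption)
  have inj: "inj_on h (carrier M)" using \<rho>(2) by (metis inj_onI)
  interpret exponent3_embedding M N h
    using assms N h inj by (simp add: exponent3_embedding_def exponent3_embedding_axioms_def)
  show thesis
  proof (rule that)
    show "exponent3_embedding M N h" ..
    show "generic_in N (carrier N) (h ` carrier M) a"
      unfolding generic_in_def
    proof (intro conjI ballI impI exI[of _ "h \<circ> \<rho>"])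
      show "subgroup (carrier N) N" by (rule B.subgroup_self)
      show "subgroup (h ` carrier M) N" by (rule f.subgroup_img_is_subgroup[OF A.subgroup_self])
      show "m \<in> gamma3 N (h ` carrier M)" if "m \<in> h ` carrier M" "commutator N a m = \<one>\<^bsub>N\<^esub>" for m
        using that F1 f_gamma3_mem[OF subset_refl] by blast
      show "m \<in> gamma2 N (h ` carrier M)" if "m \<in> h ` carrier M" "commutator N a m \<in> gamma3 N (carrier N)" for m
        using that F2 f_gamma2_mem[OF subset_refl] by blast
      show "h \<circ> \<rho> \<in> hom (N\<lparr>carrier := carrier N\<rparr>) (N\<lparr>carrier := h ` carrier M\<rparr>)"
      proof (rule homI)
        fix x assume "x \<in> carrier (N\<lparr>carrier := carrier N\<rparr>)"
        then show "(h \<circ> \<rho>) x \<in> carrier (N\<lparr>carrier := h ` carrier M\<rparr>)" using \<rho>(1) by (auto simp: hom_def)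
      next
        fix x y assume "x \<in> carrier (N\<lparr>carrier := carrier N\<rparr>)" "y \<in> carrier (N\<lparr>carrier := carrier N\<rparr>)"
        then have "x \<in> carrier N" "y \<in> carrier N" "\<rho> x \<in> carrier M" "\<rho> y \<in> carrier M" "\<rho> (x \<otimes>\<^bsub>N\<^esub> y) = \<rho> x \<otimes>\<^bsub>M\<^esub> \<rho> y"
          using \<rho>(1) by (auto simp: hom_def)
        then show "(h \<circ> \<rho>) (x \<otimes>\<^bsub>N\<lparr>carrier := carrier N\<rparr>\<^esub> y) = (h \<circ> \<rho>) x \<otimes>\<^bsub>N\<lparr>carrier := h ` carrier M\<rparr>\<^esub> (h \<circ> \<rho>) y"
          by simp
      qed
      show "(h \<circ> \<rho>) m = m" if "m \<in> h ` carrier M" for m using that \<rho>(2) by auto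
      show "(h \<circ> \<rho>) a = \<one>\<^bsub>N\<^esub>" using \<rho>(3) by simp
    qed fact+
  qed
qed

lemma (in exponent3_group) commutator_consistent:
  assumes "subgroup K G" "a \<in> K" "b \<in> K"
  shows "commutator (G\<lparr>carrier := K\<rparr>) a b = cm a b"
  using m_inv_consistent[OF assms(1)] assms by (simp add: commutator_def)

lemma (in exponent3_group) subgroup_exponent3:
  assumes "subgroup K G"
  shows "exponent3_group (G\<lparr>carrier := K\<rparr>)"
proof -
  interpret K: group "G\<lparr>carrier := K\<rparr>" using subgroup_imp_group[OF assms] .
  show ?thesis by unfold_locales (use cube subgroup.mem_carrier[OF assms] in simp)
qed

lemma exponent3_embedding_comp:
  assumes "exponent3_embedding A B f" "exponent3_embedding B C g"
  shows "exponent3_embedding A C (g \<circ> f)"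
proof -
  interpret f: exponent3_embedding A B f by fact
  interpret g: exponent3_embedding B C g by fact
  show ?thesis
  proof
    show "g \<circ> f \<in> hom A C" using f.f_hom g.f_hom by (auto simp: hom_def)
    show "inj_on (g \<circ> f) (carrier A)"
      using f.f_inj g.f_inj f.f.hom_closed by (intro comp_inj_on) (auto intro: inj_on_subset)
  qed
qed

text \<open>The second extension is made over the whole first one, and \<open>generic_image\<close>
  carries the genericity of x along.\<close>

lemma generic_exists2:
  assumes "exponent3_group (M :: ('a, 'b) monoid_scheme)"
  obtains N :: "'a generic generic monoid" and h K x y
  where "exponent3_embedding M N h" "generic_in N K (h ` carrier M) x" "generic_in N (carrier N) K y"
proof -
  obtain L :: "'a generic monoid" and f x
    where f: "exponent3_embedding M L f" and x: "generic_in L (carrier L) (f ` carrier M) x"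
    using generic_exists[OF assms] by blast
  then have "exponent3_group L" by (simp add: exponent3_embedding_def)
  then obtain N :: "'a generic generic monoid" and g y
    where g: "exponent3_embedding L N g" and y: "generic_in N (carrier N) (g ` carrier L) y"
    using generic_exists by blast
  show thesis
    using that[OF exponent3_embedding_comp[OF f g] _ y] exponent3_embedding.generic_image[OF g x]
    by (simp add: image_comp)
qed

lemma generic_exists3:
  assumes "exponent3_group (M :: ('a, 'b) monoid_scheme)"
  obtains N :: "'a generic generic generic monoid" and h K L x y t
  where "exponent3_embedding M N h" "generic_in N K (h ` carrier M) x" "generic_in N L K y"
    "generic_in N (carrier N) L t"
proof -
  obtain E :: "'a generic generic monoid" and f K x y
    where f: "exponent3_embedding M E f" and x: "generic_in E K (f ` carrier M) x"
      and y: "generic_in E (carrier E) K y"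
    using generic_exists2[OF assms] by blast
  then have "exponent3_group E" by (simp add: exponent3_embedding_def)
  then obtain N :: "'a generic generic generic monoid" and g t
    where g: "exponent3_embedding E N g" and t: "generic_in N (carrier N) (g ` carrier E) t"
    using generic_exists by blast
  show thesis
    using that[OF exponent3_embedding_comp[OF f g] _ _ t] exponent3_embedding.generic_image[OF g x]
      exponent3_embedding.generic_image[OF g y]
    by (simp add: image_comp)
qed

text \<open>Embedding \<open>D\<close> alone would not control which elements land in
  \<open>\<gamma>\<^sub>i(M)\<close>. So two generic elements a and t are adjoined above
  \<open>N\<close>, the larger finite group \<open>E\<close> is embedded, and the images of a and t
  expose any element that falls into \<open>\<gamma>\<^sub>i(M)\<close> without belonging to
  \<open>\<gamma>\<^sub>i(N)\<close>.\<close>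

lemma transfer_to_existentially_closed:
  fixes M :: "('a, 'b) monoid_scheme" and N :: "('c, 'd) monoid_scheme"
  assumes ec: "existentially_closed_T3 M" and h: "exponent3_embedding M N h"
    and C: "subgroup C M" "finite C" and D: "subgroup D N" "finite D" "h ` C \<subseteq> D"
    and tame: "tame N (carrier N) (h ` carrier M) (h ` C) D"
  obtains f where "exponent3_embedding (N\<lparr>carrier := D\<rparr>) M f" "\<And>c. c \<in> C \<Longrightarrow> f (h c) = c"
    "tame M (carrier M) (carrier M) C (f ` D)"
proof -
  interpret h: exponent3_embedding M N h by fact
  obtain N' :: "'c generic generic monoid" and g K a t
    where g: "exponent3_embedding N N' g" and a: "generic_in N' K (g ` carrier N) a"
      and t: "generic_in N' (carrier N') K t"
    by (rule generic_exists2[OF h.B.exponent3_group_axioms]) (rule that; assumption)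
  interpret g: exponent3_embedding N N' g by fact
  note Da = g.B.generic_inD[OF a] and Dt = g.B.generic_inD[OF t]
  have Dc: "D \<subseteq> carrier N" using subgroup.subset[OF D(1)] .
  have Cc: "C \<subseteq> carrier M" using subgroup.subset[OF C(1)] .
  have gD: "subgroup (g ` D) N'" using g.f.subgroup_img_is_subgroup[OF D(1)] .
  define D1 where "D1 = generate N' (g ` D \<union> {a})"
  define E where "E = generate N' (D1 \<union> {t})"
  have D1: "subgroup D1 N'" "finite D1"
    unfolding D1_def using subgroup.subset[OF gD] Da(3) g.B.finite_adjoin[OF gD _ Da(3)] D(2)
    by (auto intro!: g.B.generate_is_subgroup)
  have E: "subgroup E N'" "finite E"
    unfolding E_def using subgroup.subset[OF D1(1)] Dt(3) g.B.finite_adjoin[OF D1(1,2) Dt(3)]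
    by (auto intro!: g.B.generate_is_subgroup)
  have gDE: "g ` D \<subseteq> E" "a \<in> E" "t \<in> E" unfolding E_def D1_def by (auto intro: generate.incl)
  interpret gh: exponent3_embedding M N' "g \<circ> h" using exponent3_embedding_comp[OF h g] .
  obtain f0 where f0: "f0 \<in> hom (N'\<lparr>carrier := E\<rparr>) M" "inj_on f0 E" "\<And>c. c \<in> C \<Longrightarrow> f0 ((g \<circ> h) c) = c"
  proof (rule existentially_closed_embedding[OF ec g.B.exponent3_group_axioms gh.f_hom gh.f_inj Cc C(2) E])
    show "(g \<circ> h) ` C \<subseteq> E" using D(3) gDE(1) by auto
  qed (rule that; assumption)
  interpret F0: exponent3_embedding "N'\<lparr>carrier := E\<rparr>" M f0
    using f0 g.B.subgroup_exponent3[OF E(1)] h.A.exponent3_group_axioms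
    by (simp add: exponent3_embedding_def exponent3_embedding_axioms_def)
  have f0_cm: "f0 (commutator N' u v) = commutator M (f0 u) (f0 v)" if "u \<in> E" "v \<in> E" for u v
    using F0.f_cm[of u v] g.B.commutator_consistent[OF E(1)] that by simp
  have E_cm: "commutator N' u v \<in> E" if "u \<in> E" "v \<in> E" for u v
    using that subgroup.m_closed[OF E(1)] subgroup.m_inv_closed[OF E(1)] by (simp add: commutator_def)
  have f0_one: "u = \<one>\<^bsub>N'\<^esub>" if "u \<in> E" "f0 u = \<one>\<^bsub>M\<^esub>" for u
    using inj_onD[OF f0(2), of u "\<one>\<^bsub>N'\<^esub>"] F0.f.hom_one that subgroup.one_closed[OF E(1)] by simp
  define f where "f = f0 \<circ> g"
  interpret F: exponent3_embedding "N\<lparr>carrier := D\<rparr>" M f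
  proof -
    have "f \<in> hom (N\<lparr>carrier := D\<rparr>) M"
    proof (rule homI)
      fix x y assume "x \<in> carrier (N\<lparr>carrier := D\<rparr>)" "y \<in> carrier (N\<lparr>carrier := D\<rparr>)"
      then have "g x \<in> E" "g y \<in> E" "x \<in> carrier N" "y \<in> carrier N" using gDE(1) Dc by auto
      then show "f (x \<otimes>\<^bsub>N\<lparr>carrier := D\<rparr>\<^esub> y) = f x \<otimes>\<^bsub>M\<^esub> f y"
        using hom_mult[OF f0(1), of "g x" "g y"] by (simp add: f_def)
    qed (use gDE f0(1) in \<open>auto simp: f_def hom_def\<close>)
    moreover have "inj_on f D" unfolding f_def
      using g.f_inj f0(2) gDE Dc by (intro comp_inj_on) (auto intro: inj_on_subset)
    ultimately show "exponent3_embedding (N\<lparr>carrier := D\<rparr>) M f"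
      using h.B.subgroup_exponent3[OF D(1)] h.A.exponent3_group_axioms
      by (simp add: exponent3_embedding_def exponent3_embedding_axioms_def)
  qed
  have fh: "f (h c) = c" if "c \<in> C" for c using f0(3)[OF that] by (simp add: f_def)
  \<comment> \<open>\<open>\<gamma>\<^sub>3(M)\<close> is central, so f(d) commutes with the image
    of a. Injectivity pulls this back to [a, d] = 1 above \<open>N\<close>, where a is
    generic.\<close>
  have g3: "d \<in> gamma3 N (carrier N)" if d: "d \<in> D" "f d \<in> gamma3 M (carrier M)" for d
  proof -
    have gd: "g d \<in> E" "d \<in> carrier N" using d gDE Dc by auto
    have "f0 a \<in> carrier M" using F0.f.hom_closed gDE by simp
    then have "commutator M (f0 a) (f d) = \<one>\<^bsub>M\<^esub>"
      using h.A.cm_Z1(2) h.A.gamma3_Z1[OF subset_refl] d(2) by blast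
    then have "commutator N' a (g d) = \<one>\<^bsub>N'\<^esub>"
      using f0_one[OF E_cm] f0_cm gDE gd by (simp add: f_def)
    then have "g d \<in> gamma3 N' (g ` carrier N)" using Da(6)[of "g d"] gd by blast
    then show ?thesis using g.f_gamma3_mem[OF subset_refl gd(2)] by blast
  qed
  \<comment> \<open>\<open>\<gamma>\<^sub>2(M)\<close> lies in the second centre, hence [t, [a, d]]
    = 1. Genericity of t puts [a, d] into \<open>\<gamma>\<^sub>3(K)\<close>, and genericity of a
    then applies to d.\<close>
  have g2: "d \<in> gamma2 N (carrier N)" if d: "d \<in> D" "f d \<in> gamma2 M (carrier M)" for d
  proof -
    have gd: "g d \<in> E" "d \<in> carrier N" using d gDE Dc by auto
    have c: "f0 a \<in> carrier M" "f0 t \<in> carrier M" using F0.f.hom_closed gDE by simp_all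
    have "f d \<in> h.A.Z2" using h.A.gamma2_Z2[OF subset_refl] d(2) by blast
    then have "commutator M (f0 t) (commutator M (f0 a) (f d)) = \<one>\<^bsub>M\<^esub>"
      using h.A.Z2_D(2)[OF _ c(1)] h.A.cm_Z1(2)[OF _ c(2)] by blast
    then have 1: "commutator N' t (commutator N' a (g d)) = \<one>\<^bsub>N'\<^esub>"
      using f0_one[OF E_cm[OF _ E_cm]] f0_cm E_cm gDE gd by (simp add: f_def)
    have "g d \<in> K" using gd Da(8) by blast
    then have "commutator N' a (g d) \<in> K"
      using Da(9) g.B.cm_gamma2 g.B.gamma2_sub[OF Da(1)] by blast
    then have "commutator N' a (g d) \<in> gamma3 N' K" using Dt(6) 1 by blast
    then have "g d \<in> gamma2 N' (g ` carrier N)" using Da(7)[of "g d"] gd by blast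
    then show ?thesis using g.f_gamma2_mem[OF subset_refl gd(2)] by blast
  qed
  have hCc: "h ` C \<subseteq> carrier N" using Cc by auto
  have s2D: "spread2 N (h ` carrier M) (h ` C) D \<subseteq> D"
    unfolding spread2_def using h.B.gamma2_sub[OF D(1)] D(3)
    by (intro h.B.generate_subgroup_incl[OF _ D(1)]) blast
  have fs2: "f ` spread2 N (h ` carrier M) (h ` C) D \<subseteq> spread2 M (carrier M) C (f ` D)"
  proof -
    let ?S = "(h ` C \<inter> gamma2 N (h ` carrier M)) \<union> gamma2 N D"
    have S: "?S \<subseteq> D" using h.B.gamma2_sub[OF D(1)] D(3) by blast
    have "f ` generate N ?S = generate M (f ` ?S)"
      using F.f.generate_img[of ?S] S h.B.generate_consistent[OF S D(1)] by simp
    moreover have "f ` ?S \<subseteq> (C \<inter> gamma2 M (carrier M)) \<union> gamma2 M (f ` D)"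
    proof -
      have "f ` gamma2 N D = gamma2 M (f ` D)"
        using F.f.gamma2_image[of D] h.B.gamma_consistent[OF D(1) D(1)] by simp
      moreover have "f ` (h ` C \<inter> gamma2 N (h ` carrier M)) \<subseteq> C \<inter> gamma2 M (carrier M)"
        using fh h.f_gamma2_mem[OF subset_refl] Cc by auto
      ultimately show ?thesis by blast
    qed
    ultimately show ?thesis unfolding spread2_def
      by (simp only: h.A.mono_generate)
  qed
  have fs3: "f ` spread3 N (h ` carrier M) (h ` C) D \<subseteq> spread3 M (carrier M) C (f ` D)"
  proof -
    let ?T = "{commutator N l g |l g. l \<in> spread2 N (h ` carrier M) (h ` C) D \<and> g \<in> D}"
    let ?S = "(h ` C \<inter> gamma3 N (h ` carrier M)) \<union> ?T"
    have "commutator N l g \<in> D" if "l \<in> D" "g \<in> D" for l g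
      using that subgroup.m_closed[OF D(1)] subgroup.m_inv_closed[OF D(1)] by (simp add: commutator_def)
    then have S: "?S \<subseteq> D" using s2D D(3) by blast
    have "f ` generate N ?S = generate M (f ` ?S)"
      using F.f.generate_img[of ?S] S h.B.generate_consistent[OF S D(1)] by simp
    moreover have "f ` ?S \<subseteq> (C \<inter> gamma3 M (carrier M)) \<union>
        {commutator M l g |l g. l \<in> spread2 M (carrier M) C (f ` D) \<and> g \<in> f ` D}"
    proof -
      have fc: "f (commutator N l g) = commutator M (f l) (f g)" if "l \<in> D" "g \<in> D" for l g
        using F.f_cm[of l g] h.B.commutator_consistent[OF D(1)] that by simp
      have "f ` ?T \<subseteq> {commutator M l g |l g. l \<in> spread2 M (carrier M) C (f ` D) \<and> g \<in> f ` D}"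
      proof
        fix y assume "y \<in> f ` ?T"
        then obtain l g where lg: "l \<in> spread2 N (h ` carrier M) (h ` C) D" "g \<in> D"
          "y = f (commutator N l g)" by blast
        then have "y = commutator M (f l) (f g)" using fc s2D by blast
        moreover have "f l \<in> spread2 M (carrier M) C (f ` D)" using lg(1) fs2 by blast
        ultimately show "y \<in> {commutator M l g |l g. l \<in> spread2 M (carrier M) C (f ` D) \<and> g \<in> f ` D}"
          using lg(2) by blast
      qed
      moreover have "f ` (h ` C \<inter> gamma3 N (h ` carrier M)) \<subseteq> C \<inter> gamma3 M (carrier M)"
        using fh h.f_gamma3_mem[OF subset_refl] Cc by auto
      ultimately show ?thesis unfolding image_Un by (rule Un_mono[rotated])
    qed
    ultimately show ?thesis unfolding spread3_def
      by (simp only: h.A.mono_generate)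
  qed
  have "tame M (carrier M) (carrier M) C (f ` D)"
    unfolding tame_def
  proof (intro conjI subsetI)
    fix y assume "y \<in> f ` D \<inter> gamma2 M (carrier M)"
    then obtain d where "d \<in> D" "y = f d" "d \<in> gamma2 N (carrier N)" using g2 by blast
    then show "y \<in> spread2 M (carrier M) C (f ` D)" using tame fs2 unfolding tame_def by blast
  next
    fix y assume "y \<in> f ` D \<inter> gamma3 M (carrier M)"
    then obtain d where "d \<in> D" "y = f d" "d \<in> gamma3 N (carrier N)" using g3 by blast
    then show "y \<in> spread3 M (carrier M) C (f ` D)" using tame fs3 unfolding tame_def by blast
  qed
  then show thesis using that[OF F.exponent3_embedding_axioms fh] by blast
qed

section \<open>Killing an element of a generic extension\<close>

lemma (in group_hom) spread2_image_subset:
  assumes "H' \<subseteq> carrier G" "C \<subseteq> carrier G" "D \<subseteq> carrier G" and G: "exponent3_group G"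
  shows "h ` spread2 G H' C D \<subseteq> spread2 H (h ` H') (h ` C) (h ` D)"
proof -
  interpret E: exponent3_group G by fact
  have c: "gamma2 G D \<subseteq> carrier G" using E.gamma2_subgroup[OF assms(3)] subgroup.subset by blast
  have "h ` ((C \<inter> gamma2 G H') \<union> gamma2 G D) \<subseteq> (h ` C \<inter> gamma2 H (h ` H')) \<union> gamma2 H (h ` D)"
    unfolding gamma2_image[OF assms(1)] gamma2_image[OF assms(3)] by blast
  moreover have "(C \<inter> gamma2 G H') \<union> gamma2 G D \<subseteq> carrier G" using c assms by blast
  ultimately show ?thesis
    unfolding spread2_def using generate_img H.mono_generate by (metis (no_types, lifting))
qed

lemma (in group_hom) spread3_image_subset:
  assumes "H' \<subseteq> carrier G" "C \<subseteq> carrier G" "D \<subseteq> carrier G" and G: "exponent3_group G"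
  shows "h ` spread3 G H' C D \<subseteq> spread3 H (h ` H') (h ` C) (h ` D)"
proof -
  interpret E: exponent3_group G by fact
  let ?T = "{commutator G l g |l g. l \<in> spread2 G H' C D \<and> g \<in> D}"
  let ?T' = "{commutator H l g |l g. l \<in> spread2 H (h ` H') (h ` C) (h ` D) \<and> g \<in> h ` D}"
  have c: "spread2 G H' C D \<subseteq> carrier G" using E.spread2_carrier[OF assms(2,3)] subgroup.subset by blast
  have "h ` ?T \<subseteq> ?T'"
  proof
    fix y assume "y \<in> h ` ?T"
    then obtain l g where lg: "l \<in> spread2 G H' C D" "g \<in> D" "y = h (commutator G l g)" by blast
    then have "y = commutator H (h l) (h g)" using hom_commutator[of l g] c assms(3) by blast
    moreover have "h l \<in> spread2 H (h ` H') (h ` C) (h ` D)"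
      using spread2_image_subset[OF assms] lg(1) by blast
    ultimately show "y \<in> ?T'" using lg(2) by blast
  qed
  moreover have "h ` (C \<inter> gamma3 G H') \<subseteq> h ` C \<inter> gamma3 H (h ` H')"
    unfolding gamma3_image[OF assms(1)] by blast
  ultimately have "h ` ((C \<inter> gamma3 G H') \<union> ?T) \<subseteq> (h ` C \<inter> gamma3 H (h ` H')) \<union> ?T'"
    unfolding image_Un by (rule Un_mono[rotated])
  then have "generate H (h ` ((C \<inter> gamma3 G H') \<union> ?T)) \<subseteq> spread3 H (h ` H') (h ` C) (h ` D)"
    unfolding spread3_def by (rule H.mono_generate)
  moreover have "(C \<inter> gamma3 G H') \<union> ?T \<subseteq> carrier G"
    using assms c E.cm_closed by blast
  ultimately show ?thesis unfolding spread3_def[of G] by (simp only: generate_img)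
qed

context exponent3_group
begin

lemma pow_set_mult:
  assumes "a \<in> carrier G" "p \<in> {\<one>, a, a \<otimes> a}" "q \<in> {\<one>, a, a \<otimes> a}"
  shows "p \<otimes> q \<in> {\<one>, a, a \<otimes> a}"
proof -
  have "a \<otimes> (a \<otimes> a) = \<one>" "a \<otimes> a \<otimes> (a \<otimes> a) = a" "a \<otimes> a \<otimes> a = \<one>"
    using cube[OF assms(1)] assms(1) by (simp_all add: m_assoc)
  then show ?thesis using assms by auto
qed

text \<open>The normal closure of an element \<open>w\<close> of the second centre.\<close>

definition ncl :: "'a \<Rightarrow> 'a set"
  where "ncl w = {p \<otimes> cm w g | p g. p \<in> {\<one>, w, w \<otimes> w} \<and> g \<in> carrier G}"

text \<open>For w in \<open>Z2\<close> the map sending g to [w, g] is a homomorphism into the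
  centre, which gives closure under products. Conjugating a power of w changes it only by another
  [w, u].\<close>

lemma ncl_normal:
  assumes w: "w \<in> Z2"
  shows "ncl w \<lhd> G"
proof -
  note wc = Z2_carrier[OF w]
  have pc: "p \<in> carrier G" if "p \<in> {\<one>, w, w \<otimes> w}" for p using that wc by auto
  have z: "cm w g \<in> Z1" if "g \<in> carrier G" for g using Z2_D(1)[OF w that] .
  have mul: "(p \<otimes> cm w g) \<otimes> (q \<otimes> cm w k) = (p \<otimes> q) \<otimes> cm w (g \<otimes> k)"
    if "p \<in> carrier G" "q \<in> carrier G" "g \<in> carrier G" "k \<in> carrier G" for p q g k
  proof -
    have "(p \<otimes> cm w g) \<otimes> (q \<otimes> cm w k) = p \<otimes> (cm w g \<otimes> q) \<otimes> cm w k" using that wc by (simp add: m_assoc)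
    also have "cm w g \<otimes> q = q \<otimes> cm w g" using Z1_commute[OF z] that by blast
    finally show ?thesis using that wc by (simp add: Z2_mult_right(1)[OF w] m_assoc)
  qed
  have sub: "subgroup (ncl w) G"
  proof (rule subgroupI_mult)
    show "ncl w \<subseteq> carrier G" unfolding ncl_def using pc wc by blast
    have "\<one> \<otimes> cm w \<one> \<in> ncl w" unfolding ncl_def by blast
    then show "ncl w \<noteq> {}" by blast
    fix x y assume x: "x \<in> ncl w" and y: "y \<in> ncl w"
    obtain p g where p: "x = p \<otimes> cm w g" "p \<in> {\<one>, w, w \<otimes> w}" "g \<in> carrier G"
      using x unfolding ncl_def by blast
    obtain q k where q: "y = q \<otimes> cm w k" "q \<in> {\<one>, w, w \<otimes> w}" "k \<in> carrier G"
      using y unfolding ncl_def by blast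
    have "x \<otimes> y = (p \<otimes> q) \<otimes> cm w (g \<otimes> k)" using mul p q pc by simp
    moreover have "p \<otimes> q \<in> {\<one>, w, w \<otimes> w}" using pow_set_mult[OF wc p(2) q(2)] .
    ultimately show "x \<otimes> y \<in> ncl w" unfolding ncl_def using p(3) q(3) m_closed by blast
  qed
  show ?thesis
  proof (rule normal_invI[OF sub])
    fix x r assume x: "x \<in> carrier G" and r: "r \<in> ncl w"
    obtain p g where p: "r = p \<otimes> cm w g" "p \<in> {\<one>, w, w \<otimes> w}" "g \<in> carrier G"
      using r unfolding ncl_def by blast
    have xw: "cm x w = cm w (inv x)" using Z2_inv(3)[OF w x] inv_cm[OF wc x] by simp
    have "\<exists>u\<in>carrier G. cm x p = cm w u"
    proof -
      have "cm x \<one> = cm w \<one>" using x wc cm_one by simp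
      moreover have "cm x (w \<otimes> w) = cm w (inv x \<otimes> inv x)"
        using Z2_mult_left(3)[OF w wc x] Z2_mult_right(1)[OF w, of "inv x" "inv x"] xw x by simp
      ultimately show ?thesis using p(2) xw x by blast
    qed
    then obtain u where u: "u \<in> carrier G" "cm x p = cm w u" by blast
    have "x \<otimes> r \<otimes> inv x = x \<otimes> p \<otimes> (cm w g \<otimes> inv x)"
      unfolding p(1) using x pc[OF p(2)] p(3) wc by (simp add: m_assoc)
    also have "cm w g \<otimes> inv x = inv x \<otimes> cm w g" using Z1_commute[OF z[OF p(3)]] x by simp
    also have "x \<otimes> p \<otimes> (inv x \<otimes> cm w g) = cm x p \<otimes> p \<otimes> cm w g"
      using x pc[OF p(2)] p(3) wc by (simp add: commutator_def m_assoc inv_cancel)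
    also have "cm x p \<otimes> p = p \<otimes> cm w u" using u(2) Z1_commute[OF z[OF u(1)] pc[OF p(2)]] by simp
    also have "p \<otimes> cm w u \<otimes> cm w g = p \<otimes> cm w (u \<otimes> g)"
      using pc[OF p(2)] u p wc by (simp add: m_assoc Z2_mult_right(1)[OF w])
    finally show "x \<otimes> r \<otimes> inv x \<in> ncl w"
      unfolding ncl_def using p(2,3) u(1) m_closed by blast
  qed
qed

lemma ncl_self: "w \<in> carrier G \<Longrightarrow> p \<in> {\<one>, w, w \<otimes> w} \<Longrightarrow> p \<in> ncl w"
proof -
  assume w: "w \<in> carrier G" and p: "p \<in> {\<one>, w, w \<otimes> w}"
  then have "p = p \<otimes> cm w \<one>" by (auto simp: cm_one)
  then show "p \<in> ncl w" unfolding ncl_def using p one_closed by blast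
qed

text \<open>Kernel elements are p z with p a power of w and z in \<open>\<gamma>\<^sub>3(G)\<close>.
  Both factors are in \<open>\<gamma>\<^sub>2(G)\<close>, so no new element of \<open>D\<close>
  enters \<open>\<gamma>\<^sub>2\<close>. For \<open>\<gamma>\<^sub>3\<close> the factor p is
  divided off, which stays inside \<open>D\<close> because w is in \<open>D\<close> and changes
  nothing in the quotient.\<close>

lemma tame_quotient:
  assumes w: "w \<in> gamma2 G (carrier G)" "w \<in> D" and HC: "H \<subseteq> carrier G" "C \<subseteq> carrier G"
    and D: "subgroup D G" and t: "tame G (carrier G) H C D"
  defines "R \<equiv> ncl w"
  shows "tame (G Mod R) (carrier (G Mod R)) ((#>) R ` H) ((#>) R ` C) ((#>) R ` D)"
proof -
  have w2: "w \<in> Z2" using gamma2_Z2[OF subset_refl] w(1) by blast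
  note wc = Z2_carrier[OF w2]
  have R: "R \<lhd> G" unfolding R_def by (rule ncl_normal[OF w2])
  define N where "N = G Mod R"
  define q where "q x = R #> x" for x
  note Q = quotient_exponent3[OF R, folded N_def q_def]
  have Dc: "D \<subseteq> carrier G" using subgroup.subset[OF D] .
  interpret N: exponent3_group N by (rule Q)
  interpret q: group_hom G N q using Q(2) by unfold_locales
  note Gc = exponent3_group_axioms
  note g2 = gamma2_subgroup[of "carrier G", OF subset_refl] and g3 = gamma3_subgroup[of "carrier G", OF subset_refl]
  have q2: "gamma2 N (carrier N) = q ` gamma2 G (carrier G)" using q.gamma2_image[of "carrier G"] Q(3) by simp
  have q3: "gamma3 N (carrier N) = q ` gamma3 G (carrier G)" using q.gamma3_image[of "carrier G"] Q(3) by simp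
  have pD: "p \<in> D" "p \<in> gamma2 G (carrier G)" if "p \<in> {\<one>, w, w \<otimes> w}" for p
    using that w subgroup.one_closed[OF D] subgroup.m_closed[OF D] subgroup.one_closed[OF g2] subgroup.m_closed[OF g2]
    by auto
  have qeq: "\<exists>p\<in>{\<one>, w, w \<otimes> w}. \<exists>z\<in>gamma3 G (carrier G). d = p \<otimes> z \<otimes> e"
    if "d \<in> carrier G" "e \<in> carrier G" "q d = q e" for d e
  proof -
    have "q (d \<otimes> inv e) = \<one>\<^bsub>N\<^esub>" using that by simp
    then have "d \<otimes> inv e \<in> ncl w" using Q(4)[of "d \<otimes> inv e"] that by (simp add: R_def)
    then obtain p g where p: "d \<otimes> inv e = p \<otimes> cm w g" "p \<in> {\<one>, w, w \<otimes> w}" "g \<in> carrier G"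
      unfolding ncl_def by blast
    have "d = d \<otimes> inv e \<otimes> e" using that by (simp add: m_assoc)
    then have "d = p \<otimes> cm w g \<otimes> e" by (simp only: p(1))
    moreover have "cm w g \<in> gamma3 G (carrier G)" using cm_gamma3 w(1) p(3) by blast
    ultimately show ?thesis using p(2) by blast
  qed
  have "tame N (carrier N) (q ` H) (q ` C) (q ` D)"
    unfolding tame_def
  proof (intro conjI subsetI)
    fix y assume "y \<in> q ` D \<inter> gamma2 N (carrier N)"
    then obtain d e where de: "d \<in> D" "y = q d" "e \<in> gamma2 G (carrier G)" "q d = q e" using q2 by auto
    have c: "d \<in> carrier G" "e \<in> carrier G" using de Dc subgroup.mem_carrier[OF g2] by auto
    obtain p z where p: "p \<in> {\<one>, w, w \<otimes> w}" "z \<in> gamma3 G (carrier G)" "d = p \<otimes> z \<otimes> e"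
      using qeq[OF c de(4)] by blast
    have "z \<in> gamma2 G (carrier G)" using p(2) gamma3_sub_gamma2[OF subgroup_self] by blast
    then have "d \<in> gamma2 G (carrier G)" using p pD(2) de(3) subgroup.m_closed[OF g2] by simp
    then have "d \<in> spread2 G H C D" using t de(1) unfolding tame_def by blast
    then show "y \<in> spread2 N (q ` H) (q ` C) (q ` D)"
      using q.spread2_image_subset[OF HC Dc Gc] de(2) by blast
  next
    fix y assume "y \<in> q ` D \<inter> gamma3 N (carrier N)"
    then obtain d e where de: "d \<in> D" "y = q d" "e \<in> gamma3 G (carrier G)" "q d = q e" using q3 by auto
    have c: "d \<in> carrier G" "e \<in> carrier G" using de Dc subgroup.mem_carrier[OF g3] by auto
    obtain p z where p: "p \<in> {\<one>, w, w \<otimes> w}" "z \<in> gamma3 G (carrier G)" "d = p \<otimes> z \<otimes> e"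
      using qeq[OF c de(4)] by blast
    have cc: "p \<in> carrier G" "z \<in> carrier G" using p subgroup.mem_carrier[OF g3] pD(1) Dc by blast+
    have "inv p \<otimes> d = z \<otimes> e" using p(3) c cc by (simp add: m_assoc inv_cancel)
    then have "inv p \<otimes> d \<in> gamma3 G (carrier G)" using p(2) de(3) subgroup.m_closed[OF g3] by simp
    moreover have "inv p \<otimes> d \<in> D"
      using pD(1)[OF p(1)] de(1) subgroup.m_closed[OF D] subgroup.m_inv_closed[OF D] by blast
    ultimately have "inv p \<otimes> d \<in> spread3 G H C D" using t unfolding tame_def by blast
    then have "q (inv p \<otimes> d) \<in> spread3 N (q ` H) (q ` C) (q ` D)"
      using q.spread3_image_subset[OF HC Dc Gc] by blast
    moreover have "q p = \<one>\<^bsub>N\<^esub>" using Q(4)[OF cc(1)] ncl_self[OF wc p(1)] by (simp add: R_def)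
    ultimately show "y \<in> spread3 N (q ` H) (q ` C) (q ` D)" using de(2) c cc by simp
  qed
  then show ?thesis by (simp add: N_def q_def image_def)
qed

end

text \<open>Trivial intersection with \<open>M\<close> keeps \<open>M\<close> embedded in the
  quotient by the normal closure of w, and a finite piece of this quotient is transferred. Hence
  \<psi> is not injective in general, but it still undoes h on \<open>C\<close>.\<close>

lemma kill_element:
  fixes M :: "('a, 'b) monoid_scheme" and G :: "('c, 'd) monoid_scheme"
  assumes ec: "existentially_closed_T3 M" and h: "exponent3_embedding M G h"
    and C: "subgroup C M" "finite C" and D: "subgroup D G" "finite D" "h ` C \<subseteq> D"
    and t: "tame G (carrier G) (h ` carrier M) (h ` C) D"
    and w: "w \<in> gamma2 G (carrier G)" "w \<in> D"
    and triv: "exponent3_group.ncl G w \<inter> h ` carrier M \<subseteq> {\<one>\<^bsub>G\<^esub>}"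
  obtains \<psi> where "\<psi> \<in> hom (G\<lparr>carrier := D\<rparr>) M" "\<And>c. c \<in> C \<Longrightarrow> \<psi> (h c) = c" "\<psi> w = \<one>\<^bsub>M\<^esub>"
    "tame M (carrier M) (carrier M) C (\<psi> ` D)"
proof -
  interpret h: exponent3_embedding M G h by fact
  define R where "R = h.B.ncl w"
  have w2: "w \<in> h.B.Z2" using h.B.gamma2_Z2[OF subset_refl] w(1) by blast
  note wc = h.B.Z2_carrier[OF w2]
  have R: "R \<lhd> G" unfolding R_def by (rule h.B.ncl_normal[OF w2])
  define N where "N = G Mod R"
  define q where "q x = R #>\<^bsub>G\<^esub> x" for x
  note Q = h.B.quotient_exponent3[OF R, folded N_def q_def]
  have qR: "(#>\<^bsub>G\<^esub>) R = q" by (simp add: q_def fun_eq_iff)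
  interpret N: exponent3_group N by (rule Q)
  interpret q: group_hom G N q using Q(2) by unfold_locales
  have hc: "h ` carrier M \<subseteq> carrier G" "h ` C \<subseteq> carrier G" using subgroup.subset[OF C(1)] by auto
  have tq: "tame N (carrier N) (q ` h ` carrier M) (q ` h ` C) (q ` D)"
    using h.B.tame_quotient[OF w hc D(1) t] unfolding R_def[symmetric] N_def qR .
  interpret qh: exponent3_embedding M N "q \<circ> h"
  proof
    show hom: "q \<circ> h \<in> hom M N" using h.f_hom Q(2) by (auto simp: hom_def)
    show "inj_on (q \<circ> h) (carrier M)"
    proof (rule inj_onI)
      fix x y assume xy: "x \<in> carrier M" "y \<in> carrier M" "(q \<circ> h) x = (q \<circ> h) y"
      have z: "x \<otimes>\<^bsub>M\<^esub> inv\<^bsub>M\<^esub> y \<in> carrier M" using xy by simp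
      have "q (h (x \<otimes>\<^bsub>M\<^esub> inv\<^bsub>M\<^esub> y)) = \<one>\<^bsub>N\<^esub>" using xy by simp
      then have "h (x \<otimes>\<^bsub>M\<^esub> inv\<^bsub>M\<^esub> y) \<in> R" using Q(4) z h.f.hom_closed by blast
      then have "h (x \<otimes>\<^bsub>M\<^esub> inv\<^bsub>M\<^esub> y) = \<one>\<^bsub>G\<^esub>" using triv z unfolding R_def by blast
      then have "x \<otimes>\<^bsub>M\<^esub> inv\<^bsub>M\<^esub> y = \<one>\<^bsub>M\<^esub>"
        using inj_onD[OF h.f_inj, of "x \<otimes>\<^bsub>M\<^esub> inv\<^bsub>M\<^esub> y" "\<one>\<^bsub>M\<^esub>"] z by simp
      then show "x = y" using xy h.A.inv_equality by (metis h.A.inv_closed h.A.inv_inv)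
    qed
  qed
  have qD: "subgroup (q ` D) N" using q.subgroup_img_is_subgroup[OF D(1)] .
  obtain f where f: "exponent3_embedding (N\<lparr>carrier := q ` D\<rparr>) M f" "\<And>c. c \<in> C \<Longrightarrow> f ((q \<circ> h) c) = c"
    "tame M (carrier M) (carrier M) C (f ` q ` D)"
  proof (rule transfer_to_existentially_closed[OF ec qh.exponent3_embedding_axioms C qD])
    show "finite (q ` D)" using D by simp
    show "(q \<circ> h) ` C \<subseteq> q ` D" using D(3) by auto
    show "tame N (carrier N) ((q \<circ> h) ` carrier M) ((q \<circ> h) ` C) (q ` D)" using tq by (simp add: image_comp)
  qed (rule that; assumption)
  interpret f: exponent3_embedding "N\<lparr>carrier := q ` D\<rparr>" M f by fact
  have Dc: "D \<subseteq> carrier G" using subgroup.subset[OF D(1)] .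
  show thesis
  proof (rule that[of "f \<circ> q"])
    show "f \<circ> q \<in> hom (G\<lparr>carrier := D\<rparr>) M"
    proof (rule homI)
      fix x y assume "x \<in> carrier (G\<lparr>carrier := D\<rparr>)" "y \<in> carrier (G\<lparr>carrier := D\<rparr>)"
      then have xy: "x \<in> D" "y \<in> D" "x \<in> carrier G" "y \<in> carrier G" using Dc by auto
      then show "(f \<circ> q) (x \<otimes>\<^bsub>G\<lparr>carrier := D\<rparr>\<^esub> y) = (f \<circ> q) x \<otimes>\<^bsub>M\<^esub> (f \<circ> q) y"
        using f.f.hom_mult[of "q x" "q y"] by simp
    qed (use f.f.hom_closed in auto)
    have "q w = \<one>\<^bsub>N\<^esub>" using Q(4)[OF wc] h.B.ncl_self[OF wc] by (simp add: R_def)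
    then show "(f \<circ> q) w = \<one>\<^bsub>M\<^esub>" using f.f.hom_one by simp
  qed (use f in \<open>simp_all add: image_comp\<close>)
qed

context exponent3_group
begin

text \<open>Let w = [x, y] c^-1. If w times a central [w, g] lay in \<open>H\<close>, projecting y
  away would put [x, y] into \<open>\<gamma>\<^sub>3(G)\<close>, against the genericity of y and x.
  If [w, g] lies in \<open>H\<close>, projecting y and then x away turns it into [c^-1, m] with m in
  \<open>H\<close>; genericity forces m into \<open>\<gamma>\<^sub>2(H)\<close>, and this commutator
  vanishes in class 3.\<close>

lemma generic_kill_commutator:
  assumes gx: "generic_in G K H x" and gy: "generic_in G (carrier G) K y" and c: "c \<in> gamma2 G H"
  shows "ncl (cm x y \<otimes> inv c) \<inter> H \<subseteq> {\<one>}"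
proof -
  note Dx = generic_inD[OF gx] and Dy = generic_inD[OF gy]
  note Kc = subgroup.mem_carrier[OF Dx(1)] and Hc = subgroup.mem_carrier[OF Dx(2)]
  have g2: "subgroup (gamma2 G S) G" "subgroup (gamma3 G S) G" if "subgroup S G" for S
    using gamma2_subgroup gamma3_subgroup subgroup.subset[OF that] by blast+
  obtain \<rho> where \<rho>: "\<And>u. u \<in> carrier G \<Longrightarrow> \<rho> u \<in> K"
    "\<And>u v. u \<in> carrier G \<Longrightarrow> v \<in> carrier G \<Longrightarrow> \<rho> (u \<otimes> v) = \<rho> u \<otimes> \<rho> v"
    "\<And>u v. u \<in> carrier G \<Longrightarrow> v \<in> carrier G \<Longrightarrow> \<rho> (cm u v) = cm (\<rho> u) (\<rho> v)"
    "\<And>u. u \<in> carrier G \<Longrightarrow> \<rho> (inv u) = inv (\<rho> u)" "\<And>m. m \<in> K \<Longrightarrow> \<rho> m = m" "\<rho> y = \<one>"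
    "\<And>u. u \<in> gamma3 G (carrier G) \<Longrightarrow> \<rho> u \<in> gamma3 G K"
    by (rule generic_retraction[OF gy]) (rule that; assumption)
  obtain \<sigma> where \<sigma>: "\<And>u v. u \<in> K \<Longrightarrow> v \<in> K \<Longrightarrow> \<sigma> (u \<otimes> v) = \<sigma> u \<otimes> \<sigma> v"
    "\<And>u v. u \<in> K \<Longrightarrow> v \<in> K \<Longrightarrow> \<sigma> (cm u v) = cm (\<sigma> u) (\<sigma> v)"
    "\<And>m. m \<in> H \<Longrightarrow> \<sigma> m = m" "\<sigma> x = \<one>" "\<And>u. u \<in> K \<Longrightarrow> \<sigma> u \<in> H"
    "\<And>u. u \<in> gamma3 G K \<Longrightarrow> \<sigma> u \<in> gamma3 G H"
    by (rule generic_retraction[OF gx]) (rule that; assumption)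
  have cH: "c \<in> H" "c \<in> K" "c \<in> carrier G" using c gamma2_sub[OF Dx(2)] Dx(8) Kc by auto
  have cZ: "c \<in> Z2" using c gamma2_Z2[OF subgroup.subset[OF Dx(2)]] by blast
  have xc: "x \<in> carrier G" "x \<in> K" and yc: "y \<in> carrier G" using Dx Dy by auto
  define w where "w = cm x y \<otimes> inv c"
  have wZ: "w \<in> Z2" using cZ xc yc by (auto simp: w_def)
  have w: "w \<in> carrier G" using Z2_carrier[OF wZ] .
  have wG: "w \<in> gamma2 G (carrier G)"
    unfolding w_def using cm_gamma2[OF xc(1) yc] c gamma2_mono[OF subgroup.subset[OF Dx(2)]]
      subgroup.m_closed[OF g2(1)[OF subgroup_self]] subgroup.m_inv_closed[OF g2(1)[OF subgroup_self]] by blast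
  have \<rho>w: "\<rho> w = inv c" using \<rho> xc yc cH cm_one(1)[OF xc(1)] by (simp add: w_def)
  have z3: "cm w g \<in> gamma3 G (carrier G)" if "g \<in> carrier G" for g using cm_gamma3[OF wG that] .
  have zZ: "u \<in> Z1" if "u \<in> gamma3 G (carrier G)" for u using gamma3_Z1[OF subset_refl] that by blast
  \<comment> \<open>\<rho> kills [x, y] and fixes e c, so e c is the projection of [w, g] and lies
    in \<open>\<gamma>\<^sub>3(G)\<close>. As e c is also [x, y] [w, g], this leaves [x, y] in
    \<open>\<gamma>\<^sub>3(G)\<close>.\<close>
  have no: "w \<otimes> cm w g \<notin> H" if g: "g \<in> carrier G" for g
  proof
    assume e: "w \<otimes> cm w g \<in> H"
    let ?e = "w \<otimes> cm w g" and ?z = "cm w g"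
    have zc: "?z \<in> carrier G" "?e \<in> carrier G" using w g by auto
    have "?e \<otimes> c = cm x y \<otimes> inv c \<otimes> (?z \<otimes> c)" using zc cH xc yc by (simp add: w_def m_assoc)
    also have "?z \<otimes> c = c \<otimes> ?z" using Z1_commute[OF zZ[OF z3[OF g]] cH(3)] .
    finally have 1: "?e \<otimes> c = cm x y \<otimes> ?z" using zc cH xc yc by (simp add: m_assoc inv_cancel)
    have eK: "?e \<otimes> c \<in> K" using e cH Dx(8) subgroup.m_closed[OF Dx(1)] by blast
    then have "?e \<otimes> c = \<rho> (?e \<otimes> c)" using \<rho>(5) by simp
    also have "\<dots> = \<rho> ?z" unfolding 1 using \<rho> xc yc zc cm_one(1)[OF xc(1)] Kc by simp
    also have "\<dots> \<in> gamma3 G (carrier G)"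
      using \<rho>(7)[OF z3[OF g]] gamma3_mono[OF subgroup.subset[OF Dx(1)]] by blast
    finally have "cm x y \<otimes> ?z \<otimes> inv ?z \<in> gamma3 G (carrier G)"
      unfolding 1 using z3[OF g] subgroup.m_closed[OF g2(2)[OF subgroup_self]]
        subgroup.m_inv_closed[OF g2(2)[OF subgroup_self]] by blast
    then have "cm x y \<in> gamma3 G (carrier G)" using zc xc yc by (simp add: m_assoc)
    then have "inv (cm x y) \<in> gamma3 G (carrier G)" using subgroup.m_inv_closed[OF g2(2)[OF subgroup_self]] by blast
    then have "x \<in> gamma2 G K" using Dy(7)[OF xc(2)] xc yc by (simp add: inv_cm)
    then show False using Dx(5) by blast
  qed
  have "e = \<one>" if e: "e \<in> ncl w" "e \<in> H" for e
  proof -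
    obtain p g where p: "p \<in> {\<one>, w, w \<otimes> w}" "g \<in> carrier G" "e = p \<otimes> cm w g"
      using e(1) unfolding ncl_def by blast
    consider "p = \<one>" | "p = w" | "p = w \<otimes> w" using p(1) by blast
    then show ?thesis
    proof cases
      case 2 then show ?thesis using no[OF p(2)] e(2) p(3) by simp
    next
      \<comment> \<open>Inversion turns w^2 [w, g] into w [w, g^-1], so \<open>no\<close> applies
        again.\<close>
      case 3
      have "inv e = inv (cm w g) \<otimes> w" using 3 p w inv_square[OF w] by (simp add: inv_mult_group)
      also have "\<dots> = w \<otimes> cm w (inv g)"
        using Z2_inv(3)[OF wZ p(2)] Z1_commute[OF Z1_inv[OF zZ[OF z3[OF p(2)]]] w] by simp
      finally show ?thesis using no[of "inv g"] p(2) subgroup.m_inv_closed[OF Dx(2) e(2)] by simp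
    next
      case 1
      \<comment> \<open>Now e = [w, g]. In the normal form of g over y the factor [y, l] contributes
        nothing, since w commutes with commutators; and applying \<rho> to e gives e =
        [c^-1, k].\<close>
      obtain p' l k where k: "p' \<in> {\<one>, y, y \<otimes> y}" "l \<in> K" "k \<in> K" "g = p' \<otimes> cm y l \<otimes> k"
        using normal_form[OF Dx(1) yc] p(2) Dy(4) by blast
      have kc: "k \<in> carrier G" "l \<in> carrier G" "p' \<in> carrier G" using k Kc yc by auto
      have \<rho>p: "\<rho> p' = \<one>" using k(1) \<rho> yc subgroup.one_closed[OF Dx(1)] by auto
      have \<rho>g: "\<rho> g = k"
        using \<rho> k kc yc \<rho>p cm_one(2)[OF kc(2)] by simp
      have e1: "e = cm w g" using p 1 w by simp
      have "\<rho> e = e" by (rule \<rho>(5)) (use e(2) Dx(8) in blast)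
      then have e2: "e = cm (inv c) k" unfolding e1 using \<rho>(3)[OF w p(2)] \<rho>w \<rho>g by simp
      have "cm w g = cm w p' \<otimes> cm w (cm y l) \<otimes> cm w k"
        using kc yc w by (simp add: k(4) Z2_mult_right(1)[OF wZ])
      also have "cm w (cm y l) = \<one>" using Z2_commute_cm[OF wZ] kc yc by blast
      also have "cm w k = cm (cm x y) k \<otimes> cm (inv c) k"
        unfolding w_def using Z2_mult_left(1)[of "cm x y" "inv c" k] xc yc cH kc by simp
      finally have "cm (inv c) k = cm w p' \<otimes> (cm (cm x y) k \<otimes> cm (inv c) k)"
        using e1 e2 kc w by simp
      \<comment> \<open>The two expressions for e share the factor [c^-1, k], which cancels.\<close>
      then have 3: "cm w p' \<otimes> cm (cm x y) k = \<one>"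
        using kc w xc yc cH by (simp add: m_assoc[symmetric])
      have wy: "cm w y = cm (inv c) y"
        unfolding w_def using Z2_mult_left(1)[of "cm x y" "inv c" y] xc yc cH trilinear_same(1) by simp
      \<comment> \<open>Because [x, y, y] = 1, the commutators of w with powers of y are those of
        powers of c^-1 with y.\<close>
      have "\<exists>b\<in>gamma2 G H. cm w p' = cm b y"
      proof -
        have i: "inv c \<in> gamma2 G H" "inv c \<otimes> inv c \<in> gamma2 G H" "\<one> \<in> gamma2 G H"
          using c subgroup.m_inv_closed[OF g2(1)[OF Dx(2)]] subgroup.m_closed[OF g2(1)[OF Dx(2)]]
            subgroup.one_closed[OF g2(1)[OF Dx(2)]] by auto
        have "cm w (y \<otimes> y) = cm (inv c \<otimes> inv c) y"
          using Z2_mult_right(1)[OF wZ yc yc] Z2_mult_left(1)[OF Z2_inv_closed[OF cZ], of "inv c" y] wy cH yc by simp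
        moreover have "cm w \<one> = cm \<one> y" using w yc cm_one by simp
        ultimately show ?thesis using k(1) i wy by blast
      qed
      then obtain b where b: "b \<in> gamma2 G H" "cm w p' = cm b y" by blast
      have bK: "b \<in> H" "b \<in> K" "b \<in> carrier G" using b gamma2_sub[OF Dx(2)] Dx(8) Kc by auto
      have bZ: "b \<in> Z2" using b gamma2_Z2[OF subgroup.subset[OF Dx(2)]] by blast
      \<comment> \<open>After cycling, relation \<open>3\<close> becomes [b [k, x], y] = 1, a
        statement about y and an element of \<open>K\<close>, so genericity of y applies.\<close>
      have cyc: "cm (cm x y) k = cm (cm k x) y" using trilinear_cyc[OF kc(1) xc(1) yc] by simp
      have "cm (b \<otimes> cm k x) y = \<one>"
        using Z2_mult_left(1)[OF bZ, of "cm k x" y] 3 b(2) cyc kc xc yc by simp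
      then have "cm y (b \<otimes> cm k x) = \<one>"
        using inv_cm[of "b \<otimes> cm k x" y] bK kc xc yc by simp
      moreover have kxK: "cm k x \<in> K" using cm_gamma2[OF k(3) xc(2)] gamma2_sub[OF Dx(1)] by blast
      ultimately have b3: "b \<otimes> cm k x \<in> gamma3 G K"
        using Dy(6) bK subgroup.m_closed[OF Dx(1)] by blast
      have "\<sigma> (b \<otimes> cm k x) = b"
        using \<sigma> bK kxK k(3) xc(2) cm_one(1)[OF Hc[OF \<sigma>(5)[OF k(3)]]] by simp
      then have "b \<in> gamma3 G K" using \<sigma>(6)[OF b3] gamma3_mono[OF Dx(8)] by auto
      then have "inv b \<otimes> (b \<otimes> cm k x) \<in> gamma3 G K"
        using b3 subgroup.m_closed[OF g2(2)[OF Dx(1)]] subgroup.m_inv_closed[OF g2(2)[OF Dx(1)]] by blast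
      then have kx: "cm k x \<in> gamma3 G K" using bK kc xc by (simp add: inv_cancel)
      \<comment> \<open>The same splitting one level down: u = p3 [x, l3] commutes with x, so [k, x]
        equals [m, x] up to an element of \<open>\<gamma>\<^sub>3(K)\<close>, while \<sigma> sends k
        to m.\<close>
      obtain p3 l3 m where m: "p3 \<in> {\<one>, x, x \<otimes> x}" "l3 \<in> H" "m \<in> H" "k = p3 \<otimes> cm x l3 \<otimes> m"
        using normal_form[OF Dx(2) xc(1)] k(3) Dx(4) by blast
      have mc: "m \<in> carrier G" "l3 \<in> carrier G" "p3 \<in> carrier G" "m \<in> K" "l3 \<in> K" "p3 \<in> K"
        using m Hc xc Dx(8) subgroup.one_closed[OF Dx(1)] subgroup.m_closed[OF Dx(1)] by auto
      define u where "u = p3 \<otimes> cm x l3"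
      have uc: "u \<in> carrier G" "u \<in> K"
        using mc xc cm_gamma2[OF xc(2) mc(5)] gamma2_sub[OF Dx(1)] subgroup.m_closed[OF Dx(1)] by (auto simp: u_def)
      have \<sigma>k: "\<sigma> k = m"
      proof -
        have s1: "\<sigma> (cm x l3) = \<one>" using \<sigma>(2)[OF xc(2) mc(5)] \<sigma>(3)[OF m(2)] \<sigma>(4) cm_one(2)[OF mc(2)] by simp
        have s0: "\<sigma> \<one> = \<one>" by (rule \<sigma>(3)[OF subgroup.one_closed[OF Dx(2)]])
        have s2: "\<sigma> p3 = \<one>" using m(1) s0 \<sigma>(4) \<sigma>(1)[OF xc(2) xc(2)] by auto
        have xl: "cm x l3 \<in> K" using cm_gamma2[OF xc(2) mc(5)] gamma2_sub[OF Dx(1)] by blast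
        have "\<sigma> u = \<one>" unfolding u_def using \<sigma>(1)[OF mc(6) xl] s1 s2 by simp
        then show ?thesis using \<sigma>(1)[OF uc(2) mc(4)] \<sigma>(3)[OF m(3)] m(4) mc(1) by (simp add: u_def)
      qed
      have "u \<otimes> x = x \<otimes> u"
      proof -
        have "p3 \<otimes> x = x \<otimes> p3" using m(1) xc by (auto simp: m_assoc)
        moreover have "cm x l3 \<otimes> x = x \<otimes> cm x l3" using cm_self_commute xc mc by blast
        ultimately show ?thesis unfolding u_def using xc mc by (metis cm_closed m_assoc)
      qed
      then have ux: "cm u x = \<one>" using cm_eq_one_iff uc xc by simp
      have "cm k x = cm u (cm m x) \<otimes> cm m x"
        using cm_mult_left[of u m x] uc mc xc ux m(4) by (simp add: u_def)
      moreover have um: "cm u (cm m x) \<in> gamma3 G K"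
      proof -
        have "cm (cm m x) u \<in> gamma3 G K" using cm_gamma3[OF cm_gamma2[OF mc(4) xc(2)] uc(2)] .
        then have "inv (cm (cm m x) u) \<in> gamma3 G K" using subgroup.m_inv_closed[OF g2(2)[OF Dx(1)]] by blast
        then show ?thesis using inv_cm mc xc uc by simp
      qed
      ultimately have "inv (cm u (cm m x)) \<otimes> (cm u (cm m x) \<otimes> cm m x) \<in> gamma3 G K"
        using kx subgroup.m_closed[OF g2(2)[OF Dx(1)]] subgroup.m_inv_closed[OF g2(2)[OF Dx(1)]] by simp
      then have "cm m x \<in> gamma3 G K" using uc mc xc by (simp add: inv_cancel)
      then have "inv (cm m x) \<in> gamma3 G K" using subgroup.m_inv_closed[OF g2(2)[OF Dx(1)]] by blast
      then have m2: "m \<in> gamma2 G H" using Dx(7)[OF m(3)] mc xc by (simp add: inv_cm)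
      \<comment> \<open>Since \<sigma> fixes e, also e = [c^-1, m]; here c^-1 is in
        \<open>Z2\<close> and m in \<open>\<gamma>\<^sub>2(H)\<close>.\<close>
      have "\<sigma> e = e" by (rule \<sigma>(3)[OF e(2)])
      moreover have "inv c \<in> H" using cH(1) subgroup.m_inv_closed[OF Dx(2)] by blast
      moreover have "inv c \<in> K" using Dx(8) calculation(2) by blast
      ultimately have "e = cm (inv c) m" using \<sigma>(2)[of "inv c" k] k(3) \<sigma>(3)[of "inv c"] \<sigma>k e2 by simp
      then show ?thesis
        using Z2_commute_gamma2(2)[OF Z2_inv_closed[OF cZ] subgroup.subset[OF Dx(2)] m2] by simp
    qed
  qed
  then show ?thesis by (auto simp: w_def)
qed

text \<open>Here w is central, so its normal closure is just the powers of w. If w were in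
  \<open>H\<close>, projecting t away would give [x, y, t] = 1; genericity of t and then of y would
  put x into \<open>\<gamma>\<^sub>2(K)\<close>, which genericity of x excludes.\<close>

lemma generic_kill_triple_commutator:
  assumes gx: "generic_in G K H x" and gy: "generic_in G L K y" and gt: "generic_in G (carrier G) L t"
    and z: "z \<in> gamma3 G H"
  shows "ncl (cm (cm x y) t \<otimes> inv z) \<inter> H \<subseteq> {\<one>}"
proof -
  note Dx = generic_inD[OF gx] and Dy = generic_inD[OF gy] and Dt = generic_inD[OF gt]
  have g3: "subgroup (gamma3 G S) G" if "subgroup S G" for S
    using gamma3_subgroup subgroup.subset[OF that] by blast
  have HL: "H \<subseteq> L" using Dx(8) Dy(8) by blast
  have c: "x \<in> carrier G" "y \<in> carrier G" "t \<in> carrier G" "x \<in> L" "y \<in> L" "x \<in> K" "x \<in> L"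
    using Dx Dy Dt by auto
  have zH: "z \<in> H" "z \<in> carrier G"
    using z gamma3_sub_gamma2[OF Dx(2)] gamma2_sub[OF Dx(2)] subgroup.mem_carrier[OF Dx(2)] by auto
  have zZ: "z \<in> Z1" using z gamma3_Z1[OF subgroup.subset[OF Dx(2)]] by blast
  obtain \<rho> where \<rho>: "\<And>u v. u \<in> carrier G \<Longrightarrow> v \<in> carrier G \<Longrightarrow> \<rho> (u \<otimes> v) = \<rho> u \<otimes> \<rho> v"
    "\<And>u v. u \<in> carrier G \<Longrightarrow> v \<in> carrier G \<Longrightarrow> \<rho> (cm u v) = cm (\<rho> u) (\<rho> v)"
    "\<And>m. m \<in> L \<Longrightarrow> \<rho> m = m" "\<rho> t = \<one>"
    by (rule generic_retraction[OF gt]) (rule that; assumption)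
  define w where "w = cm (cm x y) t \<otimes> inv z"
  have wZ: "w \<in> Z1" unfolding w_def using zZ Z2_D(1)[OF cm_in_Z2] c by blast
  have w: "w \<in> carrier G" using Z1_carrier[OF wZ] .
  have iz: "inv z \<in> L" using zH HL subgroup.m_inv_closed[OF Dt(2)] by blast
  have xyL: "cm x y \<in> L" using cm_gamma2[OF c(4,5)] gamma2_sub[OF Dt(2)] by blast
  have no: "w \<notin> H"
  proof
    assume "w \<in> H"
    then have "\<rho> w = w" using HL by (intro \<rho>(3)) blast
    moreover have "\<rho> w = inv z" unfolding w_def
      using \<rho>(1)[of "cm (cm x y) t" "inv z"] \<rho>(2)[of "cm x y" t] \<rho>(3)[OF xyL] \<rho>(3)[OF iz] \<rho>(4)
        cm_one(1)[of "cm x y"] c zH by simp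
    ultimately have "cm (cm x y) t \<otimes> inv z \<otimes> z = inv z \<otimes> z" by (simp add: w_def)
    then have "cm (cm x y) t = \<one>" using c zH by (simp add: m_assoc)
    then have "cm t (cm x y) = \<one>" using inv_cm[of "cm x y" t] c by simp
    then have "cm x y \<in> gamma3 G L" using Dt(6) xyL by blast
    then have "inv (cm x y) \<in> gamma3 G L" using subgroup.m_inv_closed[OF g3[OF Dt(2)]] by blast
    then have "x \<in> gamma2 G K" using Dy(7)[OF c(6)] c by (simp add: inv_cm)
    then show False using Dx(5) by blast
  qed
  have "e = \<one>" if e: "e \<in> ncl w" "e \<in> H" for e
  proof -
    obtain p g where p: "p \<in> {\<one>, w, w \<otimes> w}" "g \<in> carrier G" "e = p \<otimes> cm w g"
      using e(1) unfolding ncl_def by blast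
    have "e = p" using p cm_Z1(1)[OF wZ p(2)] w by auto
    moreover have "w \<otimes> w \<notin> H"
      using no inv_square[OF w] subgroup.m_inv_closed[OF Dx(2), of "inv w"] w by auto
    ultimately show ?thesis using p(1) no e(2) by blast
  qed
  then show ?thesis by (auto simp: w_def)
qed

end

section \<open>Solving one commutator equation inside an existentially closed group\<close>

lemma (in group) generate_adjoin:
  assumes "A \<subseteq> carrier G" "B \<subseteq> carrier G"
  shows "generate G (generate G A \<union> B) = generate G (A \<union> B)"
proof
  have s: "subgroup (generate G (A \<union> B)) G" using assms by (intro generate_is_subgroup) blast
  have "generate G A \<subseteq> generate G (A \<union> B)" by (rule mono_generate) blast
  moreover have "B \<subseteq> generate G (A \<union> B)" using generate.incl[of _ "A \<union> B" G] by blast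
  ultimately show "generate G (generate G A \<union> B) \<subseteq> generate G (A \<union> B)"
    by (intro generate_subgroup_incl[OF _ s]) blast
  have "A \<subseteq> generate G A" using generate.incl[of _ A G] by blast
  then show "generate G (A \<union> B) \<subseteq> generate G (generate G A \<union> B)" by (intro mono_generate) blast
qed

lemma (in group) generate_self: "subgroup S G \<Longrightarrow> generate G S = S"
  using generate_subgroup_incl[of S S] generate.incl[of _ S G] by blast

lemma generate_image_on:
  assumes "group G" "group M" "subgroup D G" "D = generate G Y" "\<psi> \<in> hom (G\<lparr>carrier := D\<rparr>) M"
  shows "\<psi> ` D = generate M (\<psi> ` Y)"
proof -
  interpret G: group G by fact
  interpret M: group M by fact
  interpret D: group "G\<lparr>carrier := D\<rparr>" using G.subgroup_imp_group[OF assms(3)] .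
  interpret \<psi>: group_hom "G\<lparr>carrier := D\<rparr>" M \<psi> using assms(5) by unfold_locales
  have Y: "Y \<subseteq> D" unfolding assms(4) using generate.incl[of _ Y G] by blast
  have "generate (G\<lparr>carrier := D\<rparr>) Y = D" using G.generate_consistent[OF Y assms(3)] assms(4) by simp
  then show ?thesis using \<psi>.generate_img[of Y] Y by simp
qed

text \<open>\<open>kill_element\<close> with the image presented as \<open>C\<close> together with
  the images of \<open>Y\<close>, the form in which generators are counted.\<close>

lemma kill_element_generators:
  fixes M :: "('a, 'b) monoid_scheme" and G :: "('c, 'd) monoid_scheme"
  assumes ec: "existentially_closed_T3 M" and h: "exponent3_embedding M G h"
    and C: "subgroup C M" "finite C" and D: "D = generate G (h ` C \<union> Y)" "Y \<subseteq> carrier G" "finite D"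
    and t: "tame G (carrier G) (h ` carrier M) (h ` C) D"
    and w: "w \<in> gamma2 G (carrier G)" "w \<in> D"
    and triv: "exponent3_group.ncl G w \<inter> h ` carrier M \<subseteq> {\<one>\<^bsub>G\<^esub>}"
  obtains \<psi> where "\<psi> \<in> hom (G\<lparr>carrier := D\<rparr>) M" "\<And>c. c \<in> C \<Longrightarrow> \<psi> (h c) = c" "\<psi> w = \<one>\<^bsub>M\<^esub>"
    "tame M (carrier M) (carrier M) C (generate M (C \<union> \<psi> ` Y))" "finite (generate M (C \<union> \<psi> ` Y))"
    "\<psi> ` D = generate M (C \<union> \<psi> ` Y)" "\<psi> ` Y \<subseteq> carrier M"
proof -
  interpret h: exponent3_embedding M G h by fact
  have "h ` C \<union> Y \<subseteq> carrier G" using subgroup.subset[OF C(1)] D(2) by auto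
  then have Ds: "subgroup D G" unfolding D(1) by (rule h.B.generate_is_subgroup)
  have sub: "h ` C \<subseteq> D" "Y \<subseteq> D" unfolding D(1) using generate.incl[of _ "h ` C \<union> Y" G] by blast+
  obtain \<psi> where \<psi>: "\<psi> \<in> hom (G\<lparr>carrier := D\<rparr>) M" "\<And>c. c \<in> C \<Longrightarrow> \<psi> (h c) = c" "\<psi> w = \<one>\<^bsub>M\<^esub>"
    "tame M (carrier M) (carrier M) C (\<psi> ` D)"
    by (rule kill_element[OF ec h C Ds D(3) sub(1) t w triv]) (rule that; assumption)
  have "\<psi> ` (h ` C \<union> Y) = C \<union> \<psi> ` Y" using \<psi>(2) by (force simp: image_Un image_image)
  then have e: "\<psi> ` D = generate M (C \<union> \<psi> ` Y)"
    using generate_image_on[OF h.B.is_group h.A.is_group Ds D(1) \<psi>(1)] by simp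
  moreover have "\<psi> ` Y \<subseteq> carrier M" using \<psi>(1) sub(2) by (auto simp: hom_def)
  ultimately show thesis using that \<psi> D(3) by (metis finite_imageI)
qed

text \<open>Killing w = [x, y] c^-1 over two generic elements makes c the commutator of the images
  of x and y. This accounts for the 2 generators.\<close>

lemma adjoin_commutator:
  assumes ec: "existentially_closed_T3 M" and C: "subgroup C M" "finite C"
    and c: "c \<in> C" "c \<in> gamma2 M (carrier M)"
  shows "\<exists>Y\<subseteq>carrier M. finite Y \<and> card Y \<le> 2 \<and> finite (generate M (C \<union> Y)) \<and>
    tame M (carrier M) (carrier M) C (generate M (C \<union> Y)) \<and> c \<in> gamma2 M (generate M (C \<union> Y))"
proof -
  have M: "exponent3_group M" using ec by (simp add: existentially_closed_T3_def model_T3_iff)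
  obtain N :: "'a generic generic monoid" and h K x y
    where h: "exponent3_embedding M N h" and gx: "generic_in N K (h ` carrier M) x"
      and gy: "generic_in N (carrier N) K y"
    by (rule generic_exists2[OF M]) (rule that; assumption)
  interpret h: exponent3_embedding M N h by fact
  note Dx = h.B.generic_inD[OF gx] and Dy = h.B.generic_inD[OF gy]
  have hC: "subgroup (h ` C) N" "h ` C \<subseteq> h ` carrier M" "finite (h ` C)" "h ` C \<subseteq> carrier N"
    using h.f.subgroup_img_is_subgroup[OF C(1)] subgroup.subset[OF C(1)] C(2) by auto
  define D0 where "D0 = generate N (h ` C \<union> {x})"
  define D where "D = generate N (h ` C \<union> {x, y})"
  have xy: "x \<in> carrier N" "y \<in> carrier N" using Dx Dy by auto
  have D: "D = generate N (D0 \<union> {y})"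
    unfolding D_def D0_def using h.B.generate_adjoin[of "h ` C \<union> {x}" "{y}"] hC(4) xy by (simp add: insert_commute)
  have D0: "subgroup D0 N" unfolding D0_def using hC(4) xy by (intro h.B.generate_is_subgroup) auto
  have D0K: "D0 \<subseteq> K" unfolding D0_def
    using hC(2) Dx(8,9) by (intro h.B.generate_subgroup_incl[OF _ Dx(1)]) blast
  have fD0: "finite D0" unfolding D0_def using h.B.finite_adjoin[OF hC(1,3) xy(1)] .
  have fD: "finite D" unfolding D using h.B.finite_adjoin[OF D0 fD0 xy(2)] .
  have Dc: "D \<subseteq> carrier N" unfolding D_def using hC(4) xy by (intro h.B.generate_incl) auto
  have t: "tame N (carrier N) (h ` carrier M) (h ` C) D"
  proof (rule h.B.tame_trans)
    show "tame N K (h ` carrier M) (h ` C) D0" unfolding D0_def by (rule h.B.generic_tame[OF gx hC(1,2)])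
    show "tame N (carrier N) K D0 D" unfolding D by (rule h.B.generic_tame[OF gy D0 D0K])
    show "h ` C \<subseteq> D0" unfolding D0_def using generate.incl[of _ "h ` C \<union> {x}" N] by blast
    show "D0 \<subseteq> D" unfolding D using generate.incl[of _ "D0 \<union> {y}" N] by blast
  qed fact
  have cc: "h c \<in> gamma2 N (h ` carrier M)" "c \<in> carrier M" "h c \<in> D"
  proof -
    show "c \<in> carrier M" using c(1) subgroup.mem_carrier[OF C(1)] by blast
    then show "h c \<in> gamma2 N (h ` carrier M)" using h.f_gamma2_mem[OF subset_refl] c(2) by blast
    show "h c \<in> D" unfolding D_def using c(1) by (intro generate.incl) blast
  qed
  have xyD: "x \<in> D" "y \<in> D" unfolding D_def using generate.incl[of _ "h ` C \<union> {x, y}" N] by blast+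
  define w where "w = commutator N x y \<otimes>\<^bsub>N\<^esub> inv\<^bsub>N\<^esub> (h c)"
  have Ds: "subgroup D N" unfolding D_def using hC(4) xy by (intro h.B.generate_is_subgroup) auto
  have xyD2: "commutator N x y \<in> D" using h.B.cm_gamma2[OF xyD] h.B.gamma2_sub[OF Ds] by blast
  have wD: "w \<in> D" unfolding w_def
    using xyD2 cc(3) subgroup.m_closed[OF Ds] subgroup.m_inv_closed[OF Ds] by blast
  have g2: "subgroup (gamma2 N (carrier N)) N" by (rule h.B.gamma2_subgroup) (rule subset_refl)
  have hcarr: "h ` carrier M \<subseteq> carrier N" by auto
  have wg: "w \<in> gamma2 N (carrier N)" unfolding w_def
    using h.B.cm_gamma2[OF xy] cc(1) h.B.gamma2_mono[OF hcarr] subgroup.m_closed[OF g2] subgroup.m_inv_closed[OF g2]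
    by blast
  obtain \<psi> where \<psi>: "\<psi> \<in> hom (N\<lparr>carrier := D\<rparr>) M" "\<And>c. c \<in> C \<Longrightarrow> \<psi> (h c) = c" "\<psi> w = \<one>\<^bsub>M\<^esub>"
    "tame M (carrier M) (carrier M) C (generate M (C \<union> \<psi> ` {x, y}))" "finite (generate M (C \<union> \<psi> ` {x, y}))"
    "\<psi> ` D = generate M (C \<union> \<psi> ` {x, y})" "\<psi> ` {x, y} \<subseteq> carrier M"
  proof (rule kill_element_generators[OF ec h C D_def _ fD t wg wD])
    show "h.B.ncl w \<inter> h ` carrier M \<subseteq> {\<one>\<^bsub>N\<^esub>}"
      unfolding w_def by (rule h.B.generic_kill_commutator[OF gx gy cc(1)])
    show "{x, y} \<subseteq> carrier N" using xy by simp
  qed (rule that; assumption)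
  interpret ND: group "N\<lparr>carrier := D\<rparr>" using h.B.subgroup_imp_group[OF Ds] .
  interpret \<psi>: group_hom "N\<lparr>carrier := D\<rparr>" M \<psi> using \<psi>(1) by unfold_locales
  have "\<psi> (commutator N x y) = commutator M (\<psi> x) (\<psi> y)"
    using \<psi>.hom_commutator[of x y] xyD h.B.commutator_consistent[OF Ds] by simp
  moreover have "commutator N x y = w \<otimes>\<^bsub>N\<^esub> h c"
    using xy cc(2) by (simp add: w_def h.B.m_assoc)
  ultimately have "c = commutator M (\<psi> x) (\<psi> y)"
    using \<psi>.hom_mult[of w "h c"] wD cc \<psi>(2)[OF c(1)] \<psi>(3) by simp
  moreover have "\<psi> x \<in> generate M (C \<union> \<psi> ` {x, y})" "\<psi> y \<in> generate M (C \<union> \<psi> ` {x, y})"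
    by (auto intro: generate.incl)
  ultimately have "c \<in> gamma2 M (generate M (C \<union> \<psi> ` {x, y}))" using h.A.cm_gamma2 by metis
  moreover have "card (\<psi> ` {x, y}) \<le> 2" by (rule order_trans[OF card_image_le]) (auto simp: card_insert_if)
  ultimately show ?thesis using \<psi>(4,5,7) by (intro exI[of _ "\<psi> ` {x, y}"]) auto
qed

text \<open>The same with a tower of three generic elements and w = [x, y, t] z^-1, at the price of
  3 generators.\<close>

lemma adjoin_triple_commutator:
  assumes ec: "existentially_closed_T3 M" and C: "subgroup C M" "finite C"
    and z: "z \<in> C" "z \<in> gamma3 M (carrier M)"
  shows "\<exists>Y\<subseteq>carrier M. finite Y \<and> card Y \<le> 3 \<and> finite (generate M (C \<union> Y)) \<and>
    tame M (carrier M) (carrier M) C (generate M (C \<union> Y)) \<and> z \<in> gamma3 M (generate M (C \<union> Y))"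
proof -
  have M: "exponent3_group M" using ec by (simp add: existentially_closed_T3_def model_T3_iff)
  obtain N :: "'a generic generic generic monoid" and h K L x y t
    where h: "exponent3_embedding M N h" and gx: "generic_in N K (h ` carrier M) x"
      and gy: "generic_in N L K y" and gt: "generic_in N (carrier N) L t"
    by (rule generic_exists3[OF M]) (rule that; assumption)
  interpret h: exponent3_embedding M N h by fact
  note Dx = h.B.generic_inD[OF gx] and Dy = h.B.generic_inD[OF gy] and Dt = h.B.generic_inD[OF gt]
  have hC: "subgroup (h ` C) N" "h ` C \<subseteq> h ` carrier M" "finite (h ` C)" "h ` C \<subseteq> carrier N"
    using h.f.subgroup_img_is_subgroup[OF C(1)] subgroup.subset[OF C(1)] C(2) by auto
  define D0 where "D0 = generate N (h ` C \<union> {x})"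
  define D1 where "D1 = generate N (D0 \<union> {y})"
  define D where "D = generate N (h ` C \<union> {x, y, t})"
  have xy: "x \<in> carrier N" "y \<in> carrier N" "t \<in> carrier N" using Dx Dy Dt by auto
  have D0: "subgroup D0 N" unfolding D0_def using hC(4) xy by (intro h.B.generate_is_subgroup) auto
  have D0c: "D0 \<subseteq> carrier N" using subgroup.subset[OF D0] .
  have D1: "subgroup D1 N" unfolding D1_def using D0c xy by (intro h.B.generate_is_subgroup) auto
  have D1': "D1 = generate N (h ` C \<union> {x} \<union> {y})"
    unfolding D1_def D0_def using hC(4) xy by (intro h.B.generate_adjoin) auto
  have D: "D = generate N (D1 \<union> {t})"
    unfolding D_def D1' using h.B.generate_adjoin[of "h ` C \<union> {x} \<union> {y}" "{t}"] hC(4) xy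
    by (simp add: insert_commute)
  have D0K: "D0 \<subseteq> K" unfolding D0_def
    using hC(2) Dx(8,9) by (intro h.B.generate_subgroup_incl[OF _ Dx(1)]) blast
  have D1L: "D1 \<subseteq> L" unfolding D1_def
    using D0K Dy(8,9) by (intro h.B.generate_subgroup_incl[OF _ Dy(1)]) blast
  have fD0: "finite D0" unfolding D0_def using h.B.finite_adjoin[OF hC(1,3) xy(1)] .
  have fD1: "finite D1" unfolding D1_def using h.B.finite_adjoin[OF D0 fD0 xy(2)] .
  have fD: "finite D" unfolding D using h.B.finite_adjoin[OF D1 fD1 xy(3)] .
  have sub0: "h ` C \<subseteq> D0" unfolding D0_def using generate.incl[of _ "h ` C \<union> {x}" N] by blast
  have sub1: "D0 \<subseteq> D1" unfolding D1_def using generate.incl[of _ "D0 \<union> {y}" N] by blast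
  have sub2: "D1 \<subseteq> D" unfolding D using generate.incl[of _ "D1 \<union> {t}" N] by blast
  note sub = sub0 sub1 sub2
  have Dc: "D \<subseteq> carrier N" unfolding D_def using hC(4) xy by (intro h.B.generate_incl) auto
  have t1: "tame N L (h ` carrier M) (h ` C) D1"
  proof (rule h.B.tame_trans)
    show "tame N K (h ` carrier M) (h ` C) D0" unfolding D0_def by (rule h.B.generic_tame[OF gx hC(1,2)])
    show "tame N L K D0 D1" unfolding D1_def by (rule h.B.generic_tame[OF gy D0 D0K])
  qed (rule sub0 sub1 subgroup.subset[OF D1])+
  have t: "tame N (carrier N) (h ` carrier M) (h ` C) D"
  proof (rule h.B.tame_trans[OF t1])
    show "tame N (carrier N) L D1 D" unfolding D by (rule h.B.generic_tame[OF gt D1 D1L])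
    show "h ` C \<subseteq> D1" by (rule order_trans[OF sub0 sub1])
  qed (rule sub2 Dc)+
  have zz: "h z \<in> gamma3 N (h ` carrier M)" "z \<in> carrier M" "h z \<in> D"
  proof -
    show "z \<in> carrier M" using z(1) subgroup.mem_carrier[OF C(1)] by blast
    then show "h z \<in> gamma3 N (h ` carrier M)" using h.f_gamma3_mem[OF subset_refl] z(2) by blast
    show "h z \<in> D" unfolding D_def using z(1) by (intro generate.incl) blast
  qed
  have xyD: "x \<in> D" "y \<in> D" "t \<in> D"
    unfolding D_def using generate.incl[of _ "h ` C \<union> {x, y, t}" N] by blast+
  let ?k = "commutator N (commutator N x y) t"
  define w where "w = ?k \<otimes>\<^bsub>N\<^esub> inv\<^bsub>N\<^esub> (h z)"
  have Ds: "subgroup D N" unfolding D_def using hC(4) xy by (intro h.B.generate_is_subgroup) auto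
  have cD: "commutator N u v \<in> D" if "u \<in> D" "v \<in> D" for u v
    using h.B.cm_gamma2[OF that] h.B.gamma2_sub[OF Ds] by blast
  have wD: "w \<in> D" unfolding w_def
    by (rule subgroup.m_closed[OF Ds cD[OF cD[OF xyD(1,2)] xyD(3)] subgroup.m_inv_closed[OF Ds zz(3)]])
  have g3: "subgroup (gamma3 N (carrier N)) N" by (rule h.B.gamma3_subgroup) (rule subset_refl)
  have hcarr: "h ` carrier M \<subseteq> carrier N" by auto
  have k3: "?k \<in> gamma3 N (carrier N)" by (rule h.B.cm_gamma3[OF h.B.cm_gamma2[OF xy(1,2)] xy(3)])
  have z3: "h z \<in> gamma3 N (carrier N)" using zz(1) h.B.gamma3_mono[OF hcarr] by blast
  have "w \<in> gamma3 N (carrier N)"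
    unfolding w_def by (rule subgroup.m_closed[OF g3 k3 subgroup.m_inv_closed[OF g3 z3]])
  then have wg: "w \<in> gamma2 N (carrier N)" using h.B.gamma3_sub_gamma2[OF h.B.subgroup_self] by blast
  obtain \<psi> where \<psi>: "\<psi> \<in> hom (N\<lparr>carrier := D\<rparr>) M" "\<And>c. c \<in> C \<Longrightarrow> \<psi> (h c) = c" "\<psi> w = \<one>\<^bsub>M\<^esub>"
    "tame M (carrier M) (carrier M) C (generate M (C \<union> \<psi> ` {x, y, t}))" "finite (generate M (C \<union> \<psi> ` {x, y, t}))"
    "\<psi> ` D = generate M (C \<union> \<psi> ` {x, y, t})" "\<psi> ` {x, y, t} \<subseteq> carrier M"
  proof (rule kill_element_generators[OF ec h C D_def _ fD t wg wD])
    show "h.B.ncl w \<inter> h ` carrier M \<subseteq> {\<one>\<^bsub>N\<^esub>}"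
      unfolding w_def by (rule h.B.generic_kill_triple_commutator[OF gx gy gt zz(1)])
    show "{x, y, t} \<subseteq> carrier N" using xy by simp
  qed (rule that; assumption)
  interpret ND: group "N\<lparr>carrier := D\<rparr>" using h.B.subgroup_imp_group[OF Ds] .
  interpret \<psi>: group_hom "N\<lparr>carrier := D\<rparr>" M \<psi> using \<psi>(1) by unfold_locales
  have \<psi>c: "\<psi> (commutator N u v) = commutator M (\<psi> u) (\<psi> v)" if "u \<in> D" "v \<in> D" for u v
    using \<psi>.hom_commutator[of u v] that h.B.commutator_consistent[OF Ds] by simp
  have "?k = w \<otimes>\<^bsub>N\<^esub> h z"
    using xy zz(2) by (simp add: w_def h.B.m_assoc)
  then have "z = commutator M (commutator M (\<psi> x) (\<psi> y)) (\<psi> t)"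
    using \<psi>.hom_mult[of w "h z"] wD zz \<psi>(2)[OF z(1)] \<psi>(3) \<psi>c[OF cD[OF xyD(1,2)] xyD(3)] \<psi>c[OF xyD(1,2)] by simp
  moreover have "\<psi> x \<in> generate M (C \<union> \<psi> ` {x, y, t})" "\<psi> y \<in> generate M (C \<union> \<psi> ` {x, y, t})"
    "\<psi> t \<in> generate M (C \<union> \<psi> ` {x, y, t})"
    by (auto intro: generate.incl)
  ultimately have "z \<in> gamma3 M (generate M (C \<union> \<psi> ` {x, y, t}))"
    using h.A.cm_gamma3 h.A.cm_gamma2 by metis
  moreover have "card (\<psi> ` {x, y, t}) \<le> 3" by (rule order_trans[OF card_image_le]) (auto simp: card_insert_if)
  ultimately show ?thesis using \<psi>(4,5,7) by (intro exI[of _ "\<psi> ` {x, y, t}"]) auto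
qed

section \<open>Making the central series coincide\<close>

text \<open>Equivalently, the centre of D/\<open>\<gamma>\<^sub>3(D)\<close> is no larger than
  \<open>\<gamma>\<^sub>2(D)\<close>/\<open>\<gamma>\<^sub>3(D)\<close>. It is what the last generic
  element requires of its base.\<close>

definition separated :: "('a, 'b) monoid_scheme \<Rightarrow> 'a set \<Rightarrow> bool"
  where "separated G D \<longleftrightarrow>
    (\<forall>d\<in>D. (\<forall>g\<in>D. commutator G d g \<in> gamma3 G D) \<longrightarrow> d \<in> gamma2 G D)"

text \<open>The opposite inclusions hold in class 3, so for a subgroup this is the coincidence of
  its two central series.\<close>

definition balanced :: "('a, 'b) monoid_scheme \<Rightarrow> 'a set \<Rightarrow> bool"
  where "balanced G D \<longleftrightarrow> centre G D \<subseteq> gamma3 G D \<and> centre2 G D \<subseteq> gamma2 G D"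

context exponent3_embedding
begin

lemma centre_image:
  assumes "S \<subseteq> carrier A"
  shows "centre B (f ` S) = f ` centre A S"
proof -
  have "commutator B (f u) (f v) = \<one>\<^bsub>B\<^esub> \<longleftrightarrow> commutator A u v = \<one>\<^bsub>A\<^esub>" if "u \<in> S" "v \<in> S" for u v
  proof -
    have c: "u \<in> carrier A" "v \<in> carrier A" using that assms by auto
    have "commutator B (f u) (f v) = f (commutator A u v)" using f_cm c by simp
    moreover have "f (commutator A u v) = \<one>\<^bsub>B\<^esub> \<longleftrightarrow> commutator A u v = \<one>\<^bsub>A\<^esub>"
      using inj_onD[OF f_inj, of "commutator A u v" "\<one>\<^bsub>A\<^esub>"] c by auto
    ultimately show ?thesis by simp
  qed
  then show ?thesis unfolding centre_def by auto
qed

lemma centre2_image: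
  assumes "S \<subseteq> carrier A"
  shows "centre2 B (f ` S) = f ` centre2 A S"
proof -
  have Z: "centre A S \<subseteq> carrier A" using assms unfolding centre_def by blast
  have "commutator B (f u) (f v) \<in> centre B (f ` S) \<longleftrightarrow> commutator A u v \<in> centre A S" if "u \<in> S" "v \<in> S" for u v
  proof -
    have c: "u \<in> carrier A" "v \<in> carrier A" using that assms by auto
    then have "commutator B (f u) (f v) = f (commutator A u v)" using f_cm by simp
    then show ?thesis using f_mem[OF Z, of "commutator A u v"] centre_image[OF assms] c by simp
  qed
  then show ?thesis unfolding centre2_def by auto
qed

lemma image_subset_iff: "S \<subseteq> carrier A \<Longrightarrow> T \<subseteq> carrier A \<Longrightarrow> f ` S \<subseteq> f ` T \<longleftrightarrow> S \<subseteq> T"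
  using f_mem by blast

lemma balanced_image: "S \<subseteq> carrier A \<Longrightarrow> balanced B (f ` S) \<longleftrightarrow> balanced A S"
proof -
  assume S: "S \<subseteq> carrier A"
  have "centre A S \<subseteq> carrier A" "centre2 A S \<subseteq> carrier A" using S unfolding centre_def centre2_def by blast+
  then show ?thesis unfolding balanced_def
    using f_inj S by (simp add: centre_image centre2_image f.gamma2_image f.gamma3_image
        image_subset_iff gamma2_carrier gamma3_carrier)
qed

lemma separated_image:
  assumes S: "S \<subseteq> carrier A"
  shows "separated B (f ` S) \<longleftrightarrow> separated A S"
proof -
  have c: "commutator B (f u) (f v) \<in> gamma3 B (f ` S) \<longleftrightarrow> commutator A u v \<in> gamma3 A S" if "u \<in> S" "v \<in> S" for u v
  proof -
    have c: "u \<in> carrier A" "v \<in> carrier A" using that assms by auto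
    then have "commutator B (f u) (f v) = f (commutator A u v)" using f_cm by simp
    then show ?thesis using f_gamma3_mem[OF S, of "commutator A u v"] c by simp
  qed
  have "f u \<in> gamma2 B (f ` S) \<longleftrightarrow> u \<in> gamma2 A S" if "u \<in> S" for u
    using f_gamma2_mem[OF S] that S by blast
  then show ?thesis using c unfolding separated_def by simp
qed

end

context exponent3_group
begin

lemma inclusion_embedding:
  assumes "subgroup D G"
  shows "exponent3_embedding (G\<lparr>carrier := D\<rparr>) G id"
proof -
  interpret D: exponent3_group "G\<lparr>carrier := D\<rparr>" by (rule subgroup_exponent3[OF assms])
  show ?thesis by unfold_locales (use subgroup.subset[OF assms] in \<open>auto simp: hom_def\<close>)
qed

text \<open>A nilpotent group inside its derived subgroup is trivial. Here one step suffices: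
  \<open>\<gamma>\<^sub>2(C)\<close> lies in \<open>Z2\<close>, which centralises
  \<open>\<gamma>\<^sub>2(C)\<close>, so \<open>C\<close> is abelian.\<close>

lemma gamma2_eq_self:
  assumes "subgroup C G" "C \<subseteq> gamma2 G C"
  shows "C = {\<one>}"
proof -
  note c = subgroup.subset[OF assms(1)]
  have "subgroup {\<one>} G" by (rule subgroupI_mult) auto
  moreover have "cm x y \<in> {\<one>}" if "x \<in> C" "y \<in> C" for x y
    using Z2_commute_gamma2(2)[OF _ c, of x y] gamma2_Z2[OF c] that assms(2) by blast
  ultimately have "gamma2 G C \<subseteq> {\<one>}"
    unfolding gamma2_def by (rule commutator_subgroup_incl)
  then show ?thesis using assms(2) subgroup.one_closed[OF assms(1)] by blast
qed

text \<open>Write d = p [a, l] c. Testing d against a pins c down, and testing it against a suitable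
  element of \<open>C\<close> kills the power p of a. A central d still keeps its factor [a, l], and
  testing against \<open>C\<close> shows only that l is central modulo
  \<open>\<gamma>\<^sub>3(C)\<close>; this is where \<open>C\<close> itself has to be
  separated.\<close>

lemma generic_separated:
  assumes g: "generic_in G K H a" and C: "subgroup C G" "C \<subseteq> H" "C \<noteq> {\<one>}"
    and lcs: "C \<inter> gamma2 G H \<subseteq> gamma2 G C" "C \<inter> gamma3 G H \<subseteq> gamma3 G C"
  shows "separated G (generate G (C \<union> {a}))"
    and "separated G C \<Longrightarrow> balanced G (generate G (C \<union> {a}))"
proof -
  note D = generic_inD[OF g]
  define E where "E = generate G (C \<union> {a})"
  have Cc: "C \<subseteq> carrier G" using subgroup.subset[OF C(1)] .
  have ca: "C \<union> {a} \<subseteq> carrier G" using Cc D(3) by blast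
  have E: "subgroup E G" unfolding E_def by (rule generate_is_subgroup[OF ca])
  have CE: "C \<subseteq> E" "a \<in> E" unfolding E_def using generate.incl[of _ "C \<union> {a}" G] by blast+
  have EK: "E \<subseteq> K" unfolding E_def using C(2) D(8,9) by (intro generate_subgroup_incl[OF _ D(1)]) blast
  have Ec: "E \<subseteq> carrier G" using subgroup.subset[OF E] .
  have g2: "subgroup (gamma2 G S) G" "subgroup (gamma3 G S) G" if "S \<subseteq> carrier G" for S
    using gamma2_subgroup[OF that] gamma3_subgroup[OF that] .
  have Kc: "K \<subseteq> carrier G" using subgroup.subset[OF D(1)] .
  note g3K = g2(2)[OF Kc]
  have inv3: "cm u v \<in> gamma3 G K \<Longrightarrow> cm v u \<in> gamma3 G K" if "u \<in> carrier G" "v \<in> carrier G" for u v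
    using subgroup.m_inv_closed[OF g3K, of "cm u v"] inv_cm[OF that] by simp
  \<comment> \<open>Otherwise \<open>C\<close> would lie in its own derived subgroup; the assumption
    C \<noteq> {\<one>} enters here.\<close>
  have aH: "\<exists>c\<in>C. cm a c \<notin> gamma3 G K"
  proof (rule ccontr)
    assume "\<not> ?thesis"
    then have "C \<subseteq> gamma2 G H" using D(7) C(2) by blast
    then have "C \<subseteq> gamma2 G C" using lcs by blast
    then show False using gamma2_eq_self C by blast
  qed
  have nf: "\<exists>p\<in>{\<one>, a, a \<otimes> a}. \<exists>l\<in>C. \<exists>c\<in>C. d = p \<otimes> cm a l \<otimes> c \<and>
    (d \<in> gamma2 G K \<longrightarrow> p = \<one> \<and> c \<in> gamma2 G H)" if "d \<in> E" for d
    using generic_normal_form[OF g C(1,2)] that unfolding E_def by blast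
  \<comment> \<open>u = p [a, l] commutes with a, so [d, a] is [c, a] up to a triple
    commutator.\<close>
  have da: "cm d a = cm u (cm c a) \<otimes> cm c a"
    if "p \<in> {\<one>, a, a \<otimes> a}" "l \<in> C" "c \<in> C" "u = p \<otimes> cm a l" "d = u \<otimes> c" for d p l c u
  proof -
    have cc: "l \<in> carrier G" "c \<in> carrier G" "p \<in> carrier G" using that Cc D(3) by auto
    have uc: "u \<in> carrier G" using that(4) cc D(3) by simp
    have "p \<otimes> a = a \<otimes> p" using that(1) D(3) by (auto simp: m_assoc)
    moreover have "cm a l \<otimes> a = a \<otimes> cm a l" using cm_self_commute cc D(3) by blast
    ultimately have "u \<otimes> a = a \<otimes> u" unfolding that(4) using cc D(3) by (metis cm_closed m_assoc)
    then have "cm u a = \<one>" using cm_eq_one_iff uc D(3) by simp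
    then show ?thesis unfolding that(5) using cm_mult_left[OF uc cc(2) D(3)] uc cc D(3) by simp
  qed
  show sep: "separated G (generate G (C \<union> {a}))"
    unfolding separated_def E_def[symmetric]
  proof (intro ballI impI)
    fix d assume d: "d \<in> E" and dE: "\<forall>g\<in>E. cm d g \<in> gamma3 G E"
    have dK: "cm d k \<in> gamma3 G K" if "k \<in> E" for k using dE that gamma3_mono[OF EK] by blast
    obtain p l c where e: "p \<in> {\<one>, a, a \<otimes> a}" "l \<in> C" "c \<in> C" "d = p \<otimes> cm a l \<otimes> c" using nf[OF d] by blast
    have cc: "l \<in> carrier G" "c \<in> carrier G" "p \<in> carrier G" using e Cc D(3) by auto
    define u where "u = p \<otimes> cm a l"
    have pE: "p \<in> E" using e(1) CE(2) subgroup.one_closed[OF E] subgroup.m_closed[OF E] by blast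
    have alE: "cm a l \<in> gamma2 G E" using cm_gamma2 CE e(2) by blast
    have uE: "u \<in> E" unfolding u_def
      by (rule subgroup.m_closed[OF E pE]) (use alE gamma2_sub[OF E] in blast)
    have uc: "u \<in> carrier G" using uE Ec by blast
    have "cm (cm c a) u \<in> gamma3 G K"
      using cm_gamma3[OF cm_gamma2, of c K a u] e(3) uE C(2) D(8,9) EK by blast
    then have 1: "cm u (cm c a) \<in> gamma3 G K" using inv3 uc cc D(3) by simp
    have "cm d a = cm u (cm c a) \<otimes> cm c a" by (rule da[OF e(1-3) u_def]) (simp add: e(4) u_def)
    then have ca: "inv (cm u (cm c a)) \<otimes> cm d a = cm c a" using uc cc D(3) by (simp add: inv_cancel)
    have "inv (cm u (cm c a)) \<otimes> cm d a \<in> gamma3 G K"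
      using 1 dK[OF CE(2)] subgroup.m_closed[OF g3K] subgroup.m_inv_closed[OF g3K] by blast
    then have "cm c a \<in> gamma3 G K" by (simp only: ca)
    then have "cm a c \<in> gamma3 G K" using inv3 cc D(3) by blast
    then have "c \<in> gamma2 G C" using D(7)[of c] e(3) C(2) lcs(1) by blast
    then have cE: "c \<in> gamma2 G E" using gamma2_mono[OF CE(1)] by blast
    define b where "b = cm a l \<otimes> c"
    have bE: "b \<in> gamma2 G E" unfolding b_def using alE cE subgroup.m_closed[OF g2(1)[OF Ec]] by blast
    have bZ: "b \<in> Z2" using bE gamma2_Z2[OF Ec] by blast
    note bc = Z2_carrier[OF bZ]
    have db: "d = p \<otimes> b" using cc D(3) by (simp add: e(4) b_def m_assoc)
    \<comment> \<open>This c' detects p: for p = a or p = a^2 the commutator [p, c'] is [a, c'] or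
      its inverse, neither of which is in \<open>\<gamma>\<^sub>3(K)\<close>.\<close>
    obtain c' where c': "c' \<in> C" "cm a c' \<notin> gamma3 G K" using aH by blast
    have cc': "c' \<in> carrier G" "c' \<in> E" using c'(1) Cc CE by auto
    have "cm d c' = cm b c' \<otimes> cm p c'" unfolding db using Z2_mult_left(2)[OF bZ cc(3) cc'(1)] .
    then have "cm p c' = inv (cm b c') \<otimes> cm d c'" using bc cc cc' by (simp add: inv_cancel)
    moreover have "cm b c' \<in> gamma3 G K" using cm_gamma3[OF bE cc'(2)] gamma3_mono[OF EK] by blast
    ultimately have pc: "cm p c' \<in> gamma3 G K"
      using dK[OF cc'(2)] subgroup.m_closed[OF g3K] subgroup.m_inv_closed[OF g3K] by simp
    have "p = \<one>"
    proof -
      have "p \<noteq> a" using pc c'(2) by blast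
      moreover have "p \<noteq> a \<otimes> a"
      proof
        assume "p = a \<otimes> a"
        then have "cm p c' = cm a (cm a c') \<otimes> cm a c' \<otimes> cm a c'" using cm_mult_left D(3) cc' by simp
        also have "cm a (cm a c') = \<one>" using cm_cm_same D(3) cc' by blast
        finally have "cm p c' = inv (cm a c')" using D(3) cc' inv_square[of "cm a c'"] by simp
        then have "cm a c' = inv (cm p c')" using D(3) cc' by simp
        then show False using pc c'(2) subgroup.m_inv_closed[OF g3K] by metis
      qed
      ultimately show ?thesis using e(1) by blast
    qed
    then show "d \<in> gamma2 G E" using db bE bc by simp
  qed
  show "balanced G (generate G (C \<union> {a}))" if sC: "separated G C"
  proof -
    have one3: "\<one> \<in> gamma3 G E" using subgroup.one_closed[OF g2(2)[OF Ec]] .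
    have Z: "centre G E \<subseteq> gamma3 G E"
    proof
      fix d assume d: "d \<in> centre G E"
      then have dE: "d \<in> E" and d1: "\<And>k. k \<in> E \<Longrightarrow> cm d k = \<one>" unfolding centre_def by auto
      have "d \<in> gamma2 G E" using sep d1 dE one3 unfolding separated_def E_def[symmetric] by simp
      then have dK: "d \<in> gamma2 G K" by (rule subsetD[OF gamma2_mono[OF EK]])
      obtain p l c where plc: "l \<in> C" "c \<in> C" "d = p \<otimes> cm a l \<otimes> c"
        "d \<in> gamma2 G K \<longrightarrow> p = \<one> \<and> c \<in> gamma2 G H"
        using nf[OF dE] by (elim bexE conjE) (rule that; assumption)
      have p1: "p = \<one>" "c \<in> gamma2 G H" using plc(4) dK by simp_all
      note e = plc(1,2) plc(3)[unfolded p1(1)] p1(2)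
      have cc: "l \<in> carrier G" "c \<in> carrier G" using e Cc by auto
      have cZ: "c \<in> Z2" using e(4) gamma2_Z2[OF subgroup.subset[OF D(2)]] by blast
      have "cm d a = cm (\<one> \<otimes> cm a l) (cm c a) \<otimes> cm c a" by (rule da[OF _ e(1,2) refl e(3)]) simp
      also have "cm (\<one> \<otimes> cm a l) (cm c a) = \<one>"
        using cm_Z1(2)[OF Z2_D(1)[OF cZ D(3)], of "\<one> \<otimes> cm a l"] cc D(3) by simp
      finally have "cm d a = cm c a" using cc D(3) by simp
      then have "cm c a = \<one>" unfolding d1[OF CE(2)] by (rule sym)
      then have "cm a c = \<one>" using inv_cm[of c a] cc D(3) by simp
      then have c3: "c \<in> gamma3 G C" using D(6)[of c] e(2) C(2) lcs(2) by blast
      have cZ1: "c \<in> Z1" using c3 gamma3_Z1[OF Cc] by blast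
      have dl: "d = cm a l \<otimes> c" using e(3) cc D(3) by simp
      \<comment> \<open>Centrality of d gives [a, l, c'] = 1, as c is central. Cycling makes [l, c']
        commute with a, and genericity applies to [l, c'].\<close>
      have "cm l c' \<in> gamma3 G C" if c': "c' \<in> C" for c'
      proof -
        have cc': "c' \<in> carrier G" "c' \<in> E" using c' Cc CE by auto
        have "cm d c' = cm (cm a l) c' \<otimes> cm c c'"
          using Z2_mult_left(1)[of "cm a l" c c'] cc cc' D(3) unfolding dl by simp
        then have "cm d c' = cm (cm a l) c'" using cm_Z1(1)[OF cZ1 cc'(1)] cc cc' D(3) by simp
        then have "cm (cm a l) c' = \<one>" unfolding d1[OF cc'(2)] by (rule sym)
        then have "cm (cm l c') a = \<one>" using trilinear_cyc[OF D(3) cc(1) cc'(1)] by simp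
        then have "cm a (cm l c') = \<one>" using inv_cm[of "cm l c'" a] cc cc' D(3) by simp
        moreover have "cm l c' \<in> C" using cm_gamma2[OF e(1) c'] gamma2_sub[OF C(1)] by blast
        ultimately show ?thesis using D(6)[of "cm l c'"] C(2) lcs(2) by blast
      qed
      then have "l \<in> gamma2 G C" using sC e(1) unfolding separated_def by blast
      then have "l \<in> gamma2 G E" using gamma2_mono[OF CE(1)] by blast
      then have "inv (cm l a) \<in> gamma3 G E" using cm_gamma3 CE(2) subgroup.m_inv_closed[OF g2(2)[OF Ec]] by blast
      then have "cm a l \<in> gamma3 G E" using cc D(3) by (simp add: inv_cm)
      moreover have "c \<in> gamma3 G E" using c3 gamma3_mono[OF CE(1)] by blast
      ultimately show "d \<in> gamma3 G E" unfolding dl using subgroup.m_closed[OF g2(2)[OF Ec]] by blast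
    qed
    moreover have "centre2 G E \<subseteq> gamma2 G E"
    proof
      fix d assume d: "d \<in> centre2 G E"
      then have "d \<in> E" "\<forall>g\<in>E. cm d g \<in> gamma3 G E" using Z unfolding centre2_def by auto
      then show "d \<in> gamma2 G E" using sep unfolding separated_def E_def[symmetric] by blast
    qed
    ultimately show ?thesis unfolding balanced_def E_def by blast
  qed
qed

end

text \<open>\<open>separated\<close> and \<open>balanced\<close> speak of the new group alone and so
  pass through the embedding. Its relation to \<open>M\<close> is carried by
  \<open>tame\<close>.\<close>

lemma adjoin_generic:
  assumes ec: "existentially_closed_T3 M" and C: "subgroup C M" "finite C" "C \<noteq> {\<one>\<^bsub>M\<^esub>}"
    and lcs: "C \<inter> gamma2 M (carrier M) \<subseteq> gamma2 M C" "C \<inter> gamma3 M (carrier M) \<subseteq> gamma3 M C"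
  shows "\<exists>b\<in>carrier M. finite (generate M (C \<union> {b})) \<and>
    tame M (carrier M) (carrier M) C (generate M (C \<union> {b})) \<and> separated M (generate M (C \<union> {b})) \<and>
    (separated M C \<longrightarrow> balanced M (generate M (C \<union> {b})))"
proof -
  have M: "exponent3_group M" using ec by (simp add: existentially_closed_T3_def model_T3_iff)
  obtain N :: "'a generic monoid" and h a
    where h: "exponent3_embedding M N h" and ga: "generic_in N (carrier N) (h ` carrier M) a"
    by (rule generic_exists[OF M]) (rule that; assumption)
  interpret h: exponent3_embedding M N h by fact
  note Da = h.B.generic_inD[OF ga]
  have Cc: "C \<subseteq> carrier M" using subgroup.subset[OF C(1)] .
  have hC: "subgroup (h ` C) N" "h ` C \<subseteq> h ` carrier M" "finite (h ` C)" "h ` C \<subseteq> carrier N"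
    using h.f.subgroup_img_is_subgroup[OF C(1)] Cc C(2) by auto
  define D where "D = generate N (h ` C \<union> {a})"
  have Ds: "subgroup D N" unfolding D_def using hC(4) Da(3) by (intro h.B.generate_is_subgroup) auto
  have fD: "finite D" unfolding D_def using h.B.finite_adjoin[OF hC(1,3) Da(3)] .
  have Dc: "D \<subseteq> carrier N" using subgroup.subset[OF Ds] .
  have sub: "h ` C \<subseteq> D" unfolding D_def using generate.incl[of _ "h ` C \<union> {a}" N] by blast
  have t: "tame N (carrier N) (h ` carrier M) (h ` C) D" unfolding D_def by (rule h.B.generic_tame[OF ga hC(1,2)])
  have hC1: "h ` C \<noteq> {\<one>\<^bsub>N\<^esub>}"
  proof
    assume "h ` C = {\<one>\<^bsub>N\<^esub>}"
    then have "h ` C = h ` {\<one>\<^bsub>M\<^esub>}" by simp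
    then have "C = {\<one>\<^bsub>M\<^esub>}" using inj_on_image_eq_iff[OF h.f_inj Cc, of "{\<one>\<^bsub>M\<^esub>}"] by simp
    then show False using C(3) by simp
  qed
  have l2: "h ` C \<inter> gamma2 N (h ` carrier M) \<subseteq> gamma2 N (h ` C)"
    unfolding h.f.gamma2_image[OF subset_refl] h.f.gamma2_image[OF Cc]
      h.image_Int[OF Cc h.gamma2_carrier[OF subset_refl], symmetric]
    by (rule image_mono[OF lcs(1)])
  have l3: "h ` C \<inter> gamma3 N (h ` carrier M) \<subseteq> gamma3 N (h ` C)"
    unfolding h.f.gamma3_image[OF subset_refl] h.f.gamma3_image[OF Cc]
      h.image_Int[OF Cc h.gamma3_carrier[OF subset_refl], symmetric]
    by (rule image_mono[OF lcs(2)])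
  have sep: "separated N D" unfolding D_def by (rule h.B.generic_separated(1)[OF ga hC(1,2) hC1 l2 l3])
  have bal: "balanced N D" if "separated M C"
    unfolding D_def using h.B.generic_separated(2)[OF ga hC(1,2) hC1 l2 l3] h.separated_image[OF Cc] that by blast
  obtain f where f: "exponent3_embedding (N\<lparr>carrier := D\<rparr>) M f" "\<And>c. c \<in> C \<Longrightarrow> f (h c) = c"
    "tame M (carrier M) (carrier M) C (f ` D)"
    by (rule transfer_to_existentially_closed[OF ec h C(1,2) Ds fD sub t]) (rule that; assumption)
  interpret f: exponent3_embedding "N\<lparr>carrier := D\<rparr>" M f by fact
  interpret i: exponent3_embedding "N\<lparr>carrier := D\<rparr>" N id by (rule h.B.inclusion_embedding[OF Ds])
  have "f ` (h ` C \<union> {a}) = C \<union> {f a}" using f(2) by (force simp: image_Un image_image)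
  then have e: "f ` D = generate M (C \<union> {f a})"
    using generate_image_on[OF h.B.is_group h.A.is_group Ds D_def f.f_hom] by simp
  have aD: "a \<in> D" unfolding D_def by (rule generate.incl) simp
  have "separated M (f ` D)" using f.separated_image[of D] i.separated_image[of D] sep by simp
  moreover have "separated M C \<longrightarrow> balanced M (f ` D)"
    using f.balanced_image[of D] i.balanced_image[of D] bal by simp
  ultimately have "finite (f ` D) \<and> tame M (carrier M) (carrier M) C (f ` D) \<and> separated M (f ` D) \<and>
    (separated M C \<longrightarrow> balanced M (f ` D))" using f(3) fD by blast
  moreover have "f a \<in> carrier M" using f.f.hom_closed[of a] aD by simp
  ultimately show ?thesis unfolding e by blast
qed

section \<open>Counting generators\<close>

context exponent3_group
begin

text \<open>The second condition on s says that s normalises \<open>K\<close>, so the products p k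
  with p in {\<one>, s, s^2} already form a subgroup.\<close>

lemma card_adjoin_le:
  assumes K: "subgroup K G" "finite K" and s: "s \<in> carrier G" "\<And>k. k \<in> K \<Longrightarrow> cm s k \<in> K"
  shows "finite (generate G (K \<union> {s})) \<and> card (generate G (K \<union> {s})) \<le> 3 * card K"
proof -
  define P where "P = {\<one>, s, s \<otimes> s}"
  define T where "T = (\<lambda>(p, k). p \<otimes> k) ` (P \<times> K)"
  note Kc = subgroup.mem_carrier[OF K(1)] and Km = subgroup.m_closed[OF K(1)]
  have Pc: "p \<in> carrier G" if "p \<in> P" for p using that s by (auto simp: P_def)
  have sk: "\<exists>k'\<in>K. s \<otimes> k = k' \<otimes> s" if "k \<in> K" for k
    using cm_swap[OF s(1) Kc[OF that]] Km[OF s(2)[OF that] that] Kc[OF that] Kc[OF s(2)[OF that]] s(1)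
    by (auto simp: m_assoc[symmetric])
  \<comment> \<open>\<open>sk\<close> is conjugation by s; the other direction is conjugation by
    s^-1 = s^2, so \<open>sk\<close> is used twice.\<close>
  have sK: "\<exists>k'\<in>K. k \<otimes> s = s \<otimes> k'" if k: "k \<in> K" for k
  proof -
    obtain k1 where k1: "k1 \<in> K" "s \<otimes> k = k1 \<otimes> s" using sk[OF k] by blast
    obtain k2 where k2: "k2 \<in> K" "s \<otimes> k1 = k2 \<otimes> s" using sk[OF k1(1)] by blast
    note c = Kc[OF k] Kc[OF k1(1)] Kc[OF k2(1)] s(1)
    have "s \<otimes> (k2 \<otimes> s) = s \<otimes> (s \<otimes> k1)" by (simp only: k2(2))
    also have "\<dots> = inv s \<otimes> k1" using c inv_square[OF s(1)] by (simp add: m_assoc[symmetric])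
    also have "k1 = s \<otimes> k \<otimes> inv s" using k1(2) c by (simp add: m_assoc)
    also have "inv s \<otimes> (s \<otimes> k \<otimes> inv s) = k \<otimes> inv s" using c by (simp add: m_assoc inv_cancel)
    finally have "s \<otimes> k2 \<otimes> s \<otimes> s = k \<otimes> inv s \<otimes> s" using c by (simp add: m_assoc)
    then have "k = s \<otimes> k2 \<otimes> (s \<otimes> s)" using c by (simp add: m_assoc)
    then have "k \<otimes> s = s \<otimes> k2 \<otimes> (s \<otimes> s \<otimes> s)" using c by (simp add: m_assoc)
    then have "k \<otimes> s = s \<otimes> k2" using cube[OF s(1)] c by simp
    then show ?thesis using k2(1) by blast
  qed
  have PK: "\<exists>k'\<in>K. k \<otimes> p = p \<otimes> k'" if k: "k \<in> K" and p: "p \<in> P" for k p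
  proof -
    have "\<exists>k'\<in>K. k \<otimes> \<one> = \<one> \<otimes> k'" using k Kc[OF k] by (intro bexI[of _ k]) simp_all
    moreover have "\<exists>k'\<in>K. k \<otimes> (s \<otimes> s) = s \<otimes> s \<otimes> k'"
    proof -
      obtain k1 where k1: "k1 \<in> K" "k \<otimes> s = s \<otimes> k1" using sK[OF k] by blast
      obtain k2 where k2: "k2 \<in> K" "k1 \<otimes> s = s \<otimes> k2" using sK[OF k1(1)] by blast
      note c = Kc[OF k] Kc[OF k1(1)] Kc[OF k2(1)] s(1)
      have "k \<otimes> (s \<otimes> s) = k \<otimes> s \<otimes> s" using c by (simp add: m_assoc)
      also have "\<dots> = s \<otimes> (k1 \<otimes> s)" unfolding k1(2) using c by (simp add: m_assoc)
      also have "\<dots> = s \<otimes> s \<otimes> k2" unfolding k2(2) using c by (simp add: m_assoc)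
      finally show ?thesis using k2(1) by blast
    qed
    ultimately show ?thesis using p sK[OF k] unfolding P_def by blast
  qed
  have TT: "x \<otimes> y \<in> T" if x: "x \<in> T" and y: "y \<in> T" for x y
  proof -
    obtain p k where p: "p \<in> P" "k \<in> K" "x = p \<otimes> k" using x by (auto simp: T_def)
    obtain q j where q: "q \<in> P" "j \<in> K" "y = q \<otimes> j" using y by (auto simp: T_def)
    obtain k' where k': "k' \<in> K" "k \<otimes> q = q \<otimes> k'" using PK[OF p(2) q(1)] by blast
    note c = Pc[OF p(1)] Pc[OF q(1)] Kc[OF p(2)] Kc[OF q(2)] Kc[OF k'(1)]
    have "x \<otimes> y = p \<otimes> (k \<otimes> q) \<otimes> j" unfolding p(3) q(3) using c by (simp add: m_assoc)
    also have "\<dots> = (p \<otimes> q) \<otimes> (k' \<otimes> j)" unfolding k'(2) using c by (simp add: m_assoc)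
    finally have "x \<otimes> y = (\<lambda>(p, k). p \<otimes> k) (p \<otimes> q, k' \<otimes> j)" by simp
    moreover have "p \<otimes> q \<in> P" using pow_set_mult[OF s(1)] p(1) q(1) unfolding P_def by blast
    ultimately show ?thesis unfolding T_def using Km[OF k'(1) q(2)] by blast
  qed
  have oneK: "\<one> \<in> K" using subgroup.one_closed[OF K(1)] .
  have KT: "k \<in> T" if "k \<in> K" for k
    unfolding T_def using that Kc[OF that] by (intro image_eqI[of _ _ "(\<one>, k)"]) (auto simp: P_def)
  have "subgroup T G"
  proof (rule subgroupI_mult)
    show "T \<subseteq> carrier G" using Pc Kc by (auto simp: T_def)
    show "T \<noteq> {}" using KT[OF oneK] by blast
  qed (rule TT)
  moreover have "K \<union> {s} \<subseteq> T"
  proof -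
    have "s \<in> T" unfolding T_def using oneK s(1) by (intro image_eqI[of _ _ "(s, \<one>)"]) (auto simp: P_def)
    then show ?thesis using KT by blast
  qed
  ultimately have gT: "generate G (K \<union> {s}) \<subseteq> T" by (rule generate_subgroup_incl[rotated])
  have fT: "finite T" unfolding T_def P_def using K(2) by simp
  have "card P \<le> 3" unfolding P_def by (simp add: card_insert_if)
  moreover have "card T \<le> card (P \<times> K)" unfolding T_def P_def using K(2) by (intro card_image_le) simp
  ultimately have "card T \<le> 3 * card K" by (metis card_cartesian_product mult_le_mono1 order_trans)
  then show ?thesis using gT fT by (meson card_mono finite_subset order_trans)
qed

text \<open>All commutators of \<open>L\<close> lie in \<open>K\<close>, so each subgroup between
  \<open>K\<close> and \<open>L\<close> is normalised by \<open>L\<close>, and the elements of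
  \<open>S\<close> can be adjoined singly.\<close>

lemma card_adjoin_set_le:
  assumes K: "subgroup K G" "finite K" and L: "subgroup L G" "K \<subseteq> L" "\<And>x y. x \<in> L \<Longrightarrow> y \<in> L \<Longrightarrow> cm x y \<in> K"
    and S: "finite S" "S \<subseteq> L"
  shows "finite (generate G (K \<union> S)) \<and> card (generate G (K \<union> S)) \<le> 3 ^ card S * card K"
  using S
proof (induction S)
  case empty
  then show ?case using generate_self[OF K(1)] K(2) by simp
next
  case (insert s S)
  define Q where "Q = generate G (K \<union> S)"
  have Lc: "L \<subseteq> carrier G" using subgroup.subset[OF L(1)] .
  have KSL: "K \<union> S \<subseteq> L" using insert.prems L(2) by blast
  then have KSc: "K \<union> S \<subseteq> carrier G" using Lc by blast
  have Q: "subgroup Q G" unfolding Q_def by (rule generate_is_subgroup[OF KSc])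
  have QL: "Q \<subseteq> L" unfolding Q_def by (rule generate_subgroup_incl[OF KSL L(1)])
  have KQ: "K \<subseteq> Q" unfolding Q_def using generate.incl[of _ "K \<union> S" G] by blast
  have IH: "finite Q" "card Q \<le> 3 ^ card S * card K" using insert.IH insert.prems unfolding Q_def by auto
  have sL: "s \<in> L" "s \<in> carrier G" using insert.prems Lc by auto
  have "cm s k \<in> Q" if "k \<in> Q" for k using L(3)[OF sL(1)] QL KQ that by blast
  then have 1: "finite (generate G (Q \<union> {s})) \<and> card (generate G (Q \<union> {s})) \<le> 3 * card Q"
    by (rule card_adjoin_le[OF Q IH(1) sL(2)])
  have "generate G (Q \<union> {s}) = generate G (K \<union> insert s S)"
    unfolding Q_def using generate_adjoin[OF KSc, of "{s}"] sL(2) by simp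
  moreover have "3 * card Q \<le> 3 ^ card (insert s S) * card K" using IH(2) insert.hyps by simp
  ultimately show ?case using 1 by simp
qed

text \<open>The quotient of \<open>C\<close> by its derived subgroup is elementary abelian and
  spanned by the image of \<open>S\<close>.\<close>

lemma card_le_gamma2:
  assumes C: "C = generate G S" "finite S" "S \<subseteq> carrier G" "finite C"
  shows "card C \<le> 3 ^ card S * card (gamma2 G C)"
proof -
  have Cs: "subgroup C G" unfolding C(1) by (rule generate_is_subgroup[OF C(3)])
  have Cc: "C \<subseteq> carrier G" using subgroup.subset[OF Cs] .
  have g: "gamma2 G C \<subseteq> C" by (rule gamma2_sub[OF Cs])
  have SC: "S \<subseteq> C" unfolding C(1) using generate.incl[of _ S G] by blast
  have f: "finite (generate G (gamma2 G C \<union> S)) \<and> card (generate G (gamma2 G C \<union> S)) \<le> 3 ^ card S * card (gamma2 G C)"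
    using card_adjoin_set_le[OF gamma2_subgroup[OF Cc] finite_subset[OF g C(4)] Cs g _ C(2) SC] cm_gamma2 by blast
  have "C \<subseteq> generate G (gamma2 G C \<union> S)" unfolding C(1)[symmetric]
    using mono_generate[of S "gamma2 G C \<union> S"] C(1) by blast
  then show ?thesis using f by (meson card_mono order_trans)
qed

text \<open>Modulo \<open>\<gamma>\<^sub>3(C)\<close> the commutator is bilinear, so
  \<open>\<gamma>\<^sub>2(C)\<close> is spanned there by the [s, t] with s, t in \<open>S\<close>.
  Counting all ordered pairs is the source of the n^2 in the final bound.\<close>

lemma card_gamma2_le_gamma3:
  assumes C: "C = generate G S" "finite S" "S \<subseteq> carrier G" "finite C"
  shows "card (gamma2 G C) \<le> 3 ^ (card S * card S) * card (gamma3 G C)"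
proof -
  have Cs: "subgroup C G" unfolding C(1) by (rule generate_is_subgroup[OF C(3)])
  have Cc: "C \<subseteq> carrier G" using subgroup.subset[OF Cs] .
  have SC: "S \<subseteq> C" unfolding C(1) using generate.incl[of _ S G] by blast
  have g2: "subgroup (gamma2 G C) G" and g3: "subgroup (gamma3 G C) G"
    using gamma2_subgroup[OF Cc] gamma3_subgroup[OF Cc] .
  have g32: "gamma3 G C \<subseteq> gamma2 G C" by (rule gamma3_sub_gamma2[OF Cs])
  have g2C: "gamma2 G C \<subseteq> C" by (rule gamma2_sub[OF Cs])
  define U where "U = (\<lambda>(s, t). cm s t) ` (S \<times> S)"
  have U: "finite U" "card U \<le> card S * card S" "U \<subseteq> gamma2 G C"
  proof -
    show "finite U" unfolding U_def using C(2) by simp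
    show "card U \<le> card S * card S" unfolding U_def card_cartesian_product[symmetric]
      using C(2) by (intro card_image_le) simp
    show "U \<subseteq> gamma2 G C" unfolding U_def using cm_gamma2 SC by auto
  qed
  define Q where "Q = generate G (gamma3 G C \<union> U)"
  have "cm x y \<in> gamma3 G C" if "x \<in> gamma2 G C" "y \<in> gamma2 G C" for x y
    using cm_gamma3[OF that(1)] g2C that(2) by blast
  then have f: "finite Q \<and> card Q \<le> 3 ^ card U * card (gamma3 G C)"
    unfolding Q_def
    using card_adjoin_set_le[OF g3 finite_subset[OF g32 finite_subset[OF g2C C(4)]] g2 g32 _ U(1,3)] by blast
  have Q: "subgroup Q G" unfolding Q_def using g32 U(3) subgroup.subset[OF g2] by (intro generate_is_subgroup) blast
  have g3Q: "gamma3 G C \<subseteq> Q" unfolding Q_def using generate.incl[of _ "gamma3 G C \<union> U" G] by blast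
  have cQ: "cm x (cm y z) \<in> Q" if "x \<in> C" "y \<in> C" "z \<in> C" for x y z
  proof -
    have "cm (cm y z) x \<in> Q" using cm_gamma3[OF cm_gamma2[OF that(2,3)] that(1)] g3Q by blast
    then have "inv (cm (cm y z) x) \<in> Q" by (rule subgroup.m_inv_closed[OF Q])
    moreover have "inv (cm (cm y z) x) = cm x (cm y z)" by (rule inv_cm) (use that Cc in auto)
    ultimately show ?thesis by simp
  qed
  have one: "cm x \<one> \<in> Q" "cm \<one> x \<in> Q" if "x \<in> C" for x
    using cm_one[of x] that Cc subgroup.one_closed[OF Q] by auto
  \<comment> \<open>Commutators are multiplicative in each argument up to triple commutators, which
    \<open>cQ\<close> puts into Q. So membership in Q extends from generators to \<open>C\<close>,
    first in the left argument and then, in \<open>B\<close>, in the right one.\<close>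
  have A: "cm a s \<in> Q" if a: "a \<in> C" and s: "s \<in> S" for a s
  proof -
    let ?W = "{a \<in> C. cm a s \<in> Q}"
    have sC: "s \<in> C" using s SC by blast
    have "subgroup ?W G"
    proof (rule subgroupI_mult)
      show "?W \<noteq> {}" using one(2)[OF sC] subgroup.one_closed[OF Cs] by auto
      fix x y assume xy: "x \<in> ?W" "y \<in> ?W"
      have c: "x \<in> carrier G" "y \<in> carrier G" "s \<in> carrier G" using xy sC Cc by auto
      have "cm x (cm y s) \<otimes> cm y s \<otimes> cm x s \<in> Q"
        using xy sC cQ subgroup.m_closed[OF Q] by auto
      then show "x \<otimes> y \<in> ?W" using xy subgroup.m_closed[OF Cs] cm_mult_left[OF c] by auto
    qed (use Cc in auto)
    moreover have "S \<subseteq> ?W"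
    proof
      fix r assume r: "r \<in> S"
      then have "cm r s \<in> U" unfolding U_def using s by auto
      then show "r \<in> ?W" using r SC generate.incl[of "cm r s" "gamma3 G C \<union> U" G] unfolding Q_def by blast
    qed
    ultimately have "C \<subseteq> ?W" unfolding C(1)[symmetric] using generate_subgroup_incl[of S ?W] C(1) by blast
    then show ?thesis using a by blast
  qed
  have B: "cm a b \<in> Q" if a: "a \<in> C" and b: "b \<in> C" for a b
  proof -
    let ?W = "{b \<in> C. cm a b \<in> Q}"
    have "subgroup ?W G"
    proof (rule subgroupI_mult)
      show "?W \<noteq> {}" using one(1)[OF a] subgroup.one_closed[OF Cs] by auto
      fix x y assume xy: "x \<in> ?W" "y \<in> ?W"
      have c: "a \<in> carrier G" "x \<in> carrier G" "y \<in> carrier G" using xy a Cc by auto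
      have "cm a x \<otimes> cm x (cm a y) \<otimes> cm a y \<in> Q"
        using xy a cQ subgroup.m_closed[OF Q] by auto
      then show "x \<otimes> y \<in> ?W" using xy subgroup.m_closed[OF Cs] cm_mult_right[OF c] by auto
    qed (use Cc in auto)
    moreover have "S \<subseteq> ?W" using A[OF a] SC by blast
    ultimately have "C \<subseteq> ?W" unfolding C(1)[symmetric] using generate_subgroup_incl[of S ?W] C(1) by blast
    then show ?thesis using b by blast
  qed
  have "gamma2 G C \<subseteq> Q" unfolding gamma2_def by (rule commutator_subgroup_incl[OF Q B])
  then have "card (gamma2 G C) \<le> 3 ^ card U * card (gamma3 G C)" using f by (meson card_mono order_trans)
  also have "\<dots> \<le> 3 ^ (card S * card S) * card (gamma3 G C)"
    using U(2) by (intro mult_le_mono1 power_increasing) auto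
  finally show ?thesis .
qed

text \<open>Neither x nor x^2 = x^-1 lies in \<open>K\<close>, so the cosets K, x K and x^2 K are
  disjoint.\<close>

lemma card_proper_subgroup:
  assumes K: "subgroup K G" and L: "subgroup L G" "finite L" "K \<subseteq> L" and x: "x \<in> L" "x \<notin> K"
  shows "3 * card K \<le> card L"
proof -
  note Kc = subgroup.mem_carrier[OF K] and Lc = subgroup.mem_carrier[OF L(1)]
  have xc: "x \<in> carrier G" using Lc x by blast
  have xx: "x \<otimes> x \<notin> K" using subgroup.m_inv_closed[OF K, of "inv x"] inv_square[OF xc] xc x(2) by auto
  have ix: "inv x \<notin> K" using subgroup.m_inv_closed[OF K, of "inv x"] xc x(2) by auto
  have cos: "j \<otimes> inv k \<in> K" if "j \<in> K" "k \<in> K" for j k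
    using that subgroup.m_closed[OF K] subgroup.m_inv_closed[OF K] by blast
  have d1: "K \<inter> (\<otimes>) x ` K = {}"
  proof -
    have False if j: "j \<in> K" "j = x \<otimes> k" "k \<in> K" for j k
    proof -
      have "j \<otimes> inv k = x" using j Kc xc by (simp add: m_assoc)
      then show False using cos[OF j(1,3)] x(2) by simp
    qed
    then show ?thesis by blast
  qed
  have d2: "(K \<union> (\<otimes>) x ` K) \<inter> (\<otimes>) (x \<otimes> x) ` K = {}"
  proof -
    have False if j: "j \<in> K" "j = x \<otimes> x \<otimes> k" "k \<in> K" for j k
    proof -
      have "j \<otimes> inv k = x \<otimes> x" using j Kc xc by (simp add: m_assoc)
      then show False using cos[OF j(1,3)] xx by simp
    qed
    moreover have False if j: "j \<in> K" "x \<otimes> j = x \<otimes> x \<otimes> k" "k \<in> K" for j k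
    proof -
      have "j = x \<otimes> k" using j Kc xc by (simp add: m_assoc)
      then show False using d1 j by blast
    qed
    ultimately show ?thesis by blast
  qed
  have fK: "finite K" using L(3,2) by (rule finite_subset)
  have cc: "card ((\<otimes>) y ` K) = card K" if "y \<in> carrier G" for y
    using that Kc by (intro card_image inj_onI) (metis l_cancel)
  have "card (K \<union> (\<otimes>) x ` K \<union> (\<otimes>) (x \<otimes> x) ` K) = card K + card K + card K"
    using d1 d2 fK cc xc by (simp add: card_Un_disjoint)
  moreover have sub: "K \<union> (\<otimes>) x ` K \<union> (\<otimes>) (x \<otimes> x) ` K \<subseteq> L"
    using L(3) x(1) subgroup.m_closed[OF L(1)] by blast
  ultimately show ?thesis using card_mono[OF L(2) sub] by linarith
qed

lemma tame_refl: "subgroup C G \<Longrightarrow> tame G H H C C"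
  unfolding tame_def spread2_def[of G H C C] spread3_def[of G H C C]
  by (intro conjI subsetI generate.incl) simp_all

text \<open>Once the elements of \<open>C\<close> in \<open>\<gamma>\<^sub>i(H)\<close> are absorbed
  into \<open>\<gamma>\<^sub>i(D)\<close>, both spreads collapse into
  \<open>\<gamma>\<^sub>i(D)\<close>.\<close>

lemma tame_complete:
  assumes t: "tame G K H C D" and D: "D \<subseteq> carrier G"
    and c: "C \<inter> gamma2 G H \<subseteq> gamma2 G D" "C \<inter> gamma3 G H \<subseteq> gamma3 G D"
  shows "D \<inter> gamma2 G K \<subseteq> gamma2 G D" "D \<inter> gamma3 G K \<subseteq> gamma3 G D"
proof -
  have 2: "spread2 G H C D \<subseteq> gamma2 G D"
    unfolding spread2_def using c(1) by (intro generate_subgroup_incl[OF _ gamma2_subgroup[OF D]]) blast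
  have "{cm l g |l g. l \<in> spread2 G H C D \<and> g \<in> D} \<subseteq> gamma3 G D"
    using 2 cm_gamma3 by blast
  then have 3: "spread3 G H C D \<subseteq> gamma3 G D"
    unfolding spread3_def using c(2) by (intro generate_subgroup_incl[OF _ gamma3_subgroup[OF D]]) blast
  show "D \<inter> gamma2 G K \<subseteq> gamma2 G D" "D \<inter> gamma3 G K \<subseteq> gamma3 G D" using 2 3 t unfolding tame_def by blast+
qed

text \<open>
  Each step enlarges \<open>B \<inter> g D\<close>, a subgroup of the finite 3-group \<open>B\<close>, so its order is at least
  tripled; hence \<open>r\<close> steps suffice.
\<close>

lemma absorb:
  fixes g :: "'a set \<Rightarrow> 'a set"
  assumes A: "subgroup A G" "finite A" and B: "subgroup B G" "B \<subseteq> A" "T \<subseteq> B"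
    and g: "\<And>D. D \<subseteq> carrier G \<Longrightarrow> subgroup (g D) G" "\<And>D E. D \<subseteq> E \<Longrightarrow> g D \<subseteq> g E"
    and card: "card B \<le> 3 ^ r * card (B \<inter> g A)"
    and step: "\<And>D c. \<lbrakk>subgroup D G; finite D; A \<subseteq> D; c \<in> T\<rbrakk> \<Longrightarrow>
      \<exists>Y\<subseteq>carrier G. finite Y \<and> card Y \<le> m \<and> finite (generate G (D \<union> Y)) \<and>
        tame G (carrier G) (carrier G) D (generate G (D \<union> Y)) \<and> c \<in> g (generate G (D \<union> Y))"
  shows "\<exists>Y\<subseteq>carrier G. finite Y \<and> card Y \<le> m * r \<and> finite (generate G (A \<union> Y)) \<and>
    tame G (carrier G) (carrier G) A (generate G (A \<union> Y)) \<and> T \<subseteq> g (generate G (A \<union> Y))"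
proof -
  have Ac: "A \<subseteq> carrier G" using subgroup.subset[OF A(1)] .
  have fB: "finite B" using B(2) A(2) by (rule finite_subset)
  have Bg: "subgroup (B \<inter> g D) G" if "D \<subseteq> carrier G" for D
    using subgroups_Inter_pair[OF B(1) g(1)[OF that]] .
  \<comment> \<open>The disjunction allows for early success: unless \<open>T\<close> is already
    absorbed, the order of B \<inter> g D has been tripled j times.\<close>
  have "\<exists>Y\<subseteq>carrier G. finite Y \<and> card Y \<le> m * j \<and> finite (generate G (A \<union> Y)) \<and>
    tame G (carrier G) (carrier G) A (generate G (A \<union> Y)) \<and>
    (T \<subseteq> g (generate G (A \<union> Y)) \<or> 3 ^ j * card (B \<inter> g A) \<le> card (B \<inter> g (generate G (A \<union> Y))))" for j
  proof (induction j)
    case 0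
    show ?case
      by (intro exI[of _ "{}"]) (use generate_self[OF A(1)] A tame_refl[OF A(1)] in auto)
  next
    case (Suc j)
    then obtain Y where Y: "Y \<subseteq> carrier G" "finite Y" "card Y \<le> m * j" "finite (generate G (A \<union> Y))"
      "tame G (carrier G) (carrier G) A (generate G (A \<union> Y))"
      "T \<subseteq> g (generate G (A \<union> Y)) \<or> 3 ^ j * card (B \<inter> g A) \<le> card (B \<inter> g (generate G (A \<union> Y)))"
      by blast
    define D where "D = generate G (A \<union> Y)"
    have AY: "A \<union> Y \<subseteq> carrier G" using Ac Y(1) by blast
    have D: "subgroup D G" unfolding D_def by (rule generate_is_subgroup[OF AY])
    have Dc: "D \<subseteq> carrier G" using subgroup.subset[OF D] .
    have AD: "A \<subseteq> D" unfolding D_def using generate.incl[of _ "A \<union> Y" G] by blast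
    show ?case
    proof (cases "T \<subseteq> g D")
      case True
      then show ?thesis using Y unfolding D_def by (intro exI[of _ Y]) auto
    next
      case False
      then obtain c where c: "c \<in> T" "c \<notin> g D" by blast
      obtain Y' where Y': "Y' \<subseteq> carrier G" "finite Y'" "card Y' \<le> m" "finite (generate G (D \<union> Y'))"
        "tame G (carrier G) (carrier G) D (generate G (D \<union> Y'))" "c \<in> g (generate G (D \<union> Y'))"
        using step[OF D _ AD c(1)] Y(4) unfolding D_def by blast
      define E where "E = generate G (D \<union> Y')"
      have E: "E = generate G (A \<union> (Y \<union> Y'))"
        unfolding E_def D_def using generate_adjoin[OF AY Y'(1)] by (simp add: Un_assoc)
      have DY: "D \<union> Y' \<subseteq> carrier G" using Dc Y'(1) by blast
      have Ec: "E \<subseteq> carrier G" unfolding E_def by (rule generate_incl[OF DY])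
      have DE: "D \<subseteq> E" unfolding E_def using generate.incl[of _ "D \<union> Y'" G] by blast
      have "3 * card (B \<inter> g D) \<le> card (B \<inter> g E)"
      proof (rule card_proper_subgroup[OF Bg[OF Dc] Bg[OF Ec]])
        show "finite (B \<inter> g E)" using fB by simp
        show "B \<inter> g D \<subseteq> B \<inter> g E" using g(2)[OF DE] by blast
        show "c \<in> B \<inter> g E" using c(1) B(3) Y'(6) unfolding E_def by blast
        show "c \<notin> B \<inter> g D" using c(2) by blast
      qed
      moreover have "3 ^ j * card (B \<inter> g A) \<le> card (B \<inter> g D)" using Y(6) False unfolding D_def by blast
      ultimately have "3 ^ Suc j * card (B \<inter> g A) \<le> card (B \<inter> g E)" by simp
      moreover have "tame G (carrier G) (carrier G) A E"
        using tame_trans[OF Y(5)[folded D_def] Y'(5)[folded E_def] AD DE Ec] .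
      moreover have "card (Y \<union> Y') \<le> m * Suc j"
        using card_Un_le[of Y Y'] Y(3) Y'(3) by simp
      ultimately show ?thesis
        using Y(1,2) Y'(1,2,4) E E_def by (intro exI[of _ "Y \<union> Y'"]) simp
    qed
  qed
  from this[of r] obtain Y where Y: "Y \<subseteq> carrier G" "finite Y" "card Y \<le> m * r" "finite (generate G (A \<union> Y))"
      "tame G (carrier G) (carrier G) A (generate G (A \<union> Y))"
      "T \<subseteq> g (generate G (A \<union> Y)) \<or> 3 ^ r * card (B \<inter> g A) \<le> card (B \<inter> g (generate G (A \<union> Y)))"
    by blast
  \<comment> \<open>At j = r the second alternative exhausts \<open>B\<close>, by the assumed bound
    on its order.\<close>
  have "T \<subseteq> g (generate G (A \<union> Y))"
    using Y(6)
  proof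
    assume "3 ^ r * card (B \<inter> g A) \<le> card (B \<inter> g (generate G (A \<union> Y)))"
    then have "card B \<le> card (B \<inter> g (generate G (A \<union> Y)))" using card by simp
    then have "B \<inter> g (generate G (A \<union> Y)) = B" using fB by (intro card_seteq) auto
    then show ?thesis using B(3) by blast
  qed
  then show ?thesis using Y by blast
qed

end

section \<open>Return to the indexed central series, and the final construction\<close>

lemma lower_central_gamma:
  "lower_central G 1 = carrier G" "lower_central G 2 = gamma2 G (carrier G)"
  "lower_central G 3 = gamma3 G (carrier G)"
  by (simp_all add: numeral_2_eq_2 numeral_3_eq_3 gamma2_def gamma3_def)

context exponent3_group
begin

lemma upper_central_1: "upper_central G 1 = Z1"
proof (intro equalityI subsetI)
  fix a assume a: "a \<in> upper_central G 1"
  have "cm a g = \<one>" if "g \<in> carrier G" for g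
    using a that unfolding upper_central_def by (auto dest: spec[of _ "[g]"])
  then show "a \<in> Z1" using a unfolding upper_central_def centre_def by blast
next
  fix a assume "a \<in> Z1"
  then show "a \<in> upper_central G 1"
    unfolding upper_central_def centre_def by (auto simp: length_Suc_conv)
qed

lemma upper_central_2: "upper_central G 2 = Z2"
proof (intro equalityI subsetI)
  fix a assume a: "a \<in> upper_central G 2"
  then have ac: "a \<in> carrier G" unfolding upper_central_def by blast
  have *: "cm (cm a g) h = \<one>" if "g \<in> carrier G" "h \<in> carrier G" for g h
    using a that unfolding upper_central_def by (auto dest: spec[of _ "[g, h]"])
  show "a \<in> Z2" unfolding centre2_def centre_def using * ac by auto
next
  fix a assume "a \<in> Z2"
  then show "a \<in> upper_central G 2"
    unfolding upper_central_def centre2_def centre_def by (auto simp: numeral_2_eq_2 length_Suc_conv)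
qed

lemma upper_central_3: "upper_central G 3 = carrier G"
proof (intro equalityI subsetI)
  fix a assume a: "a \<in> carrier G"
  have *: "cm (cm (cm a g) h) k = \<one>" if "g \<in> carrier G" "h \<in> carrier G" "k \<in> carrier G" for g h k
    using cm_Z1(1)[OF Z2_D(1)[OF cm_in_Z2[OF a that(1)] that(2)] that(3)] .
  then show "a \<in> upper_central G 3"
    unfolding upper_central_def using a by (auto simp: numeral_3_eq_3 length_Suc_conv)
qed (simp add: upper_central_def)

lemma balanced_central_series:
  assumes "balanced G (carrier G)" "i \<in> {1..3}"
  shows "lower_central G i = upper_central G (4 - i)"
proof -
  have 3: "Z1 = gamma3 G (carrier G)" and 2: "Z2 = gamma2 G (carrier G)"
    using assms(1) gamma3_Z1[OF subset_refl] gamma2_Z2[OF subset_refl] unfolding balanced_def by auto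
  consider "i = 1" | "i = 2" | "i = 3" using assms(2) by fastforce
  then show ?thesis
  proof cases
    case 1 then show ?thesis using lower_central_gamma(1)[of G] upper_central_3 by simp
  next
    case 2 then show ?thesis using lower_central_gamma(2)[of G] upper_central_2 \<open>Z2 = _\<close> by simp
  next
    case 3 then show ?thesis using lower_central_gamma(3)[of G] upper_central_1 \<open>Z1 = _\<close> by simp
  qed
qed

lemma balanced_subgroup:
  assumes D: "subgroup D G" and b: "balanced G D"
    and lcs: "D \<inter> gamma2 G (carrier G) \<subseteq> gamma2 G D" "D \<inter> gamma3 G (carrier G) \<subseteq> gamma3 G D"
  shows "(\<forall>i\<in>{1..3}. lower_central (G\<lparr>carrier := D\<rparr>) i = upper_central (G\<lparr>carrier := D\<rparr>) (4 - i)) \<and>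
    LCS_subgroup D G"
proof
  interpret i: exponent3_embedding "G\<lparr>carrier := D\<rparr>" G id by (rule inclusion_embedding[OF D])
  have "balanced (G\<lparr>carrier := D\<rparr>) (carrier (G\<lparr>carrier := D\<rparr>))"
    using i.balanced_image[of D] b by simp
  then show "\<forall>i\<in>{1..3}. lower_central (G\<lparr>carrier := D\<rparr>) i = upper_central (G\<lparr>carrier := D\<rparr>) (4 - i)"
    using i.A.balanced_central_series by blast
  have Dc: "D \<subseteq> carrier G" using subgroup.subset[OF D] .
  have "gamma2 G D = gamma2 G (carrier G) \<inter> D"
    using lcs(1) gamma2_mono[OF Dc] gamma2_sub[OF D] by blast
  moreover have "gamma3 G D = gamma3 G (carrier G) \<inter> D"
    using lcs(2) gamma3_mono[OF Dc] gamma3_sub_gamma2[OF D] gamma2_sub[OF D] by blast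
  ultimately show "LCS_subgroup D G"
    unfolding LCS_subgroup_def lower_central_gamma using D gamma_consistent[OF D D] by simp
qed

end

theorem proposition4p13:
  fixes M :: "('a, 'b) monoid_scheme" and C :: "'a set" and n :: nat
  assumes "existentially_closed_T3 M"
    and "subgroup C M" and "finite C"
    and "generated_by_at_most M C n"
  shows "\<exists>D. subgroup D M \<and> C \<subseteq> D \<and>
    generated_by_at_most M D (15 * n\<^sup>2) \<and>
    (\<forall>i\<in>{1..3}. lower_central (M\<lparr>carrier := D\<rparr>) i = upper_central (M\<lparr>carrier := D\<rparr>) (4 - i)) \<and>
    LCS_subgroup D M"
proof -
  note ec = assms(1) and C = assms(2,3)
  interpret exponent3_group M using ec by (simp add: existentially_closed_T3_def model_T3_iff)
  obtain S where S: "S \<subseteq> carrier M" "finite S" "card S \<le> n" "generate M S = C"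
    using assms(4) unfolding generated_by_at_most_def by blast
  show ?thesis
  \<comment> \<open>A trivial \<open>C\<close> is treated apart: n may be 0, which allows no
    generators, and \<open>generic_separated\<close> starts from a nontrivial group.\<close>
  proof (cases "C = {\<one>\<^bsub>M\<^esub>}")
    case True
    have "gamma2 M C \<subseteq> C" "gamma3 M C \<subseteq> C" using gamma2_sub[OF C(1)] gamma3_sub_gamma2[OF C(1)] by auto
    moreover have one: "\<one>\<^bsub>M\<^esub> \<in> gamma2 M C" "\<one>\<^bsub>M\<^esub> \<in> gamma3 M C"
      using gamma2_subgroup gamma3_subgroup subgroup.subset[OF C(1)] subgroup.one_closed by blast+
    ultimately have "balanced M C" "C \<inter> gamma2 M (carrier M) \<subseteq> gamma2 M C" "C \<inter> gamma3 M (carrier M) \<subseteq> gamma3 M C"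
      unfolding balanced_def centre_def centre2_def using True by auto
    moreover have "generated_by_at_most M C (15 * n\<^sup>2)"
      unfolding generated_by_at_most_def using generate_empty True by (intro exI[of _ "{}"]) auto
    ultimately show ?thesis using balanced_subgroup[OF C(1)] C(1) by blast
  next
    case False
    have n: "1 \<le> n"
    proof (rule ccontr)
      assume "\<not> 1 \<le> n"
      then have "card S = 0" using S(3) by linarith
      then have "S = {}" using S(2) by simp
      then show False using S(4) generate_empty False by simp
    qed
    have Cc: "C \<subseteq> carrier M" using subgroup.subset[OF C(1)] .
    note g2 = gamma2_subgroup and g3 = gamma3_subgroup
    define T2 where "T2 = C \<inter> gamma2 M (carrier M)"
    define T3 where "T3 = C \<inter> gamma3 M (carrier M)"
    have cC: "card C \<le> 3 ^ n * card (gamma2 M C)"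
      using card_le_gamma2[OF S(4)[symmetric] S(2,1) C(2)] S(3)
      by (meson mult_le_mono1 order_trans power_increasing one_le_numeral)
    \<comment> \<open>Progress is measured by C \<inter> \<open>\<gamma>\<^sub>2(D)\<close>. It
      contains \<open>\<gamma>\<^sub>2(C)\<close> from the start, whose index in \<open>C\<close> is
      at most 3^n.\<close>
    have "\<exists>Y\<subseteq>carrier M. finite Y \<and> card Y \<le> 2 * n \<and> finite (generate M (C \<union> Y)) \<and>
      tame M (carrier M) (carrier M) C (generate M (C \<union> Y)) \<and> T2 \<subseteq> gamma2 M (generate M (C \<union> Y))"
    proof (rule absorb[where B = C])
      have "C \<inter> gamma2 M C = gamma2 M C" using gamma2_sub[OF C(1)] by blast
      then show "card C \<le> 3 ^ n * card (C \<inter> gamma2 M C)" using cC by simp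
      show "\<exists>Y\<subseteq>carrier M. finite Y \<and> card Y \<le> 2 \<and> finite (generate M (D \<union> Y)) \<and>
        tame M (carrier M) (carrier M) D (generate M (D \<union> Y)) \<and> c \<in> gamma2 M (generate M (D \<union> Y))"
        if "subgroup D M" "finite D" "C \<subseteq> D" "c \<in> T2" for D c
        using adjoin_commutator[OF ec that(1,2)] that(3,4) unfolding T2_def by blast
    qed (use C g2 gamma2_mono in \<open>auto simp: T2_def\<close>)
    then obtain Y2 where Y2: "Y2 \<subseteq> carrier M" "finite Y2" "card Y2 \<le> 2 * n" "finite (generate M (C \<union> Y2))"
      "tame M (carrier M) (carrier M) C (generate M (C \<union> Y2))" "T2 \<subseteq> gamma2 M (generate M (C \<union> Y2))" by blast
    define D2 where "D2 = generate M (C \<union> Y2)"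
    note Y2 = Y2[folded D2_def]
    have D2: "subgroup D2 M" unfolding D2_def using Cc Y2(1) by (intro generate_is_subgroup) blast
    have CD2: "C \<subseteq> D2" unfolding D2_def using generate.incl[of _ "C \<union> Y2" M] by blast
    \<comment> \<open>The second round starts from D2 but still measures progress inside
      \<open>C\<close>, which keeps the count in terms of n: C \<inter>
      \<open>\<gamma>\<^sub>3(D2)\<close> contains \<open>\<gamma>\<^sub>3(C)\<close>, of index at
      most 3^(n + n^2) in \<open>C\<close>.\<close>
    have "\<exists>Y\<subseteq>carrier M. finite Y \<and> card Y \<le> 3 * (n + n * n) \<and> finite (generate M (D2 \<union> Y)) \<and>
      tame M (carrier M) (carrier M) D2 (generate M (D2 \<union> Y)) \<and> T3 \<subseteq> gamma3 M (generate M (D2 \<union> Y))"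
    proof (rule absorb[where B = C])
      have "card (gamma2 M C) \<le> 3 ^ (card S * card S) * card (gamma3 M C)"
        using card_gamma2_le_gamma3[OF S(4)[symmetric] S(2,1) C(2)] .
      also have "\<dots> \<le> 3 ^ (n * n) * card (gamma3 M C)"
        using S(3) by (intro mult_le_mono1 power_increasing mult_le_mono) auto
      also have "\<dots> \<le> 3 ^ (n * n) * card (C \<inter> gamma3 M D2)"
        using gamma3_mono[OF CD2] gamma3_sub_gamma2[OF C(1)] gamma2_sub[OF C(1)] C(2)
        by (intro mult_le_mono2 card_mono) auto
      finally have "3 ^ n * card (gamma2 M C) \<le> 3 ^ n * (3 ^ (n * n) * card (C \<inter> gamma3 M D2))"
        by (rule mult_le_mono2)
      from order_trans[OF cC this]
      show "card C \<le> 3 ^ (n + n * n) * card (C \<inter> gamma3 M D2)"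
        by (simp only: power_add mult.assoc)
      show "\<exists>Y\<subseteq>carrier M. finite Y \<and> card Y \<le> 3 \<and> finite (generate M (D \<union> Y)) \<and>
        tame M (carrier M) (carrier M) D (generate M (D \<union> Y)) \<and> c \<in> gamma3 M (generate M (D \<union> Y))"
        if "subgroup D M" "finite D" "D2 \<subseteq> D" "c \<in> T3" for D c
        using adjoin_triple_commutator[OF ec that(1,2)] that(3,4) CD2 unfolding T3_def by blast
    qed (use C CD2 D2 Y2(4) g3 gamma3_mono in \<open>auto simp: T3_def\<close>)
    then obtain Y3 where Y3: "Y3 \<subseteq> carrier M" "finite Y3" "card Y3 \<le> 3 * (n + n * n)" "finite (generate M (D2 \<union> Y3))"
      "tame M (carrier M) (carrier M) D2 (generate M (D2 \<union> Y3))" "T3 \<subseteq> gamma3 M (generate M (D2 \<union> Y3))" by blast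
    define D3 where "D3 = generate M (D2 \<union> Y3)"
    note Y3 = Y3[folded D3_def]
    have D2c: "D2 \<subseteq> carrier M" using subgroup.subset[OF D2] .
    have D3: "subgroup D3 M" unfolding D3_def using D2c Y3(1) by (intro generate_is_subgroup) blast
    have D3c: "D3 \<subseteq> carrier M" using subgroup.subset[OF D3] .
    have D23: "D2 \<subseteq> D3" unfolding D3_def using generate.incl[of _ "D2 \<union> Y3" M] by blast
    have t3: "tame M (carrier M) (carrier M) C D3" by (rule tame_trans[OF Y2(5) Y3(5) CD2 D23 D3c])
    have "T2 \<subseteq> gamma2 M D3" using Y2(6) gamma2_mono[OF D23] by blast
    \<comment> \<open>Tameness over \<open>C\<close> allowed only \<open>T2\<close> and
      \<open>T3\<close> as possible excess over \<open>\<gamma>\<^sub>i(D3)\<close>, and both are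
      now absorbed.\<close>
    then have lcs3: "D3 \<inter> gamma2 M (carrier M) \<subseteq> gamma2 M D3" "D3 \<inter> gamma3 M (carrier M) \<subseteq> gamma3 M D3"
      using tame_complete[OF t3 D3c] Y3(6) unfolding T2_def T3_def by blast+
    have ne: "E \<noteq> {\<one>\<^bsub>M\<^esub>}" if "C \<subseteq> E" for E
      using False that subgroup.one_closed[OF C(1)] by blast
    \<comment> \<open>D3 need not be separated, so this generic element is used only to obtain a
      separated D4; the next one, over D4, gives balance.\<close>
    obtain a where a: "a \<in> carrier M" "finite (generate M (D3 \<union> {a}))"
      "tame M (carrier M) (carrier M) D3 (generate M (D3 \<union> {a}))" "separated M (generate M (D3 \<union> {a}))"
      using adjoin_generic[OF ec D3 Y3(4) ne lcs3] CD2 D23 by blast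
    define D4 where "D4 = generate M (D3 \<union> {a})"
    note a = a[folded D4_def]
    have D4: "subgroup D4 M" unfolding D4_def using D3c a(1) by (intro generate_is_subgroup) blast
    have D4c: "D4 \<subseteq> carrier M" using subgroup.subset[OF D4] .
    have D34: "D3 \<subseteq> D4" unfolding D4_def using generate.incl[of _ "D3 \<union> {a}" M] by blast
    have lcs4: "D4 \<inter> gamma2 M (carrier M) \<subseteq> gamma2 M D4" "D4 \<inter> gamma3 M (carrier M) \<subseteq> gamma3 M D4"
      using tame_complete[OF a(3) D4c] lcs3 gamma2_mono[OF D34] gamma3_mono[OF D34] by blast+
    have "C \<subseteq> D4" using CD2 D23 D34 by blast
    then obtain b where b: "b \<in> carrier M" "tame M (carrier M) (carrier M) D4 (generate M (D4 \<union> {b}))"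
      "balanced M (generate M (D4 \<union> {b}))"
      using adjoin_generic[OF ec D4 a(2) ne lcs4] a(4) by blast
    define D5 where "D5 = generate M (D4 \<union> {b})"
    note b = b[folded D5_def]
    have D5: "subgroup D5 M" unfolding D5_def using D4c b(1) by (intro generate_is_subgroup) blast
    have D5c: "D5 \<subseteq> carrier M" using subgroup.subset[OF D5] .
    have D45: "D4 \<subseteq> D5" unfolding D5_def using generate.incl[of _ "D4 \<union> {b}" M] by blast
    have lcs5: "D5 \<inter> gamma2 M (carrier M) \<subseteq> gamma2 M D5" "D5 \<inter> gamma3 M (carrier M) \<subseteq> gamma3 M D5"
      using tame_complete[OF b(2) D5c] lcs4 gamma2_mono[OF D45] gamma3_mono[OF D45] by blast+
    let ?G = "S \<union> Y2 \<union> Y3 \<union> {a} \<union> {b}"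
    have gc: "S \<union> Y2 \<subseteq> carrier M" "S \<union> Y2 \<union> Y3 \<subseteq> carrier M" "S \<union> Y2 \<union> Y3 \<union> {a} \<subseteq> carrier M" "?G \<subseteq> carrier M"
      using S(1) Y2(1) Y3(1) a(1) b(1) by auto
    have e2: "D2 = generate M (S \<union> Y2)" unfolding D2_def S(4)[symmetric] using generate_adjoin[OF S(1) Y2(1)] .
    have e3: "D3 = generate M (S \<union> Y2 \<union> Y3)" unfolding D3_def e2 using generate_adjoin[OF gc(1) Y3(1)] .
    have e4: "D4 = generate M (S \<union> Y2 \<union> Y3 \<union> {a})"
      unfolding D4_def e3 using generate_adjoin[OF gc(2), of "{a}"] a(1) by blast
    have e5: "D5 = generate M ?G" unfolding D5_def e4 using generate_adjoin[OF gc(3), of "{b}"] b(1) by blast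
    have "card ?G \<le> card S + card Y2 + card Y3 + card {a} + card {b}"
      by (intro order_trans[OF card_Un_le] add_mono) simp_all
    also have "\<dots> \<le> n + 2 * n + 3 * (n + n * n) + 1 + 1" using S(3) Y2(3) Y3(3) by simp
    also have "\<dots> \<le> 15 * n\<^sup>2"
    proof -
      \<comment> \<open>With n \<ge> 1 both n and 1 are at most k, so the total 3k + 6n + 2 is at
        most 11k.\<close>
      define k where "k = n * n"
      have "n \<le> k" "1 \<le> k" using n by (simp_all add: k_def Suc_le_eq)
      then show ?thesis unfolding power2_eq_square k_def[symmetric] by simp
    qed
    finally have "generated_by_at_most M D5 (15 * n\<^sup>2)"
      unfolding generated_by_at_most_def using gc(4) S(2) Y2(2) Y3(2) e5
      by (intro exI[of _ ?G]) auto
    then show ?thesis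
      using balanced_subgroup[OF D5 b(3) lcs5] D5 CD2 D23 D34 D45 by blast
  qed
qed

end
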